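(* Let $\mathcal A$ be a Banach ring and let $b$ be a point of $B=\mathcal M(\mathcal A)$. The residue field $\kappa(b)$ of the local ring $\mathcal O_{B,b}$ is a henselian field.
   Context: A Banach ring is a commutative unital ring complete for a submultiplicative norm $\|\cdot\|$. $\mathcal M(\mathcal A)$ is the set of multiplicative seminorms on $\mathcal A$ bounded by $\|\cdot\|$, with the coarsest topology making all maps $|\cdot|_x\mapsto|f|_x$ ($f\in\mathcal A$) continuous. For a point $x$, $\mathcal H(x)$ is the completion of $\mathrm{Frac}(\mathcal A/\ker|\cdot|_x)$. Sections of the structure sheaf $\mathcal O_B$ on an open $U$ are maps $f:U\to\bigsqcup_{x\in U}\mathcal H(x)$ with $f(x)\in\mathcal H(x)$ that are locally uniform limits of elements of the total ring of fractions of $\mathcal A$ without poles (with denominators not vanishing on the set considered). The stalk $\mathcal O_{B,b}$ is a local ring with maximal ideal $\mathfrak m_b=\{f: f(b)=0\}$; $\kappa(b)=\mathcal O_{B,b}/\mathfrak m_b$ is a subfield of $\mathcal H(b)$ and is endowed with the induced absolute value. A valued field is henselian if its absolute value extends uniquely to every algebraic extension; in the ultrametric case this means that its valuation ring is a henselian local ring.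
   Formalization: Denominators of the fractions defining the structure sheaf need only be nonvanishing on the set considered and may be zero divisors; with the total ring of fractions taken literally, stalks need not be local with maximal ideal {f : f(b)=0}, e.g. for k[p,y]/(py,y²) with trivial norm. *)

theory Defs
  imports "HOL-Analysis.Analysis" "HOL-Algebra.Algebra"
begin

section \<open>Banach rings\<close>

text \<open>The norm is only constrained on the carrier. The zero ring is allowed, and the norm of the
  unit is not required to be 1.\<close>

locale banach_ring = cring A for A :: "('a, 'm) ring_scheme" (structure) +
  fixes N :: "'a \<Rightarrow> real"
  assumes norm_nonneg: "f \<in> carrier A \<Longrightarrow> 0 \<le> N f"
    and norm_eq_zero_iff: "f \<in> carrier A \<Longrightarrow> N f = 0 \<longleftrightarrow> f = \<zero>"
    and norm_minus: "f \<in> carrier A \<Longrightarrow> N (\<ominus> f) = N f"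
    and norm_triangle: "\<lbrakk>f \<in> carrier A; g \<in> carrier A\<rbrakk> \<Longrightarrow> N (f \<oplus> g) \<le> N f + N g"
    and norm_submult: "\<lbrakk>f \<in> carrier A; g \<in> carrier A\<rbrakk> \<Longrightarrow> N (f \<otimes> g) \<le> N f * N g"
    and norm_complete:
      "\<lbrakk>range s \<subseteq> carrier A; \<forall>e>0. \<exists>n0. \<forall>m\<ge>n0. \<forall>n\<ge>n0. N (s m \<ominus> s n) < e\<rbrakk>
        \<Longrightarrow> \<exists>l\<in>carrier A. (\<lambda>n. N (s n \<ominus> l)) \<longlonglongrightarrow> 0"

section \<open>The Berkovich spectrum\<close>

definition multiplicative_seminorm :: "('a, 'm) ring_scheme \<Rightarrow> ('a \<Rightarrow> real) \<Rightarrow> bool" where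
  "multiplicative_seminorm A x \<longleftrightarrow>
     (\<forall>f\<in>carrier A. 0 \<le> x f) \<and> x \<zero>\<^bsub>A\<^esub> = 0 \<and> x \<one>\<^bsub>A\<^esub> = 1 \<and>
     (\<forall>f\<in>carrier A. \<forall>g\<in>carrier A. x (f \<oplus>\<^bsub>A\<^esub> g) \<le> x f + x g) \<and>
     (\<forall>f\<in>carrier A. \<forall>g\<in>carrier A. x (f \<otimes>\<^bsub>A\<^esub> g) = x f * x g)"

text \<open>A point is the seminorm itself; extensionality makes it determined by its values on the
  carrier.\<close>

definition spectrum :: "('a, 'm) ring_scheme \<Rightarrow> ('a \<Rightarrow> real) \<Rightarrow> ('a \<Rightarrow> real) set" where
  "spectrum A N = {x \<in> extensional (carrier A).
     multiplicative_seminorm A x \<and> (\<forall>f\<in>carrier A. x f \<le> N f)}"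

definition spectrum_topology ::
    "('a, 'm) ring_scheme \<Rightarrow> ('a \<Rightarrow> real) \<Rightarrow> ('a \<Rightarrow> real) topology" where
  "spectrum_topology A N = topology_generated_by
     {{x \<in> spectrum A N. x f \<in> S} | f S. f \<in> carrier A \<and> open S}"

section \<open>Fraction field of an integral domain\<close>

definition frac_rel :: "('a, 'm) ring_scheme \<Rightarrow> (('a \<times> 'a) \<times> ('a \<times> 'a)) set" where
  "frac_rel R = {((n, d), (n', d')).
     n \<in> carrier R \<and> d \<in> carrier R - {\<zero>\<^bsub>R\<^esub>} \<and> n' \<in> carrier R \<and> d' \<in> carrier R - {\<zero>\<^bsub>R\<^esub>} \<and>
     n \<otimes>\<^bsub>R\<^esub> d' = n' \<otimes>\<^bsub>R\<^esub> d}"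

definition fraction :: "('a, 'm) ring_scheme \<Rightarrow> 'a \<Rightarrow> 'a \<Rightarrow> ('a \<times> 'a) set" where
  "fraction R n d = frac_rel R `` {(n, d)}"

definition frac_field :: "('a, 'm) ring_scheme \<Rightarrow> ('a \<times> 'a) set ring" where
  "frac_field R = \<lparr>
     carrier = (carrier R \<times> (carrier R - {\<zero>\<^bsub>R\<^esub>})) // frac_rel R,
     monoid.mult = (\<lambda>C D. \<Union>(n, d)\<in>C. \<Union>(n', d')\<in>D. fraction R (n \<otimes>\<^bsub>R\<^esub> n') (d \<otimes>\<^bsub>R\<^esub> d')),
     monoid.one = fraction R \<one>\<^bsub>R\<^esub> \<one>\<^bsub>R\<^esub>,
     ring.zero = fraction R \<zero>\<^bsub>R\<^esub> \<one>\<^bsub>R\<^esub>,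
     ring.add = (\<lambda>C D. \<Union>(n, d)\<in>C. \<Union>(n', d')\<in>D.
              fraction R ((n \<otimes>\<^bsub>R\<^esub> d') \<oplus>\<^bsub>R\<^esub> (n' \<otimes>\<^bsub>R\<^esub> d)) (d \<otimes>\<^bsub>R\<^esub> d'))\<rparr>"

section \<open>Absolute values, completion and henselian fields\<close>

definition absolute_value :: "('k, 'm) ring_scheme \<Rightarrow> ('k \<Rightarrow> real) \<Rightarrow> bool" where
  "absolute_value K v \<longleftrightarrow>
     (\<forall>a\<in>carrier K. 0 \<le> v a \<and> (v a = 0 \<longleftrightarrow> a = \<zero>\<^bsub>K\<^esub>)) \<and>
     (\<forall>a\<in>carrier K. \<forall>b\<in>carrier K. v (a \<otimes>\<^bsub>K\<^esub> b) = v a * v b) \<and>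
     (\<forall>a\<in>carrier K. \<forall>b\<in>carrier K. v (a \<oplus>\<^bsub>K\<^esub> b) \<le> v a + v b)"

definition cauchy_ring :: "('k, 'm) ring_scheme \<Rightarrow> ('k \<Rightarrow> real) \<Rightarrow> (nat \<Rightarrow> 'k) ring" where
  "cauchy_ring K v = \<lparr>
     carrier = {s. range s \<subseteq> carrier K \<and>
       (\<forall>e>0. \<exists>n0. \<forall>m\<ge>n0. \<forall>n\<ge>n0. v (s m \<ominus>\<^bsub>K\<^esub> s n) < e)},
     monoid.mult = (\<lambda>s t n. s n \<otimes>\<^bsub>K\<^esub> t n),
     monoid.one = (\<lambda>n. \<one>\<^bsub>K\<^esub>),
     ring.zero = (\<lambda>n. \<zero>\<^bsub>K\<^esub>),
     ring.add = (\<lambda>s t n. s n \<oplus>\<^bsub>K\<^esub> t n)\<rparr>"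

definition null_sequences :: "('k, 'm) ring_scheme \<Rightarrow> ('k \<Rightarrow> real) \<Rightarrow> (nat \<Rightarrow> 'k) set" where
  "null_sequences K v = {s \<in> carrier (cauchy_ring K v). (\<lambda>n. v (s n)) \<longlonglongrightarrow> 0}"

definition completion :: "('k, 'm) ring_scheme \<Rightarrow> ('k \<Rightarrow> real) \<Rightarrow> (nat \<Rightarrow> 'k) set ring" where
  "completion K v = cauchy_ring K v Quot null_sequences K v"

text \<open>Here and below, \<^const>\<open>the_elem\<close> of an image extracts the common value of a function that is
  constant on an equivalence class.\<close>

definition completion_abs :: "('k \<Rightarrow> real) \<Rightarrow> (nat \<Rightarrow> 'k) set \<Rightarrow> real" where
  "completion_abs v C = the_elem ((\<lambda>s. lim (\<lambda>n. v (s n))) ` C)"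

definition completion_embed ::
    "('k, 'm) ring_scheme \<Rightarrow> ('k \<Rightarrow> real) \<Rightarrow> 'k \<Rightarrow> (nat \<Rightarrow> 'k) set" where
  "completion_embed K v a = null_sequences K v +>\<^bsub>cauchy_ring K v\<^esub> (\<lambda>n. a)"

text \<open>An algebraic extension of \<open>K\<close> is a field \<open>L\<close> with a ring homomorphism \<open>h\<close> from \<open>K\<close> to \<open>L\<close>
  over whose image \<open>L\<close> is algebraic. A formula cannot quantify over types, so the type of the
  elements of \<open>L\<close> is a parameter: \<open>K\<close> is henselian when the predicate holds for every type \<open>'l\<close>,
  i.e. with \<open>'l\<close> a free type variable in the conclusion of a theorem.\<close>

definition algebraic_extension ::
    "('k, 'm) ring_scheme \<Rightarrow> ('k \<Rightarrow> 'l) \<Rightarrow> 'l ring \<Rightarrow> bool" where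
  "algebraic_extension K h L \<longleftrightarrow>
     field K \<and> field L \<and> h \<in> ring_hom K L \<and>
     (\<forall>a\<in>carrier L. (ring.algebraic L over (h ` carrier K)) a)"

definition henselian_field ::
    "'l itself \<Rightarrow> ('k, 'm) ring_scheme \<Rightarrow> ('k \<Rightarrow> real) \<Rightarrow> bool" where
  "henselian_field T K v \<longleftrightarrow>
     field K \<and> absolute_value K v \<and>
     (\<forall>(L :: 'l ring) h. algebraic_extension K h L \<longrightarrow>
        (\<exists>!w. w \<in> extensional (carrier L) \<and> absolute_value L w \<and>
              (\<forall>a\<in>carrier K. w (h a) = v a)))"

section \<open>The completed residue field \<open>\<H>(x)\<close>\<close>

type_synonym 'a hfield_elem = "(nat \<Rightarrow> ('a set \<times> 'a set) set) set"

definition seminorm_kernel :: "('a, 'm) ring_scheme \<Rightarrow> ('a \<Rightarrow> real) \<Rightarrow> 'a set" where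
  "seminorm_kernel A x = {f \<in> carrier A. x f = 0}"

definition point_field :: "('a, 'm) ring_scheme \<Rightarrow> ('a \<Rightarrow> real) \<Rightarrow> ('a set \<times> 'a set) set ring" where
  "point_field A x = frac_field (A Quot seminorm_kernel A x)"

definition point_field_abs :: "('a \<Rightarrow> real) \<Rightarrow> ('a set \<times> 'a set) set \<Rightarrow> real" where
  "point_field_abs x E = the_elem ((\<lambda>(C, D). the_elem (x ` C) / the_elem (x ` D)) ` E)"

definition hfield :: "('a, 'm) ring_scheme \<Rightarrow> ('a \<Rightarrow> real) \<Rightarrow> 'a hfield_elem ring" where
  "hfield A x = completion (point_field A x) (point_field_abs x)"

definition hfield_abs :: "('a \<Rightarrow> real) \<Rightarrow> 'a hfield_elem \<Rightarrow> real" where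
  "hfield_abs x = completion_abs (point_field_abs x)"

text \<open>The value \<open>f(x)\<close> in \<open>\<H>(x)\<close> of an element \<open>f\<close> of \<open>A\<close>.\<close>

definition value_at :: "('a, 'm) ring_scheme \<Rightarrow> ('a \<Rightarrow> real) \<Rightarrow> 'a \<Rightarrow> 'a hfield_elem" where
  "value_at A x f = completion_embed (point_field A x) (point_field_abs x)
     (fraction (A Quot seminorm_kernel A x)
        (seminorm_kernel A x +>\<^bsub>A\<^esub> f) (seminorm_kernel A x +>\<^bsub>A\<^esub> \<one>\<^bsub>A\<^esub>))"

section \<open>The structure sheaf\<close>

text \<open>A fraction without poles on \<open>W\<close> is \<open>p / q\<close> with \<open>q\<close> vanishing nowhere on \<open>W\<close>, viewed as the
  function \<open>y \<mapsto> p(y) / q(y)\<close>. As in the localization of \<open>A\<close> at the elements vanishing nowhere on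
  \<open>W\<close>, \<open>q\<close> may be a zero divisor of \<open>A\<close>. (Over an integral domain it never is, for nonempty \<open>W\<close>.)
  Insisting on regular denominators would make the rings of germs below non-local in general: take
  \<open>A = k[p, y] / (p y, y\<^sup>2)\<close> with the trivial norm and the point with \<open>0 < |p| < 1\<close>, at which
  \<open>p\<close> would have no inverse.\<close>

definition uniform_limit_of_fractions ::
    "('a, 'm) ring_scheme \<Rightarrow> ('a \<Rightarrow> real) set \<Rightarrow> (('a \<Rightarrow> real) \<Rightarrow> 'a hfield_elem) \<Rightarrow> bool" where
  "uniform_limit_of_fractions A W f \<longleftrightarrow>
     (\<exists>p q. (\<forall>n::nat. p n \<in> carrier A \<and> q n \<in> carrier A \<and> (\<forall>y\<in>W. y (q n) \<noteq> 0)) \<and>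
        (\<forall>e>0. \<exists>n0. \<forall>n\<ge>n0. \<forall>y\<in>W.
           hfield_abs y (f y \<ominus>\<^bsub>hfield A y\<^esub>
             (value_at A y (p n) \<otimes>\<^bsub>hfield A y\<^esub> inv\<^bsub>hfield A y\<^esub> value_at A y (q n))) < e))"

definition sections ::
    "('a, 'm) ring_scheme \<Rightarrow> ('a \<Rightarrow> real) \<Rightarrow> ('a \<Rightarrow> real) set \<Rightarrow> (('a \<Rightarrow> real) \<Rightarrow> 'a hfield_elem) ring"
  where
  "sections A N U = \<lparr>
     carrier = {f \<in> (\<Pi>\<^sub>E x\<in>U. carrier (hfield A x)).
       \<forall>x\<in>U. \<exists>W. openin (spectrum_topology A N) W \<and> x \<in> W \<and> W \<subseteq> U \<and>
         uniform_limit_of_fractions A W f},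
     monoid.mult = (\<lambda>f g. \<lambda>x\<in>U. f x \<otimes>\<^bsub>hfield A x\<^esub> g x),
     monoid.one = (\<lambda>x\<in>U. \<one>\<^bsub>hfield A x\<^esub>),
     ring.zero = (\<lambda>x\<in>U. \<zero>\<^bsub>hfield A x\<^esub>),
     ring.add = (\<lambda>f g. \<lambda>x\<in>U. f x \<oplus>\<^bsub>hfield A x\<^esub> g x)\<rparr>"

section \<open>Stalks and residue fields\<close>

type_synonym 'a germ = "(('a \<Rightarrow> real) set \<times> (('a \<Rightarrow> real) \<Rightarrow> 'a hfield_elem)) set"

definition local_sections :: "('a, 'm) ring_scheme \<Rightarrow> ('a \<Rightarrow> real) \<Rightarrow> ('a \<Rightarrow> real) \<Rightarrow> 'a germ" where
  "local_sections A N b =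
     {(U, f). openin (spectrum_topology A N) U \<and> b \<in> U \<and> f \<in> carrier (sections A N U)}"

definition germ_rel ::
    "('a, 'm) ring_scheme \<Rightarrow> ('a \<Rightarrow> real) \<Rightarrow> ('a \<Rightarrow> real) \<Rightarrow>
     ((('a \<Rightarrow> real) set \<times> (('a \<Rightarrow> real) \<Rightarrow> 'a hfield_elem)) \<times>
      (('a \<Rightarrow> real) set \<times> (('a \<Rightarrow> real) \<Rightarrow> 'a hfield_elem))) set" where
  "germ_rel A N b = {((U, f), (V, g)).
     (U, f) \<in> local_sections A N b \<and> (V, g) \<in> local_sections A N b \<and>
     (\<exists>W. openin (spectrum_topology A N) W \<and> b \<in> W \<and> W \<subseteq> U \<inter> V \<and> (\<forall>y\<in>W. f y = g y))}"

definition germ ::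
    "('a, 'm) ring_scheme \<Rightarrow> ('a \<Rightarrow> real) \<Rightarrow> ('a \<Rightarrow> real) \<Rightarrow>
     ('a \<Rightarrow> real) set \<Rightarrow> (('a \<Rightarrow> real) \<Rightarrow> 'a hfield_elem) \<Rightarrow> 'a germ" where
  "germ A N b U f = germ_rel A N b `` {(U, f)}"

text \<open>Multiplication and addition in \<^term>\<open>sections A N (U \<inter> V)\<close> only look at values on
  \<open>U \<inter> V\<close>, so the restrictions of \<open>f\<close> and \<open>g\<close> need not be written.\<close>

definition stalk :: "('a, 'm) ring_scheme \<Rightarrow> ('a \<Rightarrow> real) \<Rightarrow> ('a \<Rightarrow> real) \<Rightarrow> 'a germ ring" where
  "stalk A N b = \<lparr>
     carrier = local_sections A N b // germ_rel A N b,
     monoid.mult = (\<lambda>s t. \<Union>(U, f)\<in>s. \<Union>(V, g)\<in>t.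
       germ A N b (U \<inter> V) (f \<otimes>\<^bsub>sections A N (U \<inter> V)\<^esub> g)),
     monoid.one = germ A N b (spectrum A N) \<one>\<^bsub>sections A N (spectrum A N)\<^esub>,
     ring.zero = germ A N b (spectrum A N) \<zero>\<^bsub>sections A N (spectrum A N)\<^esub>,
     ring.add = (\<lambda>s t. \<Union>(U, f)\<in>s. \<Union>(V, g)\<in>t.
       germ A N b (U \<inter> V) (f \<oplus>\<^bsub>sections A N (U \<inter> V)\<^esub> g))\<rparr>"

definition germ_value :: "('a \<Rightarrow> real) \<Rightarrow> 'a germ \<Rightarrow> 'a hfield_elem" where
  "germ_value b s = the_elem ((\<lambda>(U, f). f b) ` s)"

definition stalk_max_ideal ::
    "('a, 'm) ring_scheme \<Rightarrow> ('a \<Rightarrow> real) \<Rightarrow> ('a \<Rightarrow> real) \<Rightarrow> 'a germ set" where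
  "stalk_max_ideal A N b = {s \<in> carrier (stalk A N b). germ_value b s = \<zero>\<^bsub>hfield A b\<^esub>}"

definition residue_field ::
    "('a, 'm) ring_scheme \<Rightarrow> ('a \<Rightarrow> real) \<Rightarrow> ('a \<Rightarrow> real) \<Rightarrow> 'a germ set ring" where
  "residue_field A N b = stalk A N b Quot stalk_max_ideal A N b"

text \<open>The embedding of \<open>\<kappa>(b)\<close> into \<open>\<H>(b)\<close>, and the absolute value it induces.\<close>

definition residue_embed :: "('a \<Rightarrow> real) \<Rightarrow> 'a germ set \<Rightarrow> 'a hfield_elem" where
  "residue_embed b c = the_elem (germ_value b ` c)"

definition residue_abs :: "('a \<Rightarrow> real) \<Rightarrow> 'a germ set \<Rightarrow> real" where
  "residue_abs b c = hfield_abs b (residue_embed b c)"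

end

theory Submission
  imports Defs "HOL-Real_Asymp.Real_Asymp"
begin

text \<open>The residue field \<open>\<kappa>(b)\<close> has the following property of implicit function type: a system
  \<open>t\<^sub>k = \<Sum> \<gamma>\<^sub>i\<^sub>j\<^sub>k t\<^sub>i t\<^sub>j + s\<^sub>k\<close> whose constant terms \<open>s\<^sub>k\<close> are small has a small solution. Indeed the
  coefficients spread out to a neighbourhood \<open>W\<close> of \<open>b\<close>, where fixed point iteration stays within the
  uniform limits of fractions on \<open>W\<close> and converges uniformly, because each field \<open>\<H>(y)\<close> is complete.
  Neither \<open>b\<close> nor the points of \<open>W\<close> need to be ultrametric.

  Let \<open>F\<close> be a finite extension of a valued field \<open>K\<close> with this property, and let \<open>\<rho>\<close> be the spectral
  radius of a norm given by the coordinates in a basis. Since minimal submultiplicative seminorms are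
  multiplicative, \<open>\<rho>\<close> is the maximum of the absolute values on \<open>F\<close> that extend the one of \<open>K\<close>, and
  there are at most \<open>[F : K]\<close> of them. If there were two, weak approximation would give some \<open>z\<close> close
  to 1 for one of them and close to 0 for all the others, so that \<open>\<rho>(z\<^sup>2 - z)\<close> is small. After
  sufficiently many steps \<open>z \<mapsto> 3z\<^sup>2 - 2z\<^sup>3\<close> the norm of \<open>z\<^sup>2 - z\<close> is small, and the property of \<open>K\<close>
  yields an idempotent of \<open>F\<close> close to \<open>z\<close> that is neither 0 nor 1. Hence the extension is unique, and
  the extensions to the finite subextensions of an algebraic extension glue.\<close>

section \<open>Minimal seminorms and the spectral radius\<close>

text \<open>The field \<kappa>(b) is in general not complete: a limit formed at b alone lands in
  \<H>(b). Only a function on a fixed neighbourhood of b that is a uniform limit of fractions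
  returns an element of \<kappa>(b), so an equation has to be solved at all nearby points at once,
  with constants independent of the point. This dictates the form of \<open>quad_henselian\<close>:
  finitely many coefficients, strict bounds at b that persist nearby, and a universal rate of
  contraction. Several unknowns occur because the equation t = t^2 + s behind an idempotent lives in
  a finite extension F, which has no sheaf of its own; in a basis it becomes a quadratic system over
  \<kappa>(b) whose coefficients are the structure constants of F.

  The spectral radius takes the place of the field norm in the construction of extensions, so that
  archimedean and ultrametric points are treated alike. It controls the powers of z^2 - z only up to
  a constant, whereas \<open>quad_henselian\<close> asks for smallness of coordinates; finitely many
  polynomial steps inside F close this gap before the property of the field is used.\<close>

lemmas real_square = power2_eq_square[where 'a=real]

text \<open>Only 1 \<le> p(1) is required, because the coordinate norm of a finite extension need
  not give the unit norm 1. Passing to the spectral radius repairs this.\<close>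

locale submult_seminorm = cring R for R (structure) +
  fixes p :: "'a \<Rightarrow> real"
  assumes nonneg: "x \<in> carrier R \<Longrightarrow> 0 \<le> p x"
    and zero: "p \<zero> = 0"
    and triangle: "\<lbrakk>x \<in> carrier R; y \<in> carrier R\<rbrakk> \<Longrightarrow> p (x \<oplus> y) \<le> p x + p y"
    and submult: "\<lbrakk>x \<in> carrier R; y \<in> carrier R\<rbrakk> \<Longrightarrow> p (x \<otimes> y) \<le> p x * p y"
    and one_ge: "1 \<le> p \<one>"

locale unital_seminorm = submult_seminorm +
  assumes one: "p \<one> = 1"

text \<open>This is the limit of the n-th roots of p(x^n), written as the infimum of the exponential
  rates that dominate the powers. The constant C absorbs changes to an equivalent norm, and upper
  bounds need no limit argument.\<close>

definition spectral_radius :: "('a, 'm) ring_scheme \<Rightarrow> ('a \<Rightarrow> real) \<Rightarrow> 'a \<Rightarrow> real" where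
  "spectral_radius R p x = Inf {r. 0 < r \<and> (\<exists>C. \<forall>n::nat. p (x [^]\<^bsub>R\<^esub> n) \<le> C * r ^ n)}"

context submult_seminorm
begin

lemma pow_le: "x \<in> carrier R \<Longrightarrow> p (x [^] (n::nat)) \<le> p \<one> * p x ^ n"
proof (induction n)
  case (Suc n)
  have "p (x [^] Suc n) \<le> p (x [^] n) * p x" using Suc submult by simp
  also have "\<dots> \<le> (p \<one> * p x ^ n) * p x" using Suc nonneg by (intro mult_right_mono) auto
  finally show ?case by (simp add: ac_simps)
qed simp

lemma spectral_radius_le:
  assumes "0 < r" "\<And>n::nat. p (x [^] n) \<le> C * r ^ n"
  shows "spectral_radius R p x \<le> r"
  unfolding spectral_radius_def
  by (rule cInf_lower) (use assms in \<open>auto intro!: bdd_belowI[where m=0]\<close>)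

lemma spectral_set_nonempty:
  assumes "x \<in> carrier R"
  shows "\<exists>r. 0 < r \<and> (\<exists>C. \<forall>n::nat. p (x [^] n) \<le> C * r ^ n)"
proof (intro exI conjI allI)
  show "0 < p x + 1" using nonneg[OF assms] by simp
  show "p (x [^] n) \<le> p \<one> * (p x + 1) ^ n" for n :: nat
    using pow_le[OF assms, of n] one_ge nonneg[OF assms]
    by (smt (verit) mult_left_mono power_mono)
qed

lemma spectral_radius_nonneg:
  assumes "x \<in> carrier R"
  shows "0 \<le> spectral_radius R p x"
  unfolding spectral_radius_def
  by (rule cInf_greatest) (use spectral_set_nonempty[OF assms] in auto)

lemma spectral_radius_less:
  assumes "x \<in> carrier R" "spectral_radius R p x < r"
  obtains C where "0 < C" "\<And>n::nat. p (x [^] n) \<le> C * r ^ n"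
proof -
  let ?S = "{r. 0 < r \<and> (\<exists>C. \<forall>n::nat. p (x [^] n) \<le> C * r ^ n)}"
  have "\<exists>s\<in>?S. s < r"
    using assms spectral_set_nonempty[OF assms(1)] unfolding spectral_radius_def
    by (subst cInf_less_iff[symmetric]) (auto intro!: bdd_belowI[where m=0])
  then obtain s C where s: "0 < s" "s < r" "\<And>n::nat. p (x [^] n) \<le> C * s ^ n" by auto
  have "p (x [^] n) \<le> max C 1 * r ^ n" for n :: nat
  proof -
    have "p (x [^] n) \<le> C * s ^ n" by (rule s)
    also have "\<dots> \<le> max C 1 * r ^ n" using s by (intro mult_mono power_mono) auto
    finally show ?thesis .
  qed
  then show thesis using that[of "max C 1"] by auto
qed

lemma spectral_radius_le_norm:
  assumes "x \<in> carrier R"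
  shows "spectral_radius R p x \<le> p x"
proof (rule field_le_epsilon)
  fix e :: real assume e: "0 < e"
  have "p (x [^] n) \<le> p \<one> * (p x + e) ^ n" for n :: nat
    using pow_le[OF assms, of n] one_ge nonneg[OF assms] e
    by (smt (verit) mult_left_mono power_mono)
  then show "spectral_radius R p x \<le> p x + e"
    using nonneg[OF assms] e by (intro spectral_radius_le) auto
qed

text \<open>The binomial expansion is bypassed: the induction carries all mixed products (x+y)^n x^k
  y^l with the bound C D (a+b)^n a^k b^l, and each step distributes one factor x+y.\<close>

lemma spectral_radius_add:
  assumes x: "x \<in> carrier R" and y: "y \<in> carrier R"
  shows "spectral_radius R p (x \<oplus> y) \<le> spectral_radius R p x + spectral_radius R p y"
proof (rule field_le_epsilon)
  fix e :: real assume e: "0 < e"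
  define a where "a = spectral_radius R p x + e / 2"
  define b where "b = spectral_radius R p y + e / 2"
  have ab: "0 < a" "0 < b"
    using e spectral_radius_nonneg[OF x] spectral_radius_nonneg[OF y] by (auto simp: a_def b_def)
  obtain C where C: "0 < C" "\<And>n::nat. p (x [^] n) \<le> C * a ^ n"
    using spectral_radius_less[OF x, of a] e by (auto simp: a_def)
  obtain D where D: "0 < D" "\<And>n::nat. p (y [^] n) \<le> D * b ^ n"
    using spectral_radius_less[OF y, of b] e by (auto simp: b_def)
  have "p ((x \<oplus> y) [^] n \<otimes> (x [^] k \<otimes> y [^] l)) \<le> C * D * (a + b) ^ n * a ^ k * b ^ l" for n k l :: nat
  proof (induction n arbitrary: k l)
    case 0
    have "p (x [^] k \<otimes> y [^] l) \<le> p (x [^] k) * p (y [^] l)" using x y submult by simp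
    also have "\<dots> \<le> (C * a ^ k) * (D * b ^ l)"
      using C D x y nonneg ab by (intro mult_mono) auto
    finally show ?case using x y by (simp add: ac_simps)
  next
    case (Suc n)
    have 1: "(x \<oplus> y) [^] Suc n \<otimes> (x [^] k \<otimes> y [^] l) =
        (x \<oplus> y) [^] n \<otimes> (x [^] Suc k \<otimes> y [^] l) \<oplus> (x \<oplus> y) [^] n \<otimes> (x [^] k \<otimes> y [^] Suc l)"
    proof -
      define u where "u = (x \<oplus> y) [^] n"
      define r where "r = x [^] k"
      define s where "s = y [^] l"
      have [simp]: "u \<in> carrier R" "r \<in> carrier R" "s \<in> carrier R" using x y by (auto simp: u_def r_def s_def)
      show ?thesis
        unfolding nat_pow_Suc u_def[symmetric] r_def[symmetric] s_def[symmetric]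
        using x y by (simp add: r_distr m_ac)
    qed
    have "p ((x \<oplus> y) [^] Suc n \<otimes> (x [^] k \<otimes> y [^] l)) \<le>
        C * D * (a + b) ^ n * a ^ Suc k * b ^ l + C * D * (a + b) ^ n * a ^ k * b ^ Suc l"
      unfolding 1 using Suc[of "Suc k" l] Suc[of k "Suc l"] x y
      by (intro order_trans[OF triangle] add_mono) auto
    also have "\<dots> = C * D * (a + b) ^ Suc n * a ^ k * b ^ l" by (simp add: algebra_simps)
    finally show ?case .
  qed
  from this[of _ 0 0] have "p ((x \<oplus> y) [^] n) \<le> C * D * (a + b) ^ n" for n :: nat
    using x y by simp
  then have "spectral_radius R p (x \<oplus> y) \<le> a + b"
    using ab by (intro spectral_radius_le) auto
  then show "spectral_radius R p (x \<oplus> y) \<le> spectral_radius R p x + spectral_radius R p y + e"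
    by (simp add: a_def b_def)
qed

lemma spectral_radius_mult:
  assumes x: "x \<in> carrier R" and y: "y \<in> carrier R"
  shows "spectral_radius R p (x \<otimes> y) \<le> spectral_radius R p x * spectral_radius R p y"
proof -
  let ?a = "spectral_radius R p x" and ?b = "spectral_radius R p y"
  have "spectral_radius R p (x \<otimes> y) \<le> (?a + e) * (?b + e)" if e: "0 < e" for e
  proof -
    obtain C where C: "0 < C" "\<And>n::nat. p (x [^] n) \<le> C * (?a + e) ^ n"
      using spectral_radius_less[OF x, of "?a + e"] e by auto
    obtain D where D: "0 < D" "\<And>n::nat. p (y [^] n) \<le> D * (?b + e) ^ n"
      using spectral_radius_less[OF y, of "?b + e"] e by auto
    have pos: "0 < ?a + e" "0 < ?b + e"
      using e spectral_radius_nonneg[OF x] spectral_radius_nonneg[OF y] by auto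
    have "p ((x \<otimes> y) [^] n) \<le> (C * D) * ((?a + e) * (?b + e)) ^ n" for n :: nat
    proof -
      have "p ((x \<otimes> y) [^] n) \<le> p (x [^] n) * p (y [^] n)"
        using x y submult by (simp add: nat_pow_distrib)
      also have "\<dots> \<le> (C * (?a + e) ^ n) * (D * (?b + e) ^ n)"
        using C D x y nonneg pos by (intro mult_mono) auto
      finally show ?thesis by (simp add: power_mult_distrib ac_simps)
    qed
    then show ?thesis using pos by (intro spectral_radius_le) auto
  qed
  then have ev: "eventually (\<lambda>e. spectral_radius R p (x \<otimes> y) \<le> (?a + e) * (?b + e)) (at_right 0)"
    by (auto simp: eventually_at_right_less eventually_at_filter)
  have "((\<lambda>e. (?a + e) * (?b + e)) \<longlongrightarrow> (?a + 0) * (?b + 0)) (at_right 0)"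
    by (intro tendsto_intros)
  from tendsto_lowerbound[OF this ev] show ?thesis by simp
qed

text \<open>A rate r for the powers of x^2 gives the rate sqrt r for the even powers of x. An odd
  power costs one more factor p(x), which the constant D absorbs.\<close>

lemma spectral_radius_square:
  assumes x: "x \<in> carrier R"
  shows "spectral_radius R p (x \<otimes> x) = spectral_radius R p x ^ 2"
proof (rule antisym)
  show "spectral_radius R p (x \<otimes> x) \<le> spectral_radius R p x ^ 2"
    unfolding real_square by (rule spectral_radius_mult[OF x x])
  have "spectral_radius R p x \<le> sqrt r" if r: "spectral_radius R p (x \<otimes> x) < r" for r
  proof -
    have r0: "0 < r" using r spectral_radius_nonneg[of "x \<otimes> x"] x by simp
    obtain C where C: "0 < C" "\<And>n::nat. p ((x \<otimes> x) [^] n) \<le> C * r ^ n"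
      using spectral_radius_less[OF _ r] x by auto
    define D where "D = C * (1 + p x / sqrt r)"
    have "p (x [^] n) \<le> D * sqrt r ^ n" for n :: nat
    proof -
      define k where "k = n div 2"
      have sq: "(x \<otimes> x) [^] k = x [^] (2 * k)"
        using x by (metis nat_pow_pow numeral_2_eq_2 nat_pow_Suc nat_pow_0 l_one)
      have rk: "r ^ k = sqrt r ^ (2 * k)" using r0 by (simp add: power_mult)
      show ?thesis
      proof (cases "even n")
        case True
        then have n: "n = 2 * k" by (simp add: k_def)
        have "p (x [^] n) \<le> C * sqrt r ^ n" using C(2)[of k] unfolding sq rk n .
        also have "\<dots> \<le> D * sqrt r ^ n"
          unfolding D_def using C(1) r0 nonneg[OF x] by (intro mult_right_mono) auto
        finally show ?thesis .
      next
        case False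
        then have n: "n = Suc (2 * k)" by (simp add: k_def)
        have "p (x [^] n) \<le> p (x [^] (2 * k)) * p x" unfolding n using x submult by simp
        also have "\<dots> \<le> (C * sqrt r ^ (2 * k)) * p x"
          using C(2)[of k] nonneg[OF x] unfolding sq rk by (intro mult_right_mono) auto
        also have "\<dots> = (C * (p x / sqrt r)) * sqrt r ^ n" unfolding n using r0 by simp
        also have "\<dots> \<le> D * sqrt r ^ n"
          unfolding D_def using C(1) r0 by (intro mult_right_mono mult_left_mono) auto
        finally show ?thesis .
      qed
    qed
    then show ?thesis using r0 by (intro spectral_radius_le) auto
  qed
  then have "spectral_radius R p x ^ 2 \<le> r" if r: "spectral_radius R p (x \<otimes> x) < r" for r
  proof -
    have "0 \<le> r" using r spectral_radius_nonneg[of "x \<otimes> x"] x by simp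
    moreover have "spectral_radius R p x ^ 2 \<le> sqrt r ^ 2"
      using \<open>\<And>r. spectral_radius R p (x \<otimes> x) < r \<Longrightarrow> spectral_radius R p x \<le> sqrt r\<close>[OF r]
        spectral_radius_nonneg[OF x] by (intro power_mono)
    ultimately show ?thesis by simp
  qed
  then show "spectral_radius R p x ^ 2 \<le> spectral_radius R p (x \<otimes> x)"
    by (rule dense_ge)
qed

text \<open>A rate below 1 would force p(1) = p(1^n) to tend to 0.\<close>

lemma spectral_radius_one: "spectral_radius R p \<one> = 1"
proof (rule antisym)
  show "spectral_radius R p \<one> \<le> 1" by (rule spectral_radius_le[of _ _ "p \<one>"]) auto
  show "1 \<le> spectral_radius R p \<one>"
  proof (rule ccontr)
    assume "\<not> ?thesis"
    then obtain r where r: "spectral_radius R p \<one> < r" "r < 1"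
      using dense[of "spectral_radius R p \<one>" 1] by auto
    have r0: "0 \<le> r" using r spectral_radius_nonneg[of \<one>] by simp
    obtain C where C: "0 < C" "\<And>n::nat. p (\<one> [^] n) \<le> C * r ^ n"
      using spectral_radius_less[OF _ r(1)] by auto
    have "(\<lambda>n. C * r ^ n) \<longlonglongrightarrow> C * 0" using r0 r by (intro tendsto_intros LIMSEQ_power_zero) auto
    moreover have "\<forall>n. 1 \<le> C * r ^ n" using C(2) one_ge by (auto intro: order_trans)
    ultimately show False using LIMSEQ_le_const[of "\<lambda>n. C * r ^ n" 0 1] by auto
  qed
qed

lemma spectral_radius_zero: "spectral_radius R p \<zero> = 0"
  using spectral_radius_nonneg[of \<zero>] spectral_radius_le_norm[of \<zero>] zero by simp

lemma unital_spectral_radius: "unital_seminorm R (spectral_radius R p)"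
  by unfold_locales
    (auto simp: spectral_radius_nonneg spectral_radius_zero spectral_radius_one
      spectral_radius_add spectral_radius_mult)

end

text \<open>Forces multiplication by f to scale exactly by p(f). The quotients p(g f^n) / p(f)^n
  decrease in n by submultiplicativity; q(g) is their limit, and shifting n by one yields q(g f) =
  q(g) p(f).\<close>

lemma (in unital_seminorm) twist:
  assumes sq: "\<And>y. y \<in> carrier R \<Longrightarrow> p (y \<otimes> y) = p y ^ 2"
    and f: "f \<in> carrier R" "0 < p f"
  obtains q where "unital_seminorm R q" "\<And>g. g \<in> carrier R \<Longrightarrow> q g \<le> p g"
    "\<And>g. g \<in> carrier R \<Longrightarrow> q (g \<otimes> f) = q g * p f"
proof -
  define a where "a g n = p (g \<otimes> f [^] n) / p f ^ n" for g and n :: nat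
  have nn: "0 \<le> a g n" if "g \<in> carrier R" for g n using that f nonneg by (simp add: a_def)
  have dec: "decseq (a g)" if "g \<in> carrier R" for g
  proof (rule decseq_SucI)
    fix n
    have "p (g \<otimes> f [^] Suc n) \<le> p (g \<otimes> f [^] n) * p f"
      using that f submult[of "g \<otimes> f [^] n" f] by (simp add: m_assoc)
    then show "a g (Suc n) \<le> a g n" using f by (simp add: a_def divide_simps mult.commute)
  qed
  define q where "q g = lim (a g)" for g
  have lim: "a g \<longlonglongrightarrow> q g" if "g \<in> carrier R" for g
    using decseq_bounded[OF dec[OF that], of 0] nn[OF that] decseq_convergent[OF dec[OF that], of 0]
    unfolding q_def by (metis limI)
  have le: "q g \<le> a g n" if "g \<in> carrier R" for g n
    using decseq_ge[OF dec[OF that] lim[OF that]] .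
  have pow2: "p (f [^] ((2::nat) ^ k)) = p f ^ (2 ^ k)" for k :: nat
  proof (induction k)
    case (Suc k)
    have "f [^] ((2::nat) ^ Suc k) = f [^] ((2::nat) ^ k) \<otimes> f [^] ((2::nat) ^ k)"
      using f by (simp add: nat_pow_mult mult_2)
    then show ?case using Suc sq[of "f [^] ((2::nat) ^ k)"] f by (simp add: power_mult[symmetric] mult.commute)
  qed (use f in simp)
  \<comment> \<open>Multiplicativity on squares controls only the powers f^(2^k). This suffices: the
    quotients for g = 1 decrease from 1 and return to the value 1 at the indices 2^k, so they are
    constant.\<close>
  have a1: "a \<one> n = 1" for n
  proof (rule antisym)
    show "a \<one> n \<le> 1" using decseqD[OF dec[OF one_closed], of 0 n] one by (simp add: a_def)
    have "n \<le> 2 ^ n" by (simp add: less_imp_le)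
    from decseqD[OF dec[OF one_closed] this] show "1 \<le> a \<one> n" using pow2[of n] f by (simp add: a_def)
  qed
  have "unital_seminorm R q"
  proof unfold_locales
    have "a \<one> = (\<lambda>_. 1)" using a1 by auto
    with lim[OF one_closed] show "q \<one> = 1" by (simp add: LIMSEQ_const_iff)
    then show "1 \<le> q \<one>" by simp
    have "a \<zero> = (\<lambda>_. 0)" using f zero by (auto simp: a_def)
    with lim[OF zero_closed] show "q \<zero> = 0" by (simp add: LIMSEQ_const_iff)
  next
    fix x assume x: "x \<in> carrier R"
    show "0 \<le> q x" using lim[OF x] nn[OF x] by (intro LIMSEQ_le_const) auto
    fix y assume y: "y \<in> carrier R"
    show "q (x \<oplus> y) \<le> q x + q y"
    proof (rule LIMSEQ_le[OF lim])
      show "(\<lambda>n. a x n + a y n) \<longlonglongrightarrow> q x + q y" using lim x y by (intro tendsto_intros)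
      have "a (x \<oplus> y) n \<le> a x n + a y n" for n
        using triangle[of "x \<otimes> f [^] n" "y \<otimes> f [^] n"] x y f
        by (simp add: a_def l_distr add_divide_distrib[symmetric] divide_right_mono)
      then show "\<exists>N. \<forall>n\<ge>N. a (x \<oplus> y) n \<le> a x n + a y n" by blast
    qed (use x y in auto)
    show "q (x \<otimes> y) \<le> q x * q y"
    proof (rule LIMSEQ_le_const)
      show "(\<lambda>n. a x n * a y n) \<longlonglongrightarrow> q x * q y" using lim x y by (intro tendsto_intros)
      have "q (x \<otimes> y) \<le> a x n * a y n" for n
      proof -
        \<comment> \<open>Splitting f^(2n) evenly between x and y bounds the quotient of index 2n
          for the product by the product of the quotients of index n.\<close>
        have e: "x \<otimes> y \<otimes> f [^] (n + n) = (x \<otimes> f [^] n) \<otimes> (y \<otimes> f [^] n)"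
        proof -
          define s where "s = f [^] n"
          have "s \<in> carrier R" using f by (simp add: s_def)
          with x y show ?thesis unfolding nat_pow_mult[OF f(1), symmetric] s_def[symmetric]
            by (simp add: m_ac)
        qed
        have "q (x \<otimes> y) \<le> a (x \<otimes> y) (n + n)" using le x y by simp
        also have "\<dots> \<le> a x n * a y n"
          unfolding a_def e using submult[of "x \<otimes> f [^] n" "y \<otimes> f [^] n"] x y f
          by (simp add: power_add divide_right_mono)
        finally show ?thesis .
      qed
      then show "\<exists>N. \<forall>n\<ge>N. q (x \<otimes> y) \<le> a x n * a y n" by blast
    qed
  qed
  moreover have "q g \<le> p g" if "g \<in> carrier R" for g
    using le[OF that, of 0] that by (simp add: a_def)
  moreover have "q (g \<otimes> f) = q g * p f" if g: "g \<in> carrier R" for g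
  proof -
    have "(\<lambda>n. a g (Suc n) * p f) \<longlonglongrightarrow> q g * p f"
      using LIMSEQ_Suc[OF lim[OF g]] by (intro tendsto_intros)
    moreover have "a g (Suc n) * p f = a (g \<otimes> f) n" for n
      using f g by (simp add: a_def m_ac)
    ultimately show ?thesis using lim[of "g \<otimes> f"] f g LIMSEQ_unique by auto
  qed
  ultimately show thesis by (rule that)
qed

text \<open>Zorn's lemma, with the pointwise infimum as lower bound of a chain. Restricting to
  extensional functions makes the pointwise order antisymmetric.\<close>

lemma (in unital_seminorm) exists_minimal:
  obtains w where "unital_seminorm R w" "\<And>x. x \<in> carrier R \<Longrightarrow> w x \<le> p x"
    "\<And>w' x. \<lbrakk>unital_seminorm R w'; \<And>x. x \<in> carrier R \<Longrightarrow> w' x \<le> w x; x \<in> carrier R\<rbrakk> \<Longrightarrow> w' x = w x"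
proof -
  define S where "S = {w \<in> extensional (carrier R). unital_seminorm R w \<and> (\<forall>x\<in>carrier R. w x \<le> p x)}"
  define P where "P w w' \<longleftrightarrow> (\<forall>x\<in>carrier R. w' x \<le> (w x :: real))" for w w'
  have restr: "unital_seminorm R (restrict w (carrier R))" if "unital_seminorm R w" for w
  proof -
    interpret w: unital_seminorm R w by fact
    show ?thesis by unfold_locales (auto simp: w.nonneg w.zero w.triangle w.submult w.one)
  qed
  have "\<exists>m\<in>S. \<forall>a\<in>S. P m a \<longrightarrow> a = m"
  proof (rule predicate_Zorn)
    show "partial_order_on S (relation_of P S)"
    proof (rule partial_order_on_relation_ofI)
      show "P a a" for a by (simp add: P_def)
      show "P a c" if "P a b" "P b c" for a b c using that by (force simp: P_def)
      show "a = b" if "a \<in> S" "b \<in> S" "P a b" "P b a" for a b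
        using that by (intro extensionalityI[of _ "carrier R"]) (auto simp: S_def P_def intro: antisym)
    qed
    fix C assume C: "C \<in> Chains (relation_of P S)"
    then have CS: "C \<subseteq> S" and chain: "\<And>a b. a \<in> C \<Longrightarrow> b \<in> C \<Longrightarrow> P a b \<or> P b a"
      by (auto simp: Chains_def relation_of_def)
    show "\<exists>u\<in>S. \<forall>a\<in>C. P a u"
    proof (cases "C = {}")
      case True
      have "restrict p (carrier R) \<in> S" using restr[of p] by (auto simp: S_def unital_seminorm_axioms)
      with True show ?thesis by auto
    next
      case False
      define u where "u = (\<lambda>x\<in>carrier R. INF w\<in>C. w x)"
      have un: "unital_seminorm R w" if "w \<in> C" for w using CS that by (auto simp: S_def)
      have bdd: "bdd_below ((\<lambda>w. w x) ` C)" if "x \<in> carrier R" for x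
        by (rule bdd_belowI2[where m=0])
          (rule submult_seminorm.nonneg[OF unital_seminorm.axioms(1)[OF un] that])
      have u_le: "u x \<le> w x" if "w \<in> C" "x \<in> carrier R" for w x
        using that cINF_lower[OF bdd] by (auto simp: u_def)
      have u_ge: "c \<le> u x" if "x \<in> carrier R" "\<And>w. w \<in> C \<Longrightarrow> c \<le> w x" for c x
        using that False by (auto simp: u_def intro: cINF_greatest)
      have u_less: "\<exists>w\<in>C. w x < c" if "x \<in> carrier R" "u x < c" for c x
        using u_ge[OF that(1), of c] that(2) by (meson linorder_not_le)
      \<comment> \<open>The triangle inequality and submultiplicativity of the infimum require one
        member of the chain that is nearly optimal at x and at y simultaneously; the smaller of two
        comparable members is.\<close>
      have u_less2: "\<exists>w\<in>C. w x < c \<and> w y < d"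
        if xc: "x \<in> carrier R" "u x < c" and yd: "y \<in> carrier R" "u y < d" for x y c d
      proof -
        obtain w1 where w1: "w1 \<in> C" "w1 x < c" using u_less[OF xc] by blast
        obtain w2 where w2: "w2 \<in> C" "w2 y < d" using u_less[OF yd] by blast
        from chain[OF w1(1) w2(1)] show ?thesis
          using w1 w2 xc yd unfolding P_def by (meson order_le_less_trans)
      qed
      have nn: "0 \<le> u x" if "x \<in> carrier R" for x
        by (rule u_ge[OF that])
          (rule submult_seminorm.nonneg[OF unital_seminorm.axioms(1)[OF un] that])
      obtain w0 where w0: "w0 \<in> C" using False by auto
      have "unital_seminorm R u"
      proof unfold_locales
        have "w \<one> = 1" if "w \<in> C" for w using un[OF that] unital_seminorm.one by blast
        then show "u \<one> = 1" using u_le[OF w0, of \<one>] u_ge[of \<one> 1] w0 by fastforce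
        then show "1 \<le> u \<one>" by simp
        show "u \<zero> = 0" using u_le[OF w0, of \<zero>] nn[of \<zero>] un[OF w0]
          by (simp add: submult_seminorm.zero unital_seminorm.axioms(1))
      next
        fix x assume x: "x \<in> carrier R"
        show "0 \<le> u x" by (rule nn[OF x])
        fix y assume y: "y \<in> carrier R"
        show "u (x \<oplus> y) \<le> u x + u y"
        proof (rule field_le_epsilon)
          fix e :: real assume "0 < e"
          then obtain w where w: "w \<in> C" "w x < u x + e / 2" "w y < u y + e / 2"
            using u_less2[OF x _ y, of "u x + e / 2" "u y + e / 2"] by auto
          interpret w: unital_seminorm R w by (rule un[OF w(1)])
          show "u (x \<oplus> y) \<le> u x + u y + e"
            using u_le[OF w(1), of "x \<oplus> y"] w.triangle[OF x y] w x y by auto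
        qed
        have *: "u (x \<otimes> y) \<le> (u x + e) * (u y + e)" if e: "0 < e" for e
        proof -
          obtain w where w: "w \<in> C" "w x < u x + e" "w y < u y + e"
            using u_less2[OF x _ y, of "u x + e" "u y + e"] e by auto
          interpret w: unital_seminorm R w by (rule un[OF w(1)])
          have "u (x \<otimes> y) \<le> w x * w y" using u_le[OF w(1), of "x \<otimes> y"] w.submult[OF x y] x y by auto
          also have "\<dots> \<le> (u x + e) * (u y + e)" using w w.nonneg[OF x] w.nonneg[OF y] by (intro mult_mono) auto
          finally show ?thesis .
        qed
        then have ev: "eventually (\<lambda>e. u (x \<otimes> y) \<le> (u x + e) * (u y + e)) (at_right 0)"
          by (auto simp: eventually_at_right_less eventually_at_filter)
        have "((\<lambda>e. (u x + e) * (u y + e)) \<longlongrightarrow> (u x + 0) * (u y + 0)) (at_right 0)"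
          by (intro tendsto_intros)
        from tendsto_lowerbound[OF this ev] show "u (x \<otimes> y) \<le> u x * u y" by simp
      qed
      moreover have "u x \<le> p x" if "x \<in> carrier R" for x
        using u_le[OF w0 that] w0 CS that by (force simp: S_def)
      ultimately have "u \<in> S" by (auto simp: S_def u_def)
      moreover have "\<forall>a\<in>C. P a u" using u_le by (auto simp: P_def)
      ultimately show ?thesis by blast
    qed
  qed
  then obtain m where m: "m \<in> S" "\<And>a. a \<in> S \<Longrightarrow> P m a \<Longrightarrow> a = m" by blast
  show thesis
  proof
    show "unital_seminorm R m" "\<And>x. x \<in> carrier R \<Longrightarrow> m x \<le> p x" using m by (auto simp: S_def)
    fix w' x assume w': "unital_seminorm R w'" "\<And>x. x \<in> carrier R \<Longrightarrow> w' x \<le> m x" and x: "x \<in> carrier R"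
    have "restrict w' (carrier R) \<in> S" using restr[OF w'(1)] w'(2) m(1) by (force simp: S_def)
    moreover have "P m (restrict w' (carrier R))" using w'(2) by (auto simp: P_def)
    ultimately have "restrict w' (carrier R) = m" by (rule m(2))
    with x show "w' x = m x" by auto
  qed
qed

text \<open>Minimality is used twice. The spectral radius lies below p, hence equals p, which makes
  p multiplicative on squares. Then the twist by y lies below p, hence equals p, and its scaling
  property is the claim.\<close>

lemma (in unital_seminorm) minimal_multiplicative:
  assumes min: "\<And>w' x. \<lbrakk>unital_seminorm R w'; \<And>x. x \<in> carrier R \<Longrightarrow> w' x \<le> p x; x \<in> carrier R\<rbrakk> \<Longrightarrow> w' x = p x"
    and x: "x \<in> carrier R" and y: "y \<in> carrier R"
  shows "p (x \<otimes> y) = p x * p y"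
proof (cases "p y = 0")
  case True
  then show ?thesis using submult[OF x y] nonneg[of "x \<otimes> y"] x y by simp
next
  case False
  have sp: "spectral_radius R p z = p z" if "z \<in> carrier R" for z
    using min[OF unital_spectral_radius spectral_radius_le_norm that] .
  have sq: "p (z \<otimes> z) = p z ^ 2" if "z \<in> carrier R" for z
    using spectral_radius_square[OF that] sp that by simp
  have py: "0 < p y" using False nonneg[OF y] by simp
  show ?thesis
  proof (rule twist[OF sq y py])
    fix q assume q: "unital_seminorm R q" "\<And>g. g \<in> carrier R \<Longrightarrow> q g \<le> p g"
      "\<And>g. g \<in> carrier R \<Longrightarrow> q (g \<otimes> y) = q g * p y"
    have "q z = p z" if "z \<in> carrier R" for z
      by (rule min[of q]) (use q that in blast)+
    then show ?thesis using q(3)[OF x] x y by simp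
  qed
qed

text \<open>A minimal seminorm below the spectral radius might be too small at x. Twisting by x
  first pins the value at the inverse y to the reciprocal of the spectral radius of x; a
  multiplicative w that is at most this at y is large enough at x.\<close>

lemma (in submult_seminorm) exists_multiplicative_attaining:
  assumes x: "x \<in> carrier R" and y: "y \<in> carrier R" and xy: "x \<otimes> y = \<one>"
  obtains w where "unital_seminorm R w"
    "\<And>f g. \<lbrakk>f \<in> carrier R; g \<in> carrier R\<rbrakk> \<Longrightarrow> w (f \<otimes> g) = w f * w g"
    "\<And>f. f \<in> carrier R \<Longrightarrow> w f \<le> spectral_radius R p f"
    "w x = spectral_radius R p x"
proof -
  let ?r = "spectral_radius R p"
  interpret r: unital_seminorm R ?r by (rule unital_spectral_radius)
  have "1 \<le> ?r x * ?r y" using r.submult[OF x y] xy r.one by simp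
  then have pos: "0 < ?r x" using r.nonneg[OF x] by (cases "?r x = 0") auto
  obtain q where q: "unital_seminorm R q" "\<And>g. g \<in> carrier R \<Longrightarrow> q g \<le> ?r g"
    "\<And>g. g \<in> carrier R \<Longrightarrow> q (g \<otimes> x) = q g * ?r x"
    using r.twist[OF spectral_radius_square x pos] by auto
  interpret q: unital_seminorm R q by (rule q)
  obtain w where w: "unital_seminorm R w" "\<And>x. x \<in> carrier R \<Longrightarrow> w x \<le> q x"
    "\<And>w' x. \<lbrakk>unital_seminorm R w'; \<And>x. x \<in> carrier R \<Longrightarrow> w' x \<le> w x; x \<in> carrier R\<rbrakk> \<Longrightarrow> w' x = w x"
    using q.exists_minimal by blast
  interpret w: unital_seminorm R w by (rule w)
  have mult: "w (f \<otimes> g) = w f * w g" if "f \<in> carrier R" "g \<in> carrier R" for f g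
    by (rule w.minimal_multiplicative[OF _ that]) (rule w(3); assumption)
  have le: "w f \<le> ?r f" if "f \<in> carrier R" for f using w(2) q(2) that by force
  have "w y * ?r x \<le> q y * ?r x" using w(2)[OF y] pos by simp
  also have "\<dots> = 1" using q(3)[OF y] xy x y q.one by (simp add: m_comm)
  finally have "w y * ?r x \<le> w x * w y" using mult[OF x y] xy w.one by simp
  moreover have "0 < w y" using mult[OF x y] xy w.one w.nonneg[OF y] by (cases "w y = 0") auto
  ultimately have "?r x \<le> w x" by (simp add: mult.commute)
  with le[OF x] have "w x = ?r x" by simp
  with w(1) mult le show thesis by (rule that)
qed

section \<open>Absolute values and weak approximation\<close>

lemmas (in cring) ring_expand =
  a_minus_def l_distr r_distr l_minus r_minus minus_add a_ac m_ac r_neg l_neg r_neg1 r_neg2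

locale valued_field = field R for R (structure) +
  fixes v :: "'a \<Rightarrow> real"
  assumes av: "absolute_value R v"
begin

lemma v_nonneg [simp]: "x \<in> carrier R \<Longrightarrow> 0 \<le> v x"
  and v_eq_0 [simp]: "x \<in> carrier R \<Longrightarrow> v x = 0 \<longleftrightarrow> x = \<zero>"
  and v_mult: "\<lbrakk>x \<in> carrier R; y \<in> carrier R\<rbrakk> \<Longrightarrow> v (x \<otimes> y) = v x * v y"
  and v_add: "\<lbrakk>x \<in> carrier R; y \<in> carrier R\<rbrakk> \<Longrightarrow> v (x \<oplus> y) \<le> v x + v y"
  using av by (auto simp: absolute_value_def)

lemma v_pos: "\<lbrakk>x \<in> carrier R; x \<noteq> \<zero>\<rbrakk> \<Longrightarrow> 0 < v x"
  using v_nonneg[of x] v_eq_0[of x] by linarith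

lemma v_zero [simp]: "v \<zero> = 0" by simp

lemma v_one [simp]: "v \<one> = 1"
  using v_mult[of \<one> \<one>] v_eq_0[of \<one>] by auto

lemma v_minus [simp]: assumes "x \<in> carrier R" shows "v (\<ominus> x) = v x"
proof -
  have "v (\<ominus> \<one>) * v (\<ominus> \<one>) = 1" using v_mult[of "\<ominus> \<one>" "\<ominus> \<one>"] by (simp add: l_minus)
  then have "(v (\<ominus> \<one>) - 1) * (v (\<ominus> \<one>) + 1) = 0" by (simp add: algebra_simps)
  then have "v (\<ominus> \<one>) = 1 \<or> v (\<ominus> \<one>) = -1" by auto
  moreover have "0 \<le> v (\<ominus> \<one>)" by simp
  ultimately have "v (\<ominus> \<one>) = 1" by linarith
  then show ?thesis using v_mult[of "\<ominus> \<one>" x] assms by (simp add: l_minus)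
qed

lemma v_diff: "\<lbrakk>x \<in> carrier R; y \<in> carrier R\<rbrakk> \<Longrightarrow> v (x \<ominus> y) \<le> v x + v y"
  using v_add[of x "\<ominus> y"] by (simp add: a_minus_def)

lemma v_diff_commute: assumes "x \<in> carrier R" "y \<in> carrier R" shows "v (x \<ominus> y) = v (y \<ominus> x)"
proof -
  have "x \<ominus> y = \<ominus> (y \<ominus> x)" using assms by (simp add: a_minus_def minus_add a_comm)
  then show ?thesis using assms by simp
qed

lemma v_diff_triangle:
  assumes "x \<in> carrier R" "y \<in> carrier R" "z \<in> carrier R"
  shows "v (x \<ominus> z) \<le> v (x \<ominus> y) + v (y \<ominus> z)"
proof -
  have "x \<ominus> z = (x \<ominus> y) \<oplus> (y \<ominus> z)"
    using assms by (simp add: ring_expand)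
  then show ?thesis using v_add[of "x \<ominus> y" "y \<ominus> z"] assms by simp
qed

lemma v_diff_ge: assumes "x \<in> carrier R" "y \<in> carrier R" shows "\<bar>v x - v y\<bar> \<le> v (x \<ominus> y)"
  using v_diff_triangle[of x y \<zero>] v_diff_triangle[of y x \<zero>] v_diff_commute[of x y] assms
  by (simp add: a_minus_def)

lemma v_mult_diff:
  assumes "x \<in> carrier R" "x' \<in> carrier R" "y \<in> carrier R" "y' \<in> carrier R"
  shows "v (x \<otimes> x' \<ominus> y \<otimes> y') \<le> v x * v (x' \<ominus> y') + v (x \<ominus> y) * v y'"
proof -
  have "x \<otimes> x' \<ominus> y \<otimes> y' = x \<otimes> (x' \<ominus> y') \<oplus> (x \<ominus> y) \<otimes> y'"
    using assms by (simp add: ring_expand)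
  then show ?thesis using v_add[of "x \<otimes> (x' \<ominus> y')" "(x \<ominus> y) \<otimes> y'"] assms by (simp add: v_mult)
qed

lemma v_inv: assumes "x \<in> carrier R" "x \<noteq> \<zero>" shows "v (inv x) = inverse (v x)"
proof -
  have x: "x \<in> Units R" using assms field_Units by auto
  have "v x * v (inv x) = 1" using v_mult[of x "inv x"] x assms by simp
  moreover have "v x \<noteq> 0" using assms by simp
  ultimately show ?thesis by (simp add: field_simps)
qed

lemma inv_closed: "\<lbrakk>x \<in> carrier R; x \<noteq> \<zero>\<rbrakk> \<Longrightarrow> inv x \<in> carrier R"
  and r_inv_field: "\<lbrakk>x \<in> carrier R; x \<noteq> \<zero>\<rbrakk> \<Longrightarrow> x \<otimes> inv x = \<one>"
  and l_inv_field: "\<lbrakk>x \<in> carrier R; x \<noteq> \<zero>\<rbrakk> \<Longrightarrow> inv x \<otimes> x = \<one>"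
  using field_Units by auto

lemma v_pow: "x \<in> carrier R \<Longrightarrow> v (x [^] (n::nat)) = v x ^ n"
  by (induction n) (auto simp: v_mult)

lemma v_finsum: "\<lbrakk>finite A; f \<in> A \<rightarrow> carrier R\<rbrakk> \<Longrightarrow> v (finsum R f A) \<le> (\<Sum>i\<in>A. v (f i))"
proof (induction A rule: finite_induct)
  case (insert i A)
  then have "v (f i \<oplus> finsum R f A) \<le> v (f i) + v (finsum R f A)"
    by (intro v_add finsum_closed) auto
  with insert show ?case by (simp add: Pi_def)
qed simp

end

lemma (in field) valued_fieldI: "absolute_value R v \<Longrightarrow> valued_field R v"
  by unfold_locales

context field
begin

text \<open>The standard device of weak approximation: z^n / (1 + z^n) tends to 0 where |z| < 1 and
  to 1 where |z| > 1.\<close>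

definition damp :: "'a \<Rightarrow> nat \<Rightarrow> 'a" where
  "damp z n = z [^] n \<otimes> inv (\<one> \<oplus> z [^] n)"

text \<open>The condition |z| \<noteq> 1 keeps the denominator away from 0, since z^n = -1 with n >
  0 forces |z| = 1.\<close>

lemma damp_props:
  assumes w: "absolute_value R w" and z: "z \<in> carrier R" "w z \<noteq> 1" and n: "0 < n"
  shows "\<one> \<oplus> z [^] n \<noteq> \<zero>" "damp z n \<in> carrier R"
    "w (damp z n) = w z ^ n * inverse (w (\<one> \<oplus> z [^] n))"
    "w (\<one> \<ominus> damp z n) = inverse (w (\<one> \<oplus> z [^] n))"
proof -
  interpret w: valued_field R w by (rule valued_fieldI[OF w])
  show nz: "\<one> \<oplus> z [^] n \<noteq> \<zero>"
  proof
    assume "\<one> \<oplus> z [^] n = \<zero>"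
    then have "z [^] n = \<ominus> \<one>" using z minus_equality[of "z [^] n" \<one>] by (simp add: a_comm)
    then have "w z ^ n = 1" using w.v_pow[OF z(1), of n] by simp
    then have "w z = 1" using power_eq_iff_eq_base[OF n, of "w z" 1] z by simp
    then show False using z by simp
  qed
  have cl: "inv (\<one> \<oplus> z [^] n) \<in> carrier R" using nz z w.inv_closed by simp
  then show "damp z n \<in> carrier R" using z by (simp add: damp_def)
  show "w (damp z n) = w z ^ n * inverse (w (\<one> \<oplus> z [^] n))"
    using nz z cl by (simp add: damp_def w.v_mult w.v_pow w.v_inv)
  have "\<one> \<ominus> damp z n = inv (\<one> \<oplus> z [^] n)"
  proof -
    define t where "t = z [^] n"
    define i where "i = inv (\<one> \<oplus> t)"
    have t: "t \<in> carrier R" "i \<in> carrier R" using cl z by (auto simp: t_def i_def)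
    have "(\<one> \<oplus> t) \<otimes> i = \<one>" using nz w.r_inv_field t by (simp add: t_def i_def)
    then have "\<one> \<ominus> t \<otimes> i = (\<one> \<oplus> t) \<otimes> i \<ominus> t \<otimes> i" by simp
    also have "\<dots> = i" using t by (simp add: ring_expand)
    finally show ?thesis by (simp add: damp_def t_def i_def)
  qed
  then show "w (\<one> \<ominus> damp z n) = inverse (w (\<one> \<oplus> z [^] n))"
    using w.v_inv nz z by simp
qed

lemma damp_tendsto_0:
  assumes w: "absolute_value R w" and z: "z \<in> carrier R" "w z < 1"
  shows "(\<lambda>n. w (damp z n)) \<longlonglongrightarrow> 0"
proof -
  interpret w: valued_field R w by (rule valued_fieldI[OF w])
  have lim: "(\<lambda>n. w z ^ n * inverse (1 - w z ^ n)) \<longlonglongrightarrow> 0 * inverse (1 - 0)"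
    using z w.v_nonneg[OF z(1)] by (intro tendsto_intros LIMSEQ_power_zero) auto
  have "0 \<le> w (damp z n) \<and> w (damp z n) \<le> w z ^ n * inverse (1 - w z ^ n)" if n: "0 < n" for n
  proof
    have z1: "w z \<noteq> 1" using z by simp
    note d = damp_props[OF w z(1) z1 n]
    show "0 \<le> w (damp z n)" using d(2) by simp
    have zn: "w z ^ n < 1" using z w.v_nonneg[OF z(1)] n by (simp add: power_less_one_iff)
    have "w \<one> \<le> w (\<one> \<oplus> z [^] n) + w (z [^] n)"
      using w.v_diff[of "\<one> \<oplus> z [^] n" "z [^] n"] z by (simp add: a_minus_def a_assoc r_neg)
    then have "1 - w z ^ n \<le> w (\<one> \<oplus> z [^] n)" using z by (simp add: w.v_pow)
    with zn show "w (damp z n) \<le> w z ^ n * inverse (1 - w z ^ n)"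
      unfolding d(3) using w.v_nonneg[OF z(1)] by (intro mult_left_mono le_imp_inverse_le) auto
  qed
  then have "\<forall>\<^sub>F n in sequentially. 0 \<le> w (damp z n)"
    "\<forall>\<^sub>F n in sequentially. w (damp z n) \<le> w z ^ n * inverse (1 - w z ^ n)"
    by (auto simp: eventually_sequentially intro!: exI[of _ 1])
  with lim show ?thesis using tendsto_sandwich[OF _ _ tendsto_const] by fastforce
qed

lemma damp_tendsto_1:
  assumes w: "absolute_value R w" and z: "z \<in> carrier R" "1 < w z"
  shows "(\<lambda>n. w (\<one> \<ominus> damp z n)) \<longlonglongrightarrow> 0" "(\<lambda>n. w (damp z n)) \<longlonglongrightarrow> 1"
proof -
  interpret w: valued_field R w by (rule valued_fieldI[OF w])
  have z1: "w z \<noteq> 1" using z by simp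
  have lim: "(\<lambda>n. inverse (w z ^ n - 1)) \<longlonglongrightarrow> 0"
    using z(2) by real_asymp
  have b: "0 \<le> w (\<one> \<ominus> damp z n) \<and> w (\<one> \<ominus> damp z n) \<le> inverse (w z ^ n - 1)" if n: "0 < n" for n
  proof
    note d = damp_props[OF w z(1) z1 n]
    show "0 \<le> w (\<one> \<ominus> damp z n)" using d(2) by simp
    have zn: "1 < w z ^ n" using z n by simp
    have "w (z [^] n) \<le> w (\<one> \<oplus> z [^] n) + w \<one>"
    proof -
      have "z [^] n = (\<one> \<oplus> z [^] n) \<ominus> \<one>"
        using z by (simp add: a_minus_def a_comm[of \<one>] a_assoc r_neg)
      then show ?thesis using w.v_diff[of "\<one> \<oplus> z [^] n" \<one>] z by simp
    qed
    then have "w z ^ n - 1 \<le> w (\<one> \<oplus> z [^] n)" using z by (simp add: w.v_pow)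
    with zn show "w (\<one> \<ominus> damp z n) \<le> inverse (w z ^ n - 1)"
      unfolding d(4) by (intro le_imp_inverse_le) auto
  qed
  then have "\<forall>\<^sub>F n in sequentially. 0 \<le> w (\<one> \<ominus> damp z n)"
    "\<forall>\<^sub>F n in sequentially. w (\<one> \<ominus> damp z n) \<le> inverse (w z ^ n - 1)"
    by (auto simp: eventually_sequentially intro!: exI[of _ 1])
  with lim show l0: "(\<lambda>n. w (\<one> \<ominus> damp z n)) \<longlonglongrightarrow> 0"
    using tendsto_sandwich[OF _ _ tendsto_const] by fastforce
  have "\<bar>w (damp z n) - 1\<bar> \<le> w (\<one> \<ominus> damp z n)" if "0 < n" for n
    using w.v_diff_ge[of \<one> "damp z n"] damp_props(2)[OF w z(1) z1 that] by simp
  then have "\<forall>\<^sub>F n in sequentially. \<bar>w (damp z n) - 1\<bar> \<le> w (\<one> \<ominus> damp z n)"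
    by (auto simp: eventually_sequentially intro!: exI[of _ 1])
  then have "(\<lambda>n. \<bar>w (damp z n) - 1\<bar>) \<longlonglongrightarrow> 0"
    using tendsto_sandwich[OF _ _ tendsto_const l0] by fastforce
  then have "(\<lambda>n. w (damp z n) - 1) \<longlonglongrightarrow> 0" by (rule tendsto_rabs_zero_cancel)
  then show "(\<lambda>n. w (damp z n)) \<longlonglongrightarrow> 1" by (simp add: LIM_zero_iff)
qed

text \<open>Induction on the finite set: z serves for T and y for the new w. If w(z) < 1, then z
  itself works. If w(z) = 1, a high power of z times y works, as it is unchanged at w and shrinks on
  T. If w(z) > 1, powers would grow at w, and \<open>damp z n\<close> replaces them: it tends to 1
  at both w0 and w and to 0 on T.\<close>

lemma weak_approximation_separate:
  assumes "finite T" and w0: "absolute_value R w0" and "\<And>w. w \<in> T \<Longrightarrow> absolute_value R w"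
    and "\<And>w. w \<in> T \<Longrightarrow> \<exists>y\<in>carrier R. 1 < w0 y \<and> w y < 1" and "T \<noteq> {}"
  shows "\<exists>y\<in>carrier R. 1 < w0 y \<and> (\<forall>w\<in>T. w y < 1)"
  using assms(1,5,3,4)
proof (induction T rule: finite_ne_induct)
  case (singleton w)
  then show ?case by simp
next
  case (insert w T)
  interpret w0: valued_field R w0 by (rule valued_fieldI[OF w0])
  have avw: "absolute_value R w" and avT: "\<And>w. w \<in> T \<Longrightarrow> absolute_value R w" using insert by auto
  interpret w: valued_field R w by (rule valued_fieldI[OF avw])
  obtain z where z: "z \<in> carrier R" "1 < w0 z" "\<forall>w\<in>T. w z < 1" using insert by force
  obtain y where y: "y \<in> carrier R" "1 < w0 y" "w y < 1" using insert by force
  consider "w z < 1" | "w z = 1" | "1 < w z" by linarith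
  then show ?case
  proof cases
    case 1
    with z show ?thesis by auto
  next
    case 2
    have "\<forall>\<^sub>F n in sequentially. \<forall>w'\<in>T. w' z ^ n * w' y < 1"
    proof (rule eventually_ball_finite[OF insert.hyps(1)], rule ballI)
      fix w' assume w': "w' \<in> T"
      interpret w': valued_field R w' by (rule valued_fieldI[OF avT[OF w']])
      have "(\<lambda>n. w' z ^ n * w' y) \<longlonglongrightarrow> 0 * w' y"
        using z w' w'.v_nonneg[OF z(1)] by (intro tendsto_intros LIMSEQ_power_zero) auto
      then show "\<forall>\<^sub>F n in sequentially. w' z ^ n * w' y < 1"
        by (rule order_tendstoD) simp
    qed
    then obtain n where n: "\<forall>w'\<in>T. w' z ^ n * w' y < 1"
      by (auto simp: eventually_sequentially)
    show ?thesis
    proof (intro bexI[of _ "z [^] n \<otimes> y"] conjI ballI)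
      have "1 * 1 < w0 z ^ n * w0 y"
        using z y by (intro mult_le_less_imp_less) (auto simp: one_le_power)
      then show "1 < w0 (z [^] n \<otimes> y)" using z y by (simp add: w0.v_mult w0.v_pow)
      fix w' assume "w' \<in> insert w T"
      then show "w' (z [^] n \<otimes> y) < 1"
      proof
        assume "w' = w"
        then show ?thesis using 2 y z by (simp add: w.v_mult w.v_pow)
      next
        assume w': "w' \<in> T"
        interpret w': valued_field R w' by (rule valued_fieldI[OF avT[OF w']])
        show ?thesis using n w' z y by (simp add: w'.v_mult w'.v_pow)
      qed
    qed (use z y in simp)
  next
    case 3
    have lim: "(\<lambda>n. u (damp z n) * u y) \<longlonglongrightarrow> l * u y" if "(\<lambda>n. u (damp z n)) \<longlonglongrightarrow> l" for u :: "'a \<Rightarrow> real" and l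
      using that by (intro tendsto_intros)
    have "\<forall>\<^sub>F n in sequentially. \<forall>w'\<in>T. w' (damp z n) * w' y < 1"
    proof (rule eventually_ball_finite[OF insert.hyps(1)], rule ballI)
      fix w' assume w': "w' \<in> T"
      have "(\<lambda>n. w' (damp z n) * w' y) \<longlonglongrightarrow> 0 * w' y"
        using z w' by (intro lim damp_tendsto_0 avT) auto
      then show "\<forall>\<^sub>F n in sequentially. w' (damp z n) * w' y < 1"
        by (rule order_tendstoD) simp
    qed
    moreover have "\<forall>\<^sub>F n in sequentially. w (damp z n) * w y < 1"
      using lim[OF damp_tendsto_1(2)[OF avw z(1) 3]] y by (intro order_tendstoD) auto
    moreover have "\<forall>\<^sub>F n in sequentially. 1 < w0 (damp z n) * w0 y"
      using lim[OF damp_tendsto_1(2)[OF w0 z(1,2)]] y by (intro order_tendstoD) auto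
    moreover have "\<forall>\<^sub>F n in sequentially. 0 < n" by (rule eventually_gt_at_top)
    ultimately have ev: "\<forall>\<^sub>F n in sequentially. (\<forall>w'\<in>insert w T. w' (damp z n) * w' y < 1) \<and>
        1 < w0 (damp z n) * w0 y \<and> 0 < n"
      by eventually_elim auto
    then obtain n where n: "\<forall>w'\<in>insert w T. w' (damp z n) * w' y < 1" "1 < w0 (damp z n) * w0 y" "0 < n"
      by (auto simp: eventually_sequentially)
    have d: "damp z n \<in> carrier R" using damp_props(2)[OF w0 z(1) _ n(3)] z by auto
    show ?thesis
    proof (intro bexI[of _ "damp z n \<otimes> y"] conjI ballI)
      show "1 < w0 (damp z n \<otimes> y)" using n d y by (simp add: w0.v_mult)
      fix w' assume w': "w' \<in> insert w T"
      interpret w': valued_field R w' by (rule valued_fieldI) (use w' avw avT in auto)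
      show "w' (damp z n \<otimes> y) < 1" using n(1) w' d y by (simp only: w'.v_mult)
    qed (use d y in simp)
  qed
qed

text \<open>Damping an element that is large at w0 and small on T moves it towards 1 at w0 and
  towards 0 on T.\<close>

lemma weak_approximation:
  assumes T: "finite T" and w0: "absolute_value R w0" and av: "\<And>w. w \<in> T \<Longrightarrow> absolute_value R w"
    and ex: "\<And>w. w \<in> T \<Longrightarrow> \<exists>y\<in>carrier R. 1 < w0 y \<and> w y < 1" and e: "0 < (e::real)"
  shows "\<exists>z\<in>carrier R. w0 (\<one> \<ominus> z) < e \<and> (\<forall>w\<in>T. w z < e)"
proof (cases "T = {}")
  case True
  interpret w0: valued_field R w0 by (rule valued_fieldI[OF w0])
  show ?thesis using True e by (auto intro!: bexI[of _ \<one>] simp: a_minus_def r_neg)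
next
  case False
  obtain y where y: "y \<in> carrier R" "1 < w0 y" "\<forall>w\<in>T. w y < 1"
    using weak_approximation_separate[OF T w0 av ex False] by auto
  have "\<forall>\<^sub>F n in sequentially. \<forall>w\<in>T. w (damp y n) < e"
    using damp_tendsto_0[OF av y(1)] y(3) e
    by (intro eventually_ball_finite[OF T] ballI) (rule order_tendstoD, auto)
  moreover have "\<forall>\<^sub>F n in sequentially. w0 (\<one> \<ominus> damp y n) < e"
    by (rule order_tendstoD(2)[OF damp_tendsto_1(1)[OF w0 y(1,2)] e])
  moreover have "\<forall>\<^sub>F n in sequentially. 0 < n" by (rule eventually_gt_at_top)
  ultimately have "\<forall>\<^sub>F n in sequentially. (\<forall>w\<in>T. w (damp y n) < e) \<and> w0 (\<one> \<ominus> damp y n) < e \<and> 0 < n"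
    by eventually_elim auto
  then obtain n where n: "\<forall>w\<in>T. w (damp y n) < e" "w0 (\<one> \<ominus> damp y n) < e" "0 < n"
    by (auto simp: eventually_sequentially)
  have "damp y n \<in> carrier R" using damp_props(2)[OF w0 y(1) _ n(3)] y by auto
  with n show ?thesis by auto
qed

end

section \<open>Finite extensions of a valued field\<close>

text \<open>The condition \<open>8 G d\<^sup>2 e \<le> 1\<close> makes the quadratic map a contraction with factor 1/2 on the
  ball of radius \<open>2 e\<close>.\<close>

definition quad_henselian :: "('k, 'm) ring_scheme \<Rightarrow> ('k \<Rightarrow> real) \<Rightarrow> bool" where
  "quad_henselian K v \<longleftrightarrow> (\<forall>(d::nat) \<gamma> s G e.
     0 < G \<and> 0 < e \<and> 8 * G * (real d)\<^sup>2 * e \<le> 1 \<and>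
     (\<forall>i<d. \<forall>j<d. \<forall>k<d. \<gamma> i j k \<in> carrier K \<and> v (\<gamma> i j k) < G) \<and>
     (\<forall>k<d. s k \<in> carrier K \<and> v (s k) < e) \<longrightarrow>
     (\<exists>t. \<forall>k<d. t k \<in> carrier K \<and> v (t k) \<le> 2 * e \<and>
        t k = (\<Oplus>\<^bsub>K\<^esub>i\<in>{..<d}. \<Oplus>\<^bsub>K\<^esub>j\<in>{..<d}. t i \<otimes>\<^bsub>K\<^esub> t j \<otimes>\<^bsub>K\<^esub> \<gamma> i j k) \<oplus>\<^bsub>K\<^esub> s k))"

definition extends_abs :: "('k, 'm) ring_scheme \<Rightarrow> ('k \<Rightarrow> real) \<Rightarrow> ('k \<Rightarrow> 'l) \<Rightarrow> ('l, 'n) ring_scheme \<Rightarrow> ('l \<Rightarrow> real) \<Rightarrow> bool" where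
  "extends_abs K v h L w \<longleftrightarrow> absolute_value L w \<and> (\<forall>a\<in>carrier K. w (h a) = v a)"

text \<open>The extension is described by coordinate functions into K, so that K and F may have
  different element types. The condition \<open>dependent\<close> bounds the dimension by d from
  above; it limits the number of extensions of the absolute value.\<close>

locale finite_valued_extension = K: valued_field K v + field F
  for K :: "('k, 'm) ring_scheme" and v and F :: "('l, 'n) ring_scheme" (structure) +
  fixes h :: "'k \<Rightarrow> 'l" and d :: nat and bas :: "nat \<Rightarrow> 'l" and c :: "nat \<Rightarrow> 'l \<Rightarrow> 'k"
  assumes h: "h \<in> ring_hom K F"
    and bas: "i < d \<Longrightarrow> bas i \<in> carrier F"
    and c_closed: "\<lbrakk>i < d; x \<in> carrier F\<rbrakk> \<Longrightarrow> c i x \<in> carrier K"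
    and expand: "x \<in> carrier F \<Longrightarrow> (\<Oplus>i\<in>{..<d}. h (c i x) \<otimes> bas i) = x"
    and c_add: "\<lbrakk>i < d; x \<in> carrier F; y \<in> carrier F\<rbrakk> \<Longrightarrow> c i (x \<oplus> y) = c i x \<oplus>\<^bsub>K\<^esub> c i y"
    and c_smult: "\<lbrakk>i < d; a \<in> carrier K; x \<in> carrier F\<rbrakk> \<Longrightarrow> c i (h a \<otimes> x) = a \<otimes>\<^bsub>K\<^esub> c i x"
    and dependent: "(\<And>i. i \<le> d \<Longrightarrow> ys i \<in> carrier F) \<Longrightarrow>
      \<exists>a. (\<forall>i\<le>d. a i \<in> carrier K) \<and> (\<exists>i\<le>d. a i \<noteq> \<zero>\<^bsub>K\<^esub>) \<and> (\<Oplus>i\<in>{..d}. h (a i) \<otimes> ys i) = \<zero>"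
begin

sublocale h: ring_hom_ring K F h
  by unfold_locales (rule h)

lemma c_zero: "i < d \<Longrightarrow> c i \<zero> = \<zero>\<^bsub>K\<^esub>"
  using c_add[of i \<zero> \<zero>] c_closed[of i \<zero>] by (simp add: K.add.l_cancel_one' )

lemma c_finsum:
  assumes "finite I" "i < d" "f \<in> I \<rightarrow> carrier F"
  shows "c i (finsum F f I) = (\<Oplus>\<^bsub>K\<^esub>j\<in>I. c i (f j))"
  using assms(1,3)
proof (induction I rule: finite_induct)
  case empty
  then show ?case using c_zero assms by simp
next
  case (insert j I)
  then have f: "f j \<in> carrier F" "f \<in> I \<rightarrow> carrier F" by auto
  have "(\<lambda>j. c i (f j)) \<in> I \<rightarrow> carrier K" using f(2) c_closed assms(2) by auto
  then show ?case using insert f c_add[OF assms(2)] c_closed[OF assms(2)] by simp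
qed

text \<open>The structure constants of the K-algebra F in the basis. They become the coefficients of
  the quadratic system over K.\<close>

definition sc where "sc i j k = c k (bas i \<otimes> bas j)"

lemma sc_closed: "i < d \<Longrightarrow> j < d \<Longrightarrow> k < d \<Longrightarrow> sc i j k \<in> carrier K"
  by (simp add: sc_def c_closed bas)

text \<open>Stated for arbitrary combinations of the basis because \<open>quadratic_root\<close>
  squares such a combination before its coordinates are known.\<close>

lemma comb_mult:
  assumes a: "\<And>i. i < d \<Longrightarrow> a i \<in> carrier K" and a': "\<And>i. i < d \<Longrightarrow> a' i \<in> carrier K" and k: "k < d"
  shows "c k ((\<Oplus>i\<in>{..<d}. h (a i) \<otimes> bas i) \<otimes> (\<Oplus>i\<in>{..<d}. h (a' i) \<otimes> bas i)) =
    (\<Oplus>\<^bsub>K\<^esub>i\<in>{..<d}. \<Oplus>\<^bsub>K\<^esub>j\<in>{..<d}. a i \<otimes>\<^bsub>K\<^esub> a' j \<otimes>\<^bsub>K\<^esub> sc i j k)"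
proof -
  let ?y = "\<Oplus>i\<in>{..<d}. h (a' i) \<otimes> bas i"
  have y: "?y \<in> carrier F" using a' bas by (intro finsum_closed) auto
  have "(\<Oplus>i\<in>{..<d}. h (a i) \<otimes> bas i) \<otimes> ?y = (\<Oplus>i\<in>{..<d}. h (a i) \<otimes> bas i \<otimes> ?y)"
    using a bas y by (intro finsum_ldistr) auto
  also have "\<dots> = (\<Oplus>i\<in>{..<d}. \<Oplus>j\<in>{..<d}. h (a i \<otimes>\<^bsub>K\<^esub> a' j) \<otimes> (bas i \<otimes> bas j))"
  proof (rule finsum_cong')
    fix i assume i: "i \<in> {..<d}"
    have "h (a i) \<otimes> bas i \<otimes> ?y = (\<Oplus>j\<in>{..<d}. h (a i) \<otimes> bas i \<otimes> (h (a' j) \<otimes> bas j))"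
      using a a' bas i by (intro finsum_rdistr) auto
    also have "\<dots> = (\<Oplus>j\<in>{..<d}. h (a i \<otimes>\<^bsub>K\<^esub> a' j) \<otimes> (bas i \<otimes> bas j))"
      using a a' bas i by (intro finsum_cong') (auto simp: m_ac)
    finally show "h (a i) \<otimes> bas i \<otimes> ?y = (\<Oplus>j\<in>{..<d}. h (a i \<otimes>\<^bsub>K\<^esub> a' j) \<otimes> (bas i \<otimes> bas j))" .
  qed (use a a' bas in \<open>auto intro!: finsum_closed\<close>)
  finally have "c k ((\<Oplus>i\<in>{..<d}. h (a i) \<otimes> bas i) \<otimes> ?y) =
      c k (\<Oplus>i\<in>{..<d}. \<Oplus>j\<in>{..<d}. h (a i \<otimes>\<^bsub>K\<^esub> a' j) \<otimes> (bas i \<otimes> bas j))" by simp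
  also have "\<dots> = (\<Oplus>\<^bsub>K\<^esub>i\<in>{..<d}. c k (\<Oplus>j\<in>{..<d}. h (a i \<otimes>\<^bsub>K\<^esub> a' j) \<otimes> (bas i \<otimes> bas j)))"
    using a a' bas k by (intro c_finsum) (auto intro!: finsum_closed)
  also have "\<dots> = (\<Oplus>\<^bsub>K\<^esub>i\<in>{..<d}. \<Oplus>\<^bsub>K\<^esub>j\<in>{..<d}. a i \<otimes>\<^bsub>K\<^esub> a' j \<otimes>\<^bsub>K\<^esub> sc i j k)"
  proof (rule K.finsum_cong')
    fix i assume i: "i \<in> {..<d}"
    have "c k (\<Oplus>j\<in>{..<d}. h (a i \<otimes>\<^bsub>K\<^esub> a' j) \<otimes> (bas i \<otimes> bas j)) =
        (\<Oplus>\<^bsub>K\<^esub>j\<in>{..<d}. c k (h (a i \<otimes>\<^bsub>K\<^esub> a' j) \<otimes> (bas i \<otimes> bas j)))"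
      using a a' bas k i by (intro c_finsum) auto
    also have "\<dots> = (\<Oplus>\<^bsub>K\<^esub>j\<in>{..<d}. a i \<otimes>\<^bsub>K\<^esub> a' j \<otimes>\<^bsub>K\<^esub> sc i j k)"
      using a a' bas k i by (intro K.finsum_cong') (auto simp: c_smult sc_def c_closed simp del: h.hom_mult)
    finally show "c k (\<Oplus>j\<in>{..<d}. h (a i \<otimes>\<^bsub>K\<^esub> a' j) \<otimes> (bas i \<otimes> bas j)) =
      (\<Oplus>\<^bsub>K\<^esub>j\<in>{..<d}. a i \<otimes>\<^bsub>K\<^esub> a' j \<otimes>\<^bsub>K\<^esub> sc i j k)" .
  qed (use a a' bas k in \<open>auto intro!: K.finsum_closed sc_closed\<close>)
  finally show ?thesis .
qed

section \<open>A submultiplicative norm on a finite extension\<close>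

definition n0 where "n0 x = (\<Sum>k<d. v (c k x))"
text \<open>The sum norm satisfies n0(xy) \<le> M n0(x) n0(y), so multiplying it by M makes it
  submultiplicative. The summand 1 gives \<open>n0\<close> \<le> \<open>nrm\<close>.\<close>

definition M where "M = 1 + (\<Sum>i<d. \<Sum>j<d. \<Sum>k<d. v (sc i j k))"
definition nrm where "nrm x = M * n0 x"

lemma M_ge: "1 \<le> M"
  using sc_closed by (auto simp: M_def intro!: sum_nonneg)

lemma n0_nonneg: "x \<in> carrier F \<Longrightarrow> 0 \<le> n0 x"
  using c_closed by (auto simp: n0_def intro!: sum_nonneg)

lemma nrm_nonneg: "x \<in> carrier F \<Longrightarrow> 0 \<le> nrm x"
  using n0_nonneg M_ge by (simp add: nrm_def)

lemma n0_le_nrm: "x \<in> carrier F \<Longrightarrow> n0 x \<le> nrm x"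
  using mult_right_mono[OF M_ge n0_nonneg, of x] by (simp add: nrm_def)

lemma coord_le_nrm: assumes "x \<in> carrier F" "k < d" shows "v (c k x) \<le> nrm x"
proof -
  have "v (c k x) \<le> n0 x"
    unfolding n0_def using assms c_closed by (intro member_le_sum) auto
  then show ?thesis using n0_le_nrm[OF assms(1)] by simp
qed

lemma n0_mult:
  assumes x: "x \<in> carrier F" and y: "y \<in> carrier F"
  shows "n0 (x \<otimes> y) \<le> M * n0 x * n0 y"
proof -
  have cx: "\<And>i. i < d \<Longrightarrow> c i x \<in> carrier K" and cy: "\<And>i. i < d \<Longrightarrow> c i y \<in> carrier K"
    using c_closed x y by auto
  have "n0 (x \<otimes> y) \<le> (\<Sum>k<d. \<Sum>i<d. \<Sum>j<d. v (c i x) * v (c j y) * v (sc i j k))"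
    unfolding n0_def
  proof (rule sum_mono)
    fix k assume k: "k \<in> {..<d}"
    have "v (c k (x \<otimes> y)) = v (\<Oplus>\<^bsub>K\<^esub>i\<in>{..<d}. \<Oplus>\<^bsub>K\<^esub>j\<in>{..<d}. c i x \<otimes>\<^bsub>K\<^esub> c j y \<otimes>\<^bsub>K\<^esub> sc i j k)"
      using comb_mult[of "\<lambda>i. c i x" "\<lambda>i. c i y" k] cx cy k x y by (simp add: expand)
    also have "\<dots> \<le> (\<Sum>i<d. v (\<Oplus>\<^bsub>K\<^esub>j\<in>{..<d}. c i x \<otimes>\<^bsub>K\<^esub> c j y \<otimes>\<^bsub>K\<^esub> sc i j k))"
      using cx cy k by (intro K.v_finsum) (auto intro!: K.finsum_closed sc_closed)
    also have "\<dots> \<le> (\<Sum>i<d. \<Sum>j<d. v (c i x \<otimes>\<^bsub>K\<^esub> c j y \<otimes>\<^bsub>K\<^esub> sc i j k))"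
      using cx cy k by (intro sum_mono K.v_finsum) (auto intro!: sc_closed)
    also have "\<dots> = (\<Sum>i<d. \<Sum>j<d. v (c i x) * v (c j y) * v (sc i j k))"
      using cx cy k by (intro sum.cong refl) (simp add: K.v_mult sc_closed)
    finally show "v (c k (x \<otimes> y)) \<le> (\<Sum>i<d. \<Sum>j<d. v (c i x) * v (c j y) * v (sc i j k))" .
  qed
  also have "\<dots> = (\<Sum>i<d. \<Sum>k<d. \<Sum>j<d. v (c i x) * v (c j y) * v (sc i j k))"
    by (rule sum.swap)
  also have "\<dots> = (\<Sum>i<d. \<Sum>j<d. \<Sum>k<d. v (c i x) * v (c j y) * v (sc i j k))"
    by (intro sum.cong refl sum.swap)
  also have "\<dots> = (\<Sum>i<d. \<Sum>j<d. v (c i x) * v (c j y) * (\<Sum>k<d. v (sc i j k)))"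
    by (simp only: sum_distrib_left)
  also have "\<dots> \<le> (\<Sum>i<d. \<Sum>j<d. v (c i x) * v (c j y) * M)"
  proof (intro sum_mono mult_left_mono)
    fix i j assume ij: "i \<in> {..<d}" "j \<in> {..<d}"
    have "(\<Sum>k<d. v (sc i j k)) \<le> (\<Sum>j<d. \<Sum>k<d. v (sc i j k))"
      using ij sc_closed by (intro member_le_sum[of j "{..<d}" "\<lambda>j. \<Sum>k<d. v (sc i j k)"]) (auto intro!: sum_nonneg)
    also have "\<dots> \<le> (\<Sum>i<d. \<Sum>j<d. \<Sum>k<d. v (sc i j k))"
      using ij sc_closed
      by (intro member_le_sum[of i "{..<d}" "\<lambda>i. \<Sum>j<d. \<Sum>k<d. v (sc i j k)"]) (auto intro!: sum_nonneg)
    finally show "(\<Sum>k<d. v (sc i j k)) \<le> M" by (simp add: M_def)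
  qed (use cx cy in auto)
  also have "\<dots> = M * n0 x * n0 y"
    by (simp add: n0_def sum_distrib_left sum_distrib_right mult_ac)
  finally show ?thesis .
qed

lemma n0_smult: "a \<in> carrier K \<Longrightarrow> x \<in> carrier F \<Longrightarrow> n0 (h a \<otimes> x) = v a * n0 x"
  by (simp add: n0_def c_smult K.v_mult c_closed sum_distrib_left)

lemma n0_zero_imp:
  assumes x: "x \<in> carrier F" and 0: "n0 x = 0" shows "x = \<zero>"
proof -
  have "v (c i x) = 0" if "i < d" for i
    using 0 that c_closed x unfolding n0_def by (subst (asm) sum_nonneg_eq_0_iff) auto
  then have "c i x = \<zero>\<^bsub>K\<^esub>" if "i < d" for i using that c_closed x by auto
  then have "(\<Oplus>i\<in>{..<d}. h (c i x) \<otimes> bas i) = (\<Oplus>i\<in>{..<d}. \<zero>)"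
    using bas by (intro finsum_cong') auto
  then show ?thesis using expand[OF x] by (simp add: finsum_zero)
qed

sublocale nrm: submult_seminorm F nrm
proof unfold_locales
  fix x assume x: "x \<in> carrier F"
  show "0 \<le> nrm x" by (rule nrm_nonneg[OF x])
  fix y assume y: "y \<in> carrier F"
  have "n0 (x \<oplus> y) \<le> n0 x + n0 y"
    using x y c_closed by (auto simp: n0_def c_add sum.distrib[symmetric] intro!: sum_mono K.v_add)
  then show "nrm (x \<oplus> y) \<le> nrm x + nrm y"
    using M_ge by (auto simp: nrm_def distrib_left[symmetric])
  show sub: "nrm (x \<otimes> y) \<le> nrm x * nrm y"
    using mult_left_mono[OF n0_mult[OF x y], of M] M_ge by (simp add: nrm_def mult_ac)
next
  show "nrm \<zero> = 0" by (simp add: nrm_def n0_def c_zero)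
  have "n0 \<one> \<noteq> 0" using n0_zero_imp[of \<one>] by auto
  then have pos: "0 < nrm \<one>" using n0_nonneg[of \<one>] M_ge by (auto simp: nrm_def)
  have "nrm \<one> * 1 \<le> nrm \<one> * nrm \<one>"
    using mult_left_mono[OF n0_mult[of \<one> \<one>], of M] M_ge by (simp add: nrm_def mult_ac)
  then show "1 \<le> nrm \<one>" using pos by (simp only: mult_le_cancel_left_pos)
qed

lemma nrm_smult: "a \<in> carrier K \<Longrightarrow> x \<in> carrier F \<Longrightarrow> nrm (h a \<otimes> x) = v a * nrm x"
  by (simp add: nrm_def n0_smult)

lemma nrm_minus: assumes "x \<in> carrier F" shows "nrm (\<ominus> x) = nrm x"
  using nrm_smult[of "\<ominus>\<^bsub>K\<^esub> \<one>\<^bsub>K\<^esub>" x] assms by (simp add: l_minus)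

section \<open>The spectral radius of the coordinate norm and the extensions of v\<close>

abbreviation "\<rho> \<equiv> spectral_radius F nrm"
abbreviation "extends \<equiv> extends_abs K v h F"

text \<open>The n-th power of a constant has norm v(a)^n nrm(1), and the factor nrm(1) disappears in
  the spectral radius. The detour through v(a) + e keeps the rate positive when a = 0.\<close>

lemma \<rho>_le: assumes a: "a \<in> carrier K" shows "\<rho> (h a) \<le> v a"
proof (rule field_le_epsilon)
  fix e :: real assume e: "0 < e"
  have p: "h a [^] n = h (a [^]\<^bsub>K\<^esub> n)" for n :: nat using a by (induction n) auto
  have "nrm (h a [^] n) = v a ^ n * nrm \<one>" for n :: nat
    using nrm_smult[of "a [^]\<^bsub>K\<^esub> n" \<one>] a by (simp add: p K.v_pow)
  moreover have "v a ^ n \<le> (v a + e) ^ n" for n using a e by (intro power_mono) auto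
  ultimately have "nrm (h a [^] n) \<le> nrm \<one> * (v a + e) ^ n" for n :: nat
    using nrm.one_ge by (simp add: mult.commute)
  moreover have "0 < v a + e" using a e by (simp add: add_nonneg_pos)
  ultimately show "\<rho> (h a) \<le> v a + e" by (intro nrm.spectral_radius_le)
qed

text \<open>A multiplicative unital seminorm on a field is an absolute value. On K it is bounded by
  v through \<open>\<rho>_le\<close>, and a bound that also holds for inverses is an
  equality.\<close>

lemma exists_extension_attaining:
  assumes x: "x \<in> carrier F" "x \<noteq> \<zero>"
  obtains w where "extends w" "w x = \<rho> x"
proof -
  have ix: "inv x \<in> carrier F" "x \<otimes> inv x = \<one>" using x field_Units by auto
  obtain w where w: "unital_seminorm F w"
    "\<And>f g. \<lbrakk>f \<in> carrier F; g \<in> carrier F\<rbrakk> \<Longrightarrow> w (f \<otimes> g) = w f * w g"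
    "\<And>f. f \<in> carrier F \<Longrightarrow> w f \<le> \<rho> f" "w x = \<rho> x"
    using nrm.exists_multiplicative_attaining[OF x(1) ix] by blast
  interpret w: unital_seminorm F w by (rule w)
  have av: "absolute_value F w"
    unfolding absolute_value_def
  proof (intro conjI ballI)
    fix a assume a: "a \<in> carrier F"
    show "0 \<le> w a" by (rule w.nonneg[OF a])
    show "w a = 0 \<longleftrightarrow> a = \<zero>"
    proof
      assume 0: "w a = 0"
      show "a = \<zero>"
      proof (rule ccontr)
        assume "a \<noteq> \<zero>"
        then have "inv a \<in> carrier F" "a \<otimes> inv a = \<one>" using a field_Units by auto
        then show False using w(2)[of a "inv a"] a 0 w.one by simp
      qed
    qed (simp add: w.zero)
  qed (simp_all add: w w.triangle)
  interpret w': valued_field F w by (rule valued_fieldI[OF av])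
  have "w (h a) = v a" if a: "a \<in> carrier K" for a
  proof (cases "a = \<zero>\<^bsub>K\<^esub>")
    case False
    have le: "w (h b) \<le> v b" if "b \<in> carrier K" for b
      using w(3)[of "h b"] \<rho>_le[OF that] that by simp
    have ia: "inv\<^bsub>K\<^esub> a \<in> carrier K" "a \<otimes>\<^bsub>K\<^esub> inv\<^bsub>K\<^esub> a = \<one>\<^bsub>K\<^esub>"
      using K.inv_closed K.r_inv_field a False by auto
    have va: "0 < v a" using a False K.v_nonneg[OF a] K.v_eq_0[OF a] by linarith
    have "1 = w (h (a \<otimes>\<^bsub>K\<^esub> inv\<^bsub>K\<^esub> a))" using ia by simp
    also have "\<dots> = w (h a) * w (h (inv\<^bsub>K\<^esub> a))" using a ia(1) w(2) by simp
    also have "\<dots> \<le> w (h a) * inverse (v a)"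
      using le[OF ia(1)] K.v_inv[OF a False] a by (intro mult_left_mono) auto
    finally have "v a \<le> w (h a)" using va by (simp add: field_simps)
    with le[OF a] show ?thesis by simp
  qed simp
  then have "extends w" using av by (simp add: extends_abs_def)
  then show thesis using w(4) by (rule that)
qed

lemma extends_bound:
  assumes w: "extends w"
  obtains C where "0 < C" "\<And>x. x \<in> carrier F \<Longrightarrow> w x \<le> C * nrm x"
proof -
  interpret w: valued_field F w by (rule valued_fieldI) (use w in \<open>simp add: extends_abs_def\<close>)
  have wh: "w (h a) = v a" if "a \<in> carrier K" for a using w that by (simp add: extends_abs_def)
  define C where "C = 1 + (\<Sum>i<d. w (bas i))"
  have C: "1 \<le> C" using bas by (auto simp: C_def intro!: sum_nonneg)
  have wC: "w (bas i) \<le> C" if "i < d" for i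
  proof -
    have "w (bas i) \<le> (\<Sum>i<d. w (bas i))" using that bas by (intro member_le_sum) auto
    then show ?thesis by (simp add: C_def)
  qed
  have "w x \<le> C * nrm x" if x: "x \<in> carrier F" for x
  proof -
    have "w x = w (\<Oplus>i\<in>{..<d}. h (c i x) \<otimes> bas i)" using expand[OF x] by simp
    also have "\<dots> \<le> (\<Sum>i<d. w (h (c i x) \<otimes> bas i))"
      using bas c_closed x by (intro w.v_finsum) auto
    also have "\<dots> = (\<Sum>i<d. v (c i x) * w (bas i))"
      using bas c_closed x by (intro sum.cong refl) (simp add: w.v_mult wh)
    also have "\<dots> \<le> (\<Sum>i<d. v (c i x) * C)"
      using wC c_closed x by (intro sum_mono mult_left_mono) auto
    also have "\<dots> = C * n0 x" by (simp add: n0_def sum_distrib_left mult.commute)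
    also have "\<dots> \<le> C * nrm x" using n0_le_nrm[OF x] C by (intro mult_left_mono) auto
    finally show ?thesis .
  qed
  then show thesis using that[of C] C by auto
qed

text \<open>Applying the bound C nrm to all powers of x removes the constant C, since a ratio w(x)/r
  above 1 would have unbounded powers.\<close>

lemma extends_le_\<rho>:
  assumes w: "extends w" and x: "x \<in> carrier F" shows "w x \<le> \<rho> x"
proof (rule dense_ge)
  interpret w: valued_field F w by (rule valued_fieldI) (use w in \<open>simp add: extends_abs_def\<close>)
  fix r assume r: "\<rho> x < r"
  have r0: "0 < r" using r nrm.spectral_radius_nonneg[OF x] by simp
  obtain D where D: "0 < D" "\<And>n::nat. nrm (x [^] n) \<le> D * r ^ n"
    using nrm.spectral_radius_less[OF x r] by blast
  obtain C where C: "0 < C" "\<And>x. x \<in> carrier F \<Longrightarrow> w x \<le> C * nrm x"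
    using extends_bound[OF w] by blast
  have b: "(w x / r) ^ n \<le> C * D" for n :: nat
  proof -
    have "w x ^ n = w (x [^] n)" using x by (simp add: w.v_pow)
    also have "\<dots> \<le> C * nrm (x [^] n)" using C x by simp
    also have "\<dots> \<le> C * (D * r ^ n)" using C D by simp
    finally show ?thesis using r0 by (simp add: power_divide divide_simps mult_ac)
  qed
  show "w x \<le> r"
  proof (rule ccontr)
    assume "\<not> w x \<le> r"
    then have "1 < w x / r" using r0 by simp
    then obtain n where "C * D < (w x / r) ^ n" using real_arch_pow by blast
    with b[of n] show False by simp
  qed
qed

end

lemma (in cring) idempotent_defect_complement:
  assumes "z \<in> carrier R"
  shows "(\<one> \<ominus> z) \<otimes> (\<one> \<ominus> z) \<ominus> (\<one> \<ominus> z) = z \<otimes> z \<ominus> z"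
  using assms by algebra

text \<open>The square of 1 - 2y is the discriminant 1 + 4u of X^2 - X - u; it is close to 1 when y
  is nearly idempotent.\<close>

lemma (in cring) square_one_minus_double:
  assumes "y \<in> carrier R" defines "u \<equiv> y \<otimes> y \<ominus> y"
  shows "(\<one> \<ominus> (y \<oplus> y)) \<otimes> (\<one> \<ominus> (y \<oplus> y)) = \<one> \<oplus> (u \<oplus> u \<oplus> u \<oplus> u)"
  using assms(1) by (simp add: ring_expand u_def)

text \<open>For f = y + (1-2y) t the defect f^2 - f becomes u + (1+4u)(t^2 - t). Where 1 + 4u is
  invertible, f is idempotent exactly when t = t^2 + u/(1+4u), the shape that
  \<open>quad_henselian\<close> can solve. The choice t = u gives the approximate step
  \<open>newton\<close>.\<close>

lemma (in cring) newton_step_defect: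
  assumes "y \<in> carrier R" "t \<in> carrier R" defines "w \<equiv> \<one> \<ominus> (y \<oplus> y)"
  shows "(y \<oplus> w \<otimes> t) \<otimes> (y \<oplus> w \<otimes> t) \<ominus> (y \<oplus> w \<otimes> t) = (y \<otimes> y \<ominus> y) \<oplus> ((w \<otimes> w) \<otimes> (t \<otimes> t) \<ominus> (w \<otimes> w) \<otimes> t)"
proof -
  have w: "w \<in> carrier R" using assms by simp
  have "(y \<oplus> w \<otimes> t) \<otimes> (y \<oplus> w \<otimes> t) \<ominus> (y \<oplus> w \<otimes> t) =
      (y \<otimes> y \<ominus> y) \<oplus> ((w \<otimes> w) \<otimes> (t \<otimes> t) \<ominus> (w \<otimes> (\<one> \<ominus> (y \<oplus> y))) \<otimes> t)"
    using assms(1,2) w by (simp add: ring_expand)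
  then show ?thesis by (simp only: w_def)
qed

text \<open>The correction is symmetric under y -> 1 - y with the same t, so estimates near 0
  transfer to estimates near 1.\<close>

lemma (in cring) newton_step_complement:
  assumes "y \<in> carrier R" "t \<in> carrier R"
  shows "\<one> \<ominus> (y \<oplus> (\<one> \<ominus> (y \<oplus> y)) \<otimes> t) = (\<one> \<ominus> y) \<oplus> (\<one> \<ominus> ((\<one> \<ominus> y) \<oplus> (\<one> \<ominus> y))) \<otimes> t"
  using assms by (simp add: ring_expand)


section \<open>Uniqueness of the extension to a finite extension\<close>

context finite_valued_extension
begin

lemma extends_valued_field: "extends w \<Longrightarrow> valued_field F w"
  by (rule valued_fieldI) (simp add: extends_abs_def)

lemma trivial_or_unbounded:
  obtains "\<And>x. \<lbrakk>x \<in> carrier K; x \<noteq> \<zero>\<^bsub>K\<^esub>\<rbrakk> \<Longrightarrow> v x = 1" | a where "a \<in> carrier K" "1 < v a"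
proof (cases "\<exists>a\<in>carrier K. 1 < v a")
  case False
  have "v x = 1" if x: "x \<in> carrier K" "x \<noteq> \<zero>\<^bsub>K\<^esub>" for x
  proof -
    have "v x \<le> 1" using False x by force
    moreover have "v (inv\<^bsub>K\<^esub> x) \<le> 1" using False K.inv_closed[OF x] by force
    moreover have "0 < v x" by (rule K.v_pos[OF x])
    ultimately show ?thesis using K.v_inv[OF x] by (simp add: field_simps)
  qed
  with that(1) show thesis by blast
qed (use that(2) in blast)

text \<open>For trivial v the coordinate norm takes bounded values, so all powers are bounded and
  \<open>\<rho>\<close> is at most 1. A bound by 1 that also holds for inverses is an
  equality.\<close>

lemma trivial_extends:
  assumes triv: "\<And>x. \<lbrakk>x \<in> carrier K; x \<noteq> \<zero>\<^bsub>K\<^esub>\<rbrakk> \<Longrightarrow> v x = 1"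
    and w: "extends w" and x: "x \<in> carrier F" "x \<noteq> \<zero>"
  shows "w x = 1"
proof -
  interpret w: valued_field F w by (rule extends_valued_field[OF w])
  have le: "w y \<le> 1" if y: "y \<in> carrier F" for y
  proof -
    have "v a \<le> 1" if "a \<in> carrier K" for a using triv[OF that] that by (cases "a = \<zero>\<^bsub>K\<^esub>") auto
    then have "n0 z \<le> (\<Sum>k<d. 1)" if "z \<in> carrier F" for z
      unfolding n0_def using that c_closed by (intro sum_mono) auto
    then have "nrm z \<le> M * d" if "z \<in> carrier F" for z
      using that M_ge unfolding nrm_def by (intro mult_left_mono) auto
    then have "\<rho> y \<le> 1" using y by (intro nrm.spectral_radius_le[of _ _ "M * d"]) auto
    then show ?thesis using extends_le_\<rho>[OF w y] by simp
  qed
  have "0 < w x" by (rule w.v_pos[OF x])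
  then show ?thesis using le[OF x(1)] le[OF w.inv_closed[OF x]] w.v_inv[OF x] by (simp add: field_simps)
qed

text \<open>A power of an element with different values opens a gap wider than the factor |a|^2
  between w' and w, where |a| > 1. Both extend v, so multiplication by a power of a scales them
  equally and can move 1 into the gap. Without such an a, v is trivial and both extensions are
  trivial.\<close>

lemma separate_pair:
  assumes w: "extends w" and w': "extends w'" and ne: "x \<in> carrier F" "w x \<noteq> w' x"
  shows "\<exists>y\<in>carrier F. 1 < w y \<and> w' y < 1"
proof -
  interpret w: valued_field F w by (rule extends_valued_field[OF w])
  interpret w': valued_field F w' by (rule extends_valued_field[OF w'])
  have wh: "w (h a) = v a" "w' (h a) = v a" if "a \<in> carrier K" for a
    using w w' that by (auto simp: extends_abs_def)
  have x0: "x \<noteq> \<zero>" using ne by auto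
  show ?thesis
  proof (cases rule: trivial_or_unbounded)
    case 1
    then show ?thesis using trivial_extends[OF _ w ne(1) x0] trivial_extends[OF _ w' ne(1) x0] ne(2) by simp
  next
    case (2 a)
    obtain x' where x': "x' \<in> carrier F" "w' x' < w x'" "x' \<noteq> \<zero>"
    proof (cases "w' x < w x")
      case False
      have "0 < w x" "0 < w' x" using ne(1) x0 w.v_pos w'.v_pos by auto
      then have "w' (inv x) < w (inv x)" using False ne x0 by (simp add: w.v_inv w'.v_inv)
      moreover have "inv x \<noteq> \<zero>" using w.r_inv_field[OF ne(1) x0] ne(1) by auto
      ultimately show thesis using that w.inv_closed[OF ne(1) x0] by blast
    qed (use that ne x0 in blast)
    have pos: "0 < w' x'" using x' w'.v_pos by simp
    then have "1 < w x' / w' x'" using x' by simp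
    then obtain n where n: "v a * v a < (w x' / w' x') ^ n" using real_arch_pow by blast
    have gap: "v a * v a * w' x' ^ n < w x' ^ n" using n pos by (simp add: power_divide field_simps)
    \<comment> \<open>The least integer m with w'(x')^n < |a|^m. As |a|^(m-1) does not exceed
      w'(x')^n, the gap yields |a|^m < w(x')^n.\<close>
    define m where "m = \<lfloor>log (v a) (w' x' ^ n)\<rfloor> + 1"
    have l1: "w' x' ^ n < v a powr m"
      using 2 pos by (simp add: m_def less_powr_iff floor_less_iff)
    have "v a powr (m - 1) \<le> w' x' ^ n"
      using 2 pos by (simp add: m_def powr_le_iff)
    then have "v a * v a powr (m - 1) \<le> v a * w' x' ^ n" using 2 by (intro mult_left_mono) auto
    moreover have "v a * v a powr (m - 1) = v a powr m" using 2 by (simp add: powr_diff)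
    moreover have "v a * w' x' ^ n \<le> v a * v a * w' x' ^ n" using 2 pos by simp
    ultimately have l2: "v a powr m < w x' ^ n" using gap by linarith
    have "\<exists>e\<in>carrier K. v e = v a powr (- m)"
    proof (cases "m \<ge> 0")
      case True
      define k where "k = nat m"
      have m: "m = int k" using True by (simp add: k_def)
      have "v (a [^]\<^bsub>K\<^esub> k) \<noteq> 0" using 2 by (simp add: K.v_pow del: K.v_eq_0)
      then have a0: "a [^]\<^bsub>K\<^esub> k \<noteq> \<zero>\<^bsub>K\<^esub>" by auto
      have "v (inv\<^bsub>K\<^esub> (a [^]\<^bsub>K\<^esub> k)) = v a powr (- m)"
        unfolding m using 2 a0 by (simp add: K.v_inv K.v_pow powr_minus powr_realpow)
      then show ?thesis using a0 2 K.inv_closed[of "a [^]\<^bsub>K\<^esub> k"]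
        by (intro bexI[of _ "inv\<^bsub>K\<^esub> (a [^]\<^bsub>K\<^esub> k)"]) auto
    next
      case False
      define k where "k = nat (- m)"
      have m: "m = - int k" using False by (simp add: k_def)
      have "v (a [^]\<^bsub>K\<^esub> k) = v a powr (- m)"
        unfolding m using 2 by (simp add: K.v_pow powr_realpow)
      then show ?thesis using 2 by (intro bexI[of _ "a [^]\<^bsub>K\<^esub> k"]) auto
    qed
    then obtain e where e: "e \<in> carrier K" "v e = v a powr (- m)" by blast
    have p: "0 < v a powr m" using 2 by (simp del: K.v_eq_0)
    have e1: "w (h e \<otimes> x' [^] n) = w x' ^ n / v a powr m" "w' (h e \<otimes> x' [^] n) = w' x' ^ n / v a powr m"
      using e x' by (simp_all add: w.v_mult w.v_pow w'.v_mult w'.v_pow wh powr_minus divide_inverse mult.commute)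
    show ?thesis
    proof (intro bexI[of _ "h e \<otimes> x' [^] n"] conjI)
      show "1 < w (h e \<otimes> x' [^] n)" unfolding e1 using l2 p by (simp only: pos_less_divide_eq mult_1)
      show "w' (h e \<otimes> x' [^] n) < 1" unfolding e1 using l1 p by (simp only: pos_divide_less_eq mult_1)
    qed (use e x' in auto)
  qed
qed

text \<open>Extensional functions with the same values on F are equal, so the extensions can be
  counted.\<close>

definition S where "S = {w \<in> extensional (carrier F). extends w}"

lemma S_ne: assumes "w \<in> S" "w' \<in> S" "w \<noteq> w'" obtains x where "x \<in> carrier F" "w x \<noteq> w' x"
  using assms extensionalityI[of w "carrier F" w'] unfolding S_def by blast

lemma S_approx:
  assumes T: "finite T" "T \<subseteq> S" and w: "w \<in> S" "w \<notin> T" and e: "0 < (e::real)"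
  shows "\<exists>z\<in>carrier F. w (\<one> \<ominus> z) < e \<and> (\<forall>w'\<in>T. w' z < e)"
proof (rule weak_approximation[OF T(1) _ _ _ e])
  show "absolute_value F w" using w by (simp add: S_def extends_abs_def)
  fix w' assume w': "w' \<in> T"
  then have w'S: "w' \<in> S" "w \<noteq> w'" using T w by auto
  then show "absolute_value F w'" by (simp add: S_def extends_abs_def)
  obtain x where "x \<in> carrier F" "w x \<noteq> w' x" using S_ne[OF w(1) w'S] by blast
  then show "\<exists>y\<in>carrier F. 1 < w y \<and> w' y < 1"
    using w w'S by (intro separate_pair) (auto simp: S_def)
qed

text \<open>Elements close to the idempotents of the product of the completions are linearly independent.\<close>

lemma card_S_le:
  assumes T: "finite T" "T \<subseteq> S" shows "card T \<le> d"
proof (rule ccontr)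
  assume "\<not> card T \<le> d"
  then obtain T' where T': "T' \<subseteq> T" "card T' = Suc d"
    using obtain_subset_with_card_n[of "Suc d" T] by auto
  have fT': "finite T'" using T'(1) T(1) finite_subset by blast
  then obtain g where g: "bij_betw g {0..<Suc d} T'" using ex_bij_betw_nat_finite T'(2) by metis
  then have gS: "g i \<in> S" if "i \<le> d" for i
    using that T' T bij_betwE[OF g] by force
  have g_ne: "g i \<noteq> g j" if "i \<le> d" "j \<le> d" "i \<noteq> j" for i j
    using that bij_betw_imp_inj_on[OF g] by (auto dest: inj_onD)
  \<comment> \<open>Any e with e (d+1) < 1 works: the relation below would give 1 - e < d e.\<close>
  define e :: real where "e = 1 / (d + 2)"
  have e: "0 < e" "e * (d + 1) < 1" by (auto simp: e_def field_simps)
  have "\<exists>z. z \<in> carrier F \<and> g i (\<one> \<ominus> z) < e \<and> (\<forall>j\<in>{..d} - {i}. g j z < e)" if i: "i \<in> {..d}" for i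
  proof -
    have "\<exists>z\<in>carrier F. g i (\<one> \<ominus> z) < e \<and> (\<forall>w'\<in>g ` ({..d} - {i}). w' z < e)"
    proof (rule S_approx)
      show "g ` ({..d} - {i}) \<subseteq> S" "g i \<in> S" using gS i by auto
      show "g i \<notin> g ` ({..d} - {i})" using g_ne[of i] i by auto
    qed (use e in auto)
    then show ?thesis by auto
  qed
  then have "\<exists>y. \<forall>i\<in>{..d}. y i \<in> carrier F \<and> g i (\<one> \<ominus> y i) < e \<and> (\<forall>j\<in>{..d} - {i}. g j (y i) < e)"
    by (intro bchoice) blast
  then obtain y where y': "\<forall>i\<in>{..d}. y i \<in> carrier F \<and> g i (\<one> \<ominus> y i) < e \<and> (\<forall>j\<in>{..d} - {i}. g j (y i) < e)" ..
  have y: "\<And>i. i \<le> d \<Longrightarrow> y i \<in> carrier F" "\<And>i. i \<le> d \<Longrightarrow> g i (\<one> \<ominus> y i) < e"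
    "\<And>i j. i \<le> d \<Longrightarrow> j \<le> d \<Longrightarrow> i \<noteq> j \<Longrightarrow> g j (y i) < e"
    using y' by auto
  obtain a where a: "\<And>i. i \<le> d \<Longrightarrow> a i \<in> carrier K" "\<exists>i\<le>d. a i \<noteq> \<zero>\<^bsub>K\<^esub>"
    "(\<Oplus>i\<in>{..d}. h (a i) \<otimes> y i) = \<zero>"
    using dependent[of y] y(1) by blast
  \<comment> \<open>The relation is evaluated at g l for a coefficient of largest absolute value.
    Its own term exceeds v(a l)(1 - e), while the other d terms together are at most d v(a l)
    e.\<close>
  obtain l where l: "l \<le> d" "\<And>i. i \<le> d \<Longrightarrow> v (a i) \<le> v (a l)"
  proof -
    have "\<exists>l\<in>{..d}. \<forall>i\<in>{..d}. v (a i) \<le> v (a l)"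
      using Max_in[of "(\<lambda>i. v (a i)) ` {..d}"] Max_ge[of "(\<lambda>i. v (a i)) ` {..d}"] by fastforce
    then show thesis using that by auto
  qed
  have pos: "0 < v (a l)"
  proof -
    obtain i where "i \<le> d" "a i \<noteq> \<zero>\<^bsub>K\<^esub>" using a(2) by blast
    then have "0 < v (a i)" using a(1) K.v_pos by simp
    then show ?thesis using l(2)[OF \<open>i \<le> d\<close>] by simp
  qed
  have ext: "extends (g l)" using gS[OF l(1)] by (simp add: S_def)
  interpret w: valued_field F "g l" by (rule extends_valued_field[OF ext])
  have wh: "g l (h b) = v b" if "b \<in> carrier K" for b using ext that by (simp add: extends_abs_def)
  define r where "r = (\<Oplus>i\<in>{..d} - {l}. h (a i) \<otimes> y i)"
  have rc: "r \<in> carrier F" unfolding r_def using a(1) y(1) by (intro finsum_closed) auto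
  have al: "h (a l) \<otimes> y l \<in> carrier F" using a(1) y(1) l(1) by simp
  have "{..d} = insert l ({..d} - {l})" using l(1) by auto
  then have "(\<Oplus>i\<in>{..d}. h (a i) \<otimes> y i) = (\<Oplus>i\<in>insert l ({..d} - {l}). h (a i) \<otimes> y i)" by simp
  also have "\<dots> = h (a l) \<otimes> y l \<oplus> r"
    unfolding r_def using a(1) y(1) l(1) by (subst finsum_insert) auto
  finally have "h (a l) \<otimes> y l \<oplus> r = \<zero>" using a(3) by simp
  then have "r = \<ominus> (h (a l) \<otimes> y l)" using minus_equality[of r "h (a l) \<otimes> y l"] al rc by (simp add: a_comm)
  then have eq: "g l (h (a l) \<otimes> y l) = g l r" using al by simp
  have "g l r \<le> (\<Sum>i\<in>{..d} - {l}. g l (h (a i) \<otimes> y i))"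
    unfolding r_def using a(1) y(1) by (intro w.v_finsum) auto
  also have "\<dots> \<le> (\<Sum>i\<in>{..d} - {l}. v (a l) * e)"
  proof (rule sum_mono)
    fix i assume i: "i \<in> {..d} - {l}"
    have "v (a i) * g l (y i) \<le> v (a l) * e"
      using i l y(3)[of i l] y(1) a(1) by (intro mult_mono) auto
    then show "g l (h (a i) \<otimes> y i) \<le> v (a l) * e" using i a(1) y(1) by (simp add: w.v_mult wh)
  qed
  also have "\<dots> = d * (v (a l) * e)" using l(1) by simp
  finally have 1: "v (a l) * g l (y l) \<le> d * (v (a l) * e)"
    using eq a(1) y(1) l(1) by (simp add: w.v_mult wh)
  have "1 - e < g l (y l)" using w.v_diff_ge[of \<one> "y l"] y(1,2)[OF l(1)] by simp
  then have "v (a l) * (1 - e) < v (a l) * g l (y l)" using pos by simp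
  with 1 have "v (a l) * (1 - e) < v (a l) * (d * e)" by (simp add: mult_ac)
  then have "1 - e < d * e" using pos by simp
  with e show False by (simp add: algebra_simps)
qed

lemma finite_S: "finite S"
proof (rule ccontr)
  assume "infinite S"
  then obtain T where "T \<subseteq> S" "finite T" "card T = Suc d"
    using infinite_arbitrarily_large by blast
  with card_S_le[of T] show False by simp
qed

lemma \<rho>_attained:
  assumes x: "x \<in> carrier F" "x \<noteq> \<zero>" obtains w where "w \<in> S" "w x = \<rho> x"
proof -
  obtain w where w: "extends w" "w x = \<rho> x" using exists_extension_attaining[OF x] by blast
  have "restrict w (carrier F) \<in> S"
    using w(1) by (auto simp: S_def extends_abs_def absolute_value_def)
  then show thesis using w x by (intro that[of "restrict w (carrier F)"]) auto
qed

text \<open>Newton's step for X^2 - X with the inverse of 2z - 1 replaced by 2z - 1 itself, which is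
  legitimate to first order because (2z-1)^2 = 1 + 4(z^2 - z). The resulting polynomial 3z^2 - 2z^3
  involves no division and makes sense in every characteristic.\<close>

definition newton where "newton z = z \<otimes> z \<otimes> (\<one> \<oplus> \<one> \<oplus> \<one> \<ominus> (z \<oplus> z))"

lemma newton_closed [simp]: "z \<in> carrier F \<Longrightarrow> newton z \<in> carrier F"
  by (simp add: newton_def)

lemma newton_eq_step:
  assumes "z \<in> carrier F" shows "newton z = z \<oplus> (\<one> \<ominus> (z \<oplus> z)) \<otimes> (z \<otimes> z \<ominus> z)"
  using assms by (simp add: ring_expand newton_def)

lemma newton_complement:
  assumes "z \<in> carrier F"
  shows "\<one> \<ominus> newton z = newton (\<one> \<ominus> z)"
  using assms newton_step_complement[of z "z \<otimes> z \<ominus> z"]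
  by (simp add: newton_eq_step idempotent_defect_complement)

text \<open>Taking t = u in \<open>newton_step_defect\<close> gives u + (1+4u)(u^2 - u), in which
  the linear terms cancel; the remaining factor u^2 is the quadratic convergence.\<close>

lemma newton_defect:
  assumes "z \<in> carrier F" defines "u \<equiv> z \<otimes> z \<ominus> z"
  shows "newton z \<otimes> newton z \<ominus> newton z = u \<otimes> u \<otimes> (u \<oplus> u \<oplus> u \<oplus> u \<ominus> (\<one> \<oplus> \<one> \<oplus> \<one>))"
proof -
  define q where "q = u \<oplus> u \<oplus> u \<oplus> u"
  have u: "u \<in> carrier F" and q: "q \<in> carrier F" using assms by (simp_all add: q_def)
  have "newton z \<otimes> newton z \<ominus> newton z = u \<oplus> ((\<one> \<oplus> q) \<otimes> (u \<otimes> u) \<ominus> (\<one> \<oplus> q) \<otimes> u)"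
    using newton_step_defect[OF assms(1) u] square_one_minus_double[OF assms(1)] assms(1)
    by (simp add: newton_eq_step u_def[symmetric] q_def[symmetric])
  also have "\<dots> = u \<otimes> u \<oplus> q \<otimes> (u \<otimes> u) \<ominus> q \<otimes> u"
    using u q by (simp add: ring_expand)
  also have "q \<otimes> u = u \<otimes> u \<oplus> u \<otimes> u \<oplus> u \<otimes> u \<oplus> u \<otimes> u"
    using u by (simp add: ring_expand q_def)
  also have "u \<otimes> u \<oplus> q \<otimes> (u \<otimes> u) \<ominus> (u \<otimes> u \<oplus> u \<otimes> u \<oplus> u \<otimes> u \<oplus> u \<otimes> u) = u \<otimes> u \<otimes> (q \<ominus> (\<one> \<oplus> \<one> \<oplus> \<one>))"
    using u q by (simp add: ring_expand)
  finally show ?thesis by (simp only: q_def)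
qed

text \<open>Where w(z) \<le> 1/16 the cofactor 3 - 2z is at most 4, even for archimedean w, so the
  value is at most 4/256. By \<open>newton_complement\<close> the ball of the same radius around 1
  is preserved too.\<close>

lemma newton_small:
  assumes w: "absolute_value F w" and z: "z \<in> carrier F" "w z \<le> 1 / 16"
  shows "w (newton z) \<le> 1 / 16"
proof -
  interpret w: valued_field F w by (rule valued_fieldI[OF w])
  have "w (\<one> \<oplus> \<one> \<oplus> \<one> \<ominus> (z \<oplus> z)) \<le> 4"
    using w.v_diff[of "\<one> \<oplus> \<one> \<oplus> \<one>" "z \<oplus> z"] w.v_add[of z z] w.v_add[of "\<one> \<oplus> \<one>" \<one>] w.v_add[of \<one> \<one>] z by simp
  then have "w (newton z) \<le> (w z * w z) * 4"
    using z unfolding newton_def by (simp add: w.v_mult mult_left_mono)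
  also have "\<dots> \<le> (1 / 16 * (1 / 16)) * 4" using z by (intro mult_right_mono mult_mono) auto
  finally show ?thesis by simp
qed

text \<open>Bounds the operator norm of \<open>x\<close> for a norm, equivalent to \<^term>\<open>nrm\<close>, in which \<open>u\<close> itself
  has operator norm at most \<open>r\<close>. This turns \<open>\<rho> u < r\<close> into bounds for polynomials in \<open>u\<close>.\<close>

definition wt :: "'l \<Rightarrow> real \<Rightarrow> 'l \<Rightarrow> real \<Rightarrow> bool" where
  "wt u r x q \<longleftrightarrow> 0 \<le> q \<and> x \<in> carrier F \<and> (\<forall>y\<in>carrier F. \<forall>D. (\<forall>n::nat. nrm (u [^] n \<otimes> y) \<le> D * r ^ n) \<longrightarrow>
      (\<forall>n::nat. nrm (u [^] n \<otimes> (x \<otimes> y)) \<le> q * D * r ^ n))"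

lemma wt_mult: assumes "wt u r x q" "wt u r x' q'" "u \<in> carrier F" shows "wt u r (x \<otimes> x') (q * q')"
  unfolding wt_def
proof (intro conjI ballI allI impI)
  fix y D and n :: nat assume y: "y \<in> carrier F" and D: "\<forall>n::nat. nrm (u [^] n \<otimes> y) \<le> D * r ^ n"
  have "\<forall>n::nat. nrm (u [^] n \<otimes> (x' \<otimes> y)) \<le> q' * D * r ^ n" using assms y D by (auto simp: wt_def)
  then have "\<forall>n::nat. nrm (u [^] n \<otimes> (x \<otimes> (x' \<otimes> y))) \<le> q * (q' * D) * r ^ n"
    using assms y by (auto simp: wt_def)
  then show "nrm (u [^] n \<otimes> (x \<otimes> x' \<otimes> y)) \<le> q * q' * D * r ^ n"
    using assms y by (simp add: wt_def m_assoc mult.assoc)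
qed (use assms in \<open>auto simp: wt_def\<close>)

lemma wt_add: assumes "wt u r x q" "wt u r x' q'" "u \<in> carrier F" shows "wt u r (x \<oplus> x') (q + q')"
  unfolding wt_def
proof (intro conjI ballI allI impI)
  fix y D and n :: nat assume y: "y \<in> carrier F" and D: "\<forall>n::nat. nrm (u [^] n \<otimes> y) \<le> D * r ^ n"
  have x: "x \<in> carrier F" "x' \<in> carrier F" using assms by (auto simp: wt_def)
  have "nrm (u [^] n \<otimes> (x \<otimes> y)) \<le> q * D * r ^ n" "nrm (u [^] n \<otimes> (x' \<otimes> y)) \<le> q' * D * r ^ n"
    using assms y D by (auto simp: wt_def)
  moreover have "u [^] n \<otimes> ((x \<oplus> x') \<otimes> y) = u [^] n \<otimes> (x \<otimes> y) \<oplus> u [^] n \<otimes> (x' \<otimes> y)"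
    using x y assms(3) by (simp add: l_distr r_distr)
  moreover have "nrm (u [^] n \<otimes> (x \<otimes> y) \<oplus> u [^] n \<otimes> (x' \<otimes> y)) \<le>
      nrm (u [^] n \<otimes> (x \<otimes> y)) + nrm (u [^] n \<otimes> (x' \<otimes> y))"
    using x y assms(3) by (intro nrm.triangle) auto
  ultimately show "nrm (u [^] n \<otimes> ((x \<oplus> x') \<otimes> y)) \<le> (q + q') * D * r ^ n"
    by (simp add: algebra_simps)
qed (use assms in \<open>auto simp: wt_def\<close>)

lemma wt_minus: assumes "wt u r x q" "u \<in> carrier F" shows "wt u r (\<ominus> x) q"
  unfolding wt_def
proof (intro conjI ballI allI impI)
  fix y D and n :: nat assume y: "y \<in> carrier F" and D: "\<forall>n::nat. nrm (u [^] n \<otimes> y) \<le> D * r ^ n"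
  have x: "x \<in> carrier F" using assms by (auto simp: wt_def)
  have "nrm (u [^] n \<otimes> (x \<otimes> y)) \<le> q * D * r ^ n" using assms y D by (auto simp: wt_def)
  then show "nrm (u [^] n \<otimes> (\<ominus> x \<otimes> y)) \<le> q * D * r ^ n"
    using nrm_minus[of "u [^] n \<otimes> (x \<otimes> y)"] x y assms(2) by (simp add: l_minus r_minus)
qed (use assms in \<open>auto simp: wt_def\<close>)

lemma wt_one: assumes "u \<in> carrier F" shows "wt u r \<one> 1"
  using assms by (simp add: wt_def)

lemma wt_self: assumes u: "u \<in> carrier F" and r: "0 \<le> r" shows "wt u r u r"
  unfolding wt_def
proof (intro conjI ballI allI impI)
  fix y D and n :: nat assume y: "y \<in> carrier F" and D: "\<forall>n::nat. nrm (u [^] n \<otimes> y) \<le> D * r ^ n"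
  have "nrm (u [^] Suc n \<otimes> y) \<le> D * r ^ Suc n" using D by blast
  then show "nrm (u [^] n \<otimes> (u \<otimes> y)) \<le> r * D * r ^ n" using u y by (simp add: m_assoc mult_ac)
qed (use assms in auto)

lemma wt_mono: assumes "wt u r x q" "q \<le> q'" "u \<in> carrier F" "0 \<le> r" shows "wt u r x q'"
  unfolding wt_def
proof (intro conjI ballI allI impI)
  fix y D and n :: nat assume y: "y \<in> carrier F" and D: "\<forall>n::nat. nrm (u [^] n \<otimes> y) \<le> D * r ^ n"
  have "0 \<le> nrm y" by (rule nrm_nonneg[OF y])
  then have D0: "0 \<le> D" using D[rule_format, of 0] y by simp
  have "nrm (u [^] n \<otimes> (x \<otimes> y)) \<le> q * D * r ^ n" using assms y D by (auto simp: wt_def)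
  also have "\<dots> \<le> q' * D * r ^ n" using assms D0 by (intro mult_right_mono) auto
  finally show "nrm (u [^] n \<otimes> (x \<otimes> y)) \<le> q' * D * r ^ n" .
qed (use assms in \<open>auto simp: wt_def\<close>)

text \<open>For q \<le> 1/8 the factor 4q + 3 is at most 4, hence q^2 (4q + 3) \<le> q/2. Halving at
  each step is all that is needed.\<close>

lemma wt_newton:
  assumes x: "wt u r x q" and q: "q \<le> 1 / 8" and u: "u \<in> carrier F" and r: "0 \<le> r"
  shows "wt u r (x \<otimes> x \<otimes> (x \<oplus> x \<oplus> x \<oplus> x \<ominus> (\<one> \<oplus> \<one> \<oplus> \<one>))) (q / 2)"
proof (rule wt_mono[OF _ _ u r])
  note one = wt_one[OF u, of r]
  show "wt u r (x \<otimes> x \<otimes> (x \<oplus> x \<oplus> x \<oplus> x \<ominus> (\<one> \<oplus> \<one> \<oplus> \<one>))) (q * q * (q + q + q + q + (1 + 1 + 1)))"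
    unfolding a_minus_def by (intro wt_mult wt_add wt_minus x one u)
  have q0: "0 \<le> q" using x by (simp add: wt_def)
  have "q * (q * (q + q + q + q + (1 + 1 + 1))) \<le> q * (1 / 8 * 4)"
    using q q0 by (intro mult_left_mono mult_mono) auto
  then show "q * q * (q + q + q + q + (1 + 1 + 1)) \<le> q / 2" by (simp add: mult.assoc)
qed

text \<open>A small \<open>\<rho>\<close> does not make \<open>nrm\<close> small. In the norm
  adapted to the initial defect, however, the defect starts at 1/8 and is halved by every step, and
  returning to \<open>nrm\<close> costs a constant C that is fixed before the iteration. The
  positions near 1 at w and near 0 at w' survive.\<close>

lemma newton_refine:
  assumes z: "z \<in> carrier F" and \<rho>: "\<rho> (z \<otimes> z \<ominus> z) < 1 / 8" and e: "0 < e"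
    and w: "absolute_value F w" "w (\<one> \<ominus> z) \<le> 1 / 16" and w': "absolute_value F w'" "w' z \<le> 1 / 16"
  obtains y where "y \<in> carrier F" "nrm (y \<otimes> y \<ominus> y) < e" "w (\<one> \<ominus> y) \<le> 1 / 16" "w' y \<le> 1 / 16"
proof -
  let ?u = "\<lambda>z. z \<otimes> z \<ominus> z"
  have u: "?u z \<in> carrier F" using z by simp
  obtain C where C: "0 < C" "\<And>n::nat. nrm (?u z [^] n) \<le> C * (1 / 8) ^ n"
    using nrm.spectral_radius_less[OF u \<rho>] by blast
  have it: "(newton ^^ n) z \<in> carrier F \<and> wt (?u z) (1 / 8) (?u ((newton ^^ n) z)) (1 / 8 / 2 ^ n) \<and>
      w (\<one> \<ominus> (newton ^^ n) z) \<le> 1 / 16 \<and> w' ((newton ^^ n) z) \<le> 1 / 16" for n :: nat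
  proof (induction n)
    case 0
    show ?case using z u w w' wt_self[OF u, of "1 / 8"] by simp
  next
    case (Suc n)
    define y where "y = (newton ^^ n) z"
    have y: "y \<in> carrier F" "wt (?u z) (1 / 8) (?u y) (1 / 8 / 2 ^ n)" "w (\<one> \<ominus> y) \<le> 1 / 16" "w' y \<le> 1 / 16"
      using Suc by (auto simp: y_def)
    have "(1::real) / 2 ^ n \<le> 1" by (simp add: divide_le_eq_1)
    then have "wt (?u z) (1 / 8) (?u (newton y)) (1 / 8 / 2 ^ n / 2)"
      unfolding newton_defect[OF y(1)] by (intro wt_newton[OF y(2) _ u]) (simp_all add: field_simps)
    moreover have "w (\<one> \<ominus> newton y) \<le> 1 / 16"
      unfolding newton_complement[OF y(1)] using y by (intro newton_small[OF w(1)]) auto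
    moreover have "w' (newton y) \<le> 1 / 16" by (rule newton_small[OF w'(1) y(1,4)])
    ultimately show ?case using y by (simp add: y_def[symmetric] mult_ac)
  qed
  have "(\<lambda>n. 1 / 8 / 2 ^ n * C) \<longlonglongrightarrow> 0" by real_asymp
  then have "\<forall>\<^sub>F n in sequentially. 1 / 8 / 2 ^ n * C < e" using e by (rule order_tendstoD(2))
  then obtain n where n: "1 / 8 / 2 ^ n * C < e" by (auto simp: eventually_sequentially)
  define y where "y = (newton ^^ n) z"
  have y: "y \<in> carrier F" "wt (?u z) (1 / 8) (?u y) (1 / 8 / 2 ^ n)" "w (\<one> \<ominus> y) \<le> 1 / 16" "w' y \<le> 1 / 16"
    using it[of n] by (auto simp: y_def)
  \<comment> \<open>The adapted norm is left by applying \<open>wt\<close> to the element 1, with D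
    = C and n = 0.\<close>
  have "\<forall>n::nat. nrm (?u z [^] n \<otimes> \<one>) \<le> C * (1 / 8) ^ n" using C u by simp
  then have "nrm (?u z [^] (0::nat) \<otimes> (?u y \<otimes> \<one>)) \<le> 1 / 8 / 2 ^ n * C * (1 / 8) ^ 0"
    using y(2) unfolding wt_def by (meson one_closed)
  then have "nrm (?u y) < e" using n y by simp
  then show thesis using that y by blast
qed

text \<open>In coordinates t = t^2 + s is a quadratic system over K with coefficients
  \<open>sc\<close>, so the property assumed of K applies.\<close>

lemma quadratic_root:
  assumes Q: "quad_henselian K v" and e: "0 < e"
  obtains e' where "0 < e'"
    "\<And>s. \<lbrakk>s \<in> carrier F; nrm s < e'\<rbrakk> \<Longrightarrow> \<exists>t\<in>carrier F. nrm t \<le> e \<and> t = t \<otimes> t \<oplus> s"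
proof -
  define G where "G = M + 1"
  have G: "0 < G" using M_ge by (simp add: G_def)
  have scG: "v (sc i j k) < G" if "i < d" "j < d" "k < d" for i j k
  proof -
    have "v (sc i j k) \<le> (\<Sum>k<d. v (sc i j k))"
      using that sc_closed by (intro member_le_sum) auto
    also have "\<dots> \<le> (\<Sum>j<d. \<Sum>k<d. v (sc i j k))"
      using that sc_closed by (intro member_le_sum[of j "{..<d}" "\<lambda>j. \<Sum>k<d. v (sc i j k)"]) (auto intro!: sum_nonneg)
    also have "\<dots> \<le> (\<Sum>i<d. \<Sum>j<d. \<Sum>k<d. v (sc i j k))"
      using that sc_closed
      by (intro member_le_sum[of i "{..<d}" "\<lambda>i. \<Sum>j<d. \<Sum>k<d. v (sc i j k)"]) (auto intro!: sum_nonneg)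
    finally show ?thesis by (simp add: G_def M_def)
  qed
  \<comment> \<open>The first entry secures 8 G d^2 e' \<le> 1, the second nrm(t) \<le> M d (2 e')
    \<le> e. The added 1 keeps the denominators positive for every d.\<close>
  define e' where "e' = min (1 / (8 * G * (real d)\<^sup>2 + 1)) (e / (2 * M * d + 1))"
  have Gd: "0 \<le> 8 * G * (real d)\<^sup>2" using G by simp
  have Md: "0 \<le> 2 * M * d" using M_ge by simp
  have "0 < 8 * G * (real d)\<^sup>2 + 1" "0 < 2 * M * d + 1" using Gd Md by linarith+
  note pos = this
  then have e'0: "0 < e'" using e by (simp add: e'_def)
  have "8 * G * (real d)\<^sup>2 * e' \<le> 8 * G * (real d)\<^sup>2 * (1 / (8 * G * (real d)\<^sup>2 + 1))"
    using Gd by (intro mult_left_mono) (auto simp: e'_def)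
  also have "\<dots> \<le> 1" using Gd by (simp add: divide_simps)
  finally have e'1: "8 * G * (real d)\<^sup>2 * e' \<le> 1" .
  have "2 * M * d * e' \<le> 2 * M * d * (e / (2 * M * d + 1))"
    using Md by (intro mult_left_mono) (auto simp: e'_def)
  also have "\<dots> \<le> (2 * M * d + 1) * (e / (2 * M * d + 1))"
    using pos(2) e by (intro mult_right_mono) auto
  also have "\<dots> = e" using pos(2) by simp
  finally have e'2: "2 * M * d * e' \<le> e" .
  have "\<exists>t\<in>carrier F. nrm t \<le> e \<and> t = t \<otimes> t \<oplus> s" if s: "s \<in> carrier F" "nrm s < e'" for s
  proof -
    have "\<forall>k<d. c k s \<in> carrier K \<and> v (c k s) < e'"
      using s coord_le_nrm[OF s(1)] c_closed by force
    then have "\<exists>t. \<forall>k<d. t k \<in> carrier K \<and> v (t k) \<le> 2 * e' \<and>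
        t k = (\<Oplus>\<^bsub>K\<^esub>i\<in>{..<d}. \<Oplus>\<^bsub>K\<^esub>j\<in>{..<d}. t i \<otimes>\<^bsub>K\<^esub> t j \<otimes>\<^bsub>K\<^esub> sc i j k) \<oplus>\<^bsub>K\<^esub> c k s"
      using Q[unfolded quad_henselian_def, rule_format, of G e' d sc "\<lambda>k. c k s"] G e'0 e'1 scG sc_closed by blast
    then obtain t where t: "\<And>k. k < d \<Longrightarrow> t k \<in> carrier K" "\<And>k. k < d \<Longrightarrow> v (t k) \<le> 2 * e'"
      "\<And>k. k < d \<Longrightarrow> t k = (\<Oplus>\<^bsub>K\<^esub>i\<in>{..<d}. \<Oplus>\<^bsub>K\<^esub>j\<in>{..<d}. t i \<otimes>\<^bsub>K\<^esub> t j \<otimes>\<^bsub>K\<^esub> sc i j k) \<oplus>\<^bsub>K\<^esub> c k s"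
      by blast
    define T where "T = (\<Oplus>i\<in>{..<d}. h (t i) \<otimes> bas i)"
    have T: "T \<in> carrier F" unfolding T_def using t(1) bas by (intro finsum_closed) auto
    \<comment> \<open>The coordinates of a given combination such as \<open>T\<close> are not
      directly available. Hence x is formed first, its coordinates are computed from the system, and
      \<open>expand\<close> then identifies it with \<open>T\<close>.\<close>
    define x where "x = T \<otimes> T \<oplus> s"
    have x: "x \<in> carrier F" using T s by (simp add: x_def)
    have cx: "c k x = t k" if k: "k < d" for k
    proof -
      have "c k x = c k (T \<otimes> T) \<oplus>\<^bsub>K\<^esub> c k s" unfolding x_def using T s k by (intro c_add) auto
      also have "\<dots> = t k" unfolding T_def using comb_mult[of t t k] t k by simp
      finally show ?thesis .
    qed
    have "T = (\<Oplus>i\<in>{..<d}. h (c i x) \<otimes> bas i)"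
      unfolding T_def using cx t(1) bas by (intro finsum_cong') auto
    then have eq: "T = x" using expand[OF x] by simp
    have "n0 T \<le> (\<Sum>k<d. 2 * e')" unfolding n0_def using cx t(2) eq by (intro sum_mono) auto
    then have "nrm T \<le> M * (\<Sum>k<d. 2 * e')" unfolding nrm_def using M_ge by (intro mult_left_mono) auto
    also have "\<dots> \<le> e" using e'2 by (simp add: mult_ac)
    finally show ?thesis using T eq x_def by blast
  qed
  with e'0 show thesis by (rule that)
qed

text \<open>The correction y + (1-2y) t with t = t^2 + u/(1+4u) is an exact idempotent of a field,
  hence 0 or 1. Staying close to 1 at w and to 0 at w' excludes both.\<close>

lemma lift_idempotent:
  assumes Q: "quad_henselian K v" and w: "extends w" and w': "extends w'"
    and y: "\<And>e. 0 < e \<Longrightarrow> \<exists>y\<in>carrier F. nrm (y \<otimes> y \<ominus> y) < e \<and> w (\<one> \<ominus> y) \<le> 1 / 16 \<and> w' y \<le> 1 / 16"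
  shows False
proof -
  interpret w: valued_field F w by (rule extends_valued_field[OF w])
  interpret w': valued_field F w' by (rule extends_valued_field[OF w'])
  obtain C where C: "0 < C" "\<And>x. x \<in> carrier F \<Longrightarrow> w x \<le> C * nrm x" using extends_bound[OF w] by blast
  obtain C' where C': "0 < C'" "\<And>x. x \<in> carrier F \<Longrightarrow> w' x \<le> C' * nrm x" using extends_bound[OF w'] by blast
  \<comment> \<open>Makes w(t) and w'(t) at most 1/4. As 1 - 2y is at most 9/8 for both, the
    correction is at most 9/32, and 1/16 + 9/32 < 1.\<close>
  define e where "e = 1 / (4 * (C + C'))"
  have e: "0 < e" "C * e \<le> 1 / 4" "C' * e \<le> 1 / 4" using C(1) C'(1) by (auto simp: e_def field_simps)
  obtain e' where e': "0 < e'"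
    "\<And>s. \<lbrakk>s \<in> carrier F; nrm s < e'\<rbrakk> \<Longrightarrow> \<exists>t\<in>carrier F. nrm t \<le> e \<and> t = t \<otimes> t \<oplus> s"
    using quadratic_root[OF Q e(1)] by blast
  \<comment> \<open>Below 1/8 the defect satisfies nrm(4u) \<le> 1/2, whence nrm(s) \<le> 2 nrm(u)
    for s = u/(1+4u). Below e'/2 this is less than e'.\<close>
  obtain y where y: "y \<in> carrier F" "nrm (y \<otimes> y \<ominus> y) < min (e' / 2) (1 / 8)" "w (\<one> \<ominus> y) \<le> 1 / 16" "w' y \<le> 1 / 16"
    using y[of "min (e' / 2) (1 / 8)"] e'(1) by auto
  define u where "u = y \<otimes> y \<ominus> y"
  have u: "u \<in> carrier F" "nrm u < e' / 2" "nrm u < 1 / 8" using y by (auto simp: u_def)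
  define q where "q = \<one> \<oplus> (u \<oplus> u \<oplus> u \<oplus> u)"
  have q: "q \<in> carrier F" using u by (simp add: q_def)
  have sq: "(\<one> \<ominus> (y \<oplus> y)) \<otimes> (\<one> \<ominus> (y \<oplus> y)) = q"
    unfolding q_def u_def using square_one_minus_double[OF y(1)] .
  have w'yy: "w' (y \<oplus> y) \<le> 1 / 8" using w'.v_add[of y y] y by simp
  have q0: "q \<noteq> \<zero>"
  proof
    assume "q = \<zero>"
    then have "\<one> = y \<oplus> y"
      using integral[of "\<one> \<ominus> (y \<oplus> y)" "\<one> \<ominus> (y \<oplus> y)"] sq y(1) by auto
    then have "w' \<one> \<le> 1 / 8" using w'yy by simp
    then show False by simp
  qed
  define s where "s = u \<otimes> inv q"
  have s: "s \<in> carrier F" using u w.inv_closed[OF q q0] by (simp add: s_def)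
  have sqq: "s \<otimes> q = u" using w.l_inv_field[OF q q0] w.inv_closed[OF q q0] u q by (simp add: s_def m_assoc)
  \<comment> \<open>Reading s (1 + 4u) = u as an equation for s bounds s without any estimate for
    the inverse of 1 + 4u.\<close>
  have s_eq: "s = u \<ominus> s \<otimes> (u \<oplus> u \<oplus> u \<oplus> u)"
  proof -
    have "u \<ominus> s \<otimes> (u \<oplus> u \<oplus> u \<oplus> u) = s \<otimes> q \<ominus> s \<otimes> (u \<oplus> u \<oplus> u \<oplus> u)" by (simp only: sqq)
    also have "\<dots> = s" using s u(1) by (simp add: ring_expand q_def)
    finally show ?thesis by simp
  qed
  have "nrm (u \<oplus> u \<oplus> u \<oplus> u) \<le> nrm u + nrm u + nrm u + nrm u"
    using nrm.triangle[of "u \<oplus> u \<oplus> u" u] nrm.triangle[of "u \<oplus> u" u] nrm.triangle[of u u] u by simp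
  then have "nrm (u \<oplus> u \<oplus> u \<oplus> u) \<le> 1 / 2" using u by linarith
  then have "nrm s * nrm (u \<oplus> u \<oplus> u \<oplus> u) \<le> nrm s * (1 / 2)"
    using nrm_nonneg[OF s] by (rule mult_left_mono)
  then have "nrm (s \<otimes> (u \<oplus> u \<oplus> u \<oplus> u)) \<le> nrm s * (1 / 2)"
    using nrm.submult[of s "u \<oplus> u \<oplus> u \<oplus> u"] u s by simp
  moreover have "nrm s \<le> nrm u + nrm (\<ominus> (s \<otimes> (u \<oplus> u \<oplus> u \<oplus> u)))"
    using nrm.triangle[of u "\<ominus> (s \<otimes> (u \<oplus> u \<oplus> u \<oplus> u))"] s_eq u s by (simp add: a_minus_def)
  moreover have "nrm (\<ominus> (s \<otimes> (u \<oplus> u \<oplus> u \<oplus> u))) = nrm (s \<otimes> (u \<oplus> u \<oplus> u \<oplus> u))"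
    using u s by (intro nrm_minus) auto
  ultimately have "nrm s < e'" using u by linarith
  then obtain t where t: "t \<in> carrier F" "nrm t \<le> e" "t = t \<otimes> t \<oplus> s" using e'(2) s by blast
  have wt: "w t \<le> 1 / 4" "w' t \<le> 1 / 4"
    using C(2)[OF t(1)] C'(2)[OF t(1)] mult_left_mono[OF t(2), of C] mult_left_mono[OF t(2), of C'] C(1) C'(1) e
    by linarith+
  define f where "f = y \<oplus> (\<one> \<ominus> (y \<oplus> y)) \<otimes> t"
  have f: "f \<in> carrier F" using y t by (simp add: f_def)
  have "f \<otimes> f \<ominus> f = u \<oplus> (((\<one> \<ominus> (y \<oplus> y)) \<otimes> (\<one> \<ominus> (y \<oplus> y))) \<otimes> (t \<otimes> t) \<ominus> ((\<one> \<ominus> (y \<oplus> y)) \<otimes> (\<one> \<ominus> (y \<oplus> y))) \<otimes> t)"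
    unfolding f_def u_def using newton_step_defect[OF y(1) t(1)] .
  also have "\<dots> = s \<otimes> q \<oplus> (q \<otimes> (t \<otimes> t) \<ominus> q \<otimes> (t \<otimes> t \<oplus> s))"
    using t(3) by (simp add: sq sqq)
  also have "\<dots> = \<zero>"
  proof -
    have "s \<otimes> q \<oplus> q \<otimes> (t \<otimes> t) = q \<otimes> (t \<otimes> t \<oplus> s)"
      using q s t(1) by (simp add: ring_expand)
    then show ?thesis using q s t(1) by (simp add: a_minus_def a_assoc[symmetric] r_neg)
  qed
  finally have "f \<otimes> f \<ominus> f = \<zero>" .
  moreover have "f \<otimes> f \<ominus> f = f \<otimes> (f \<ominus> \<one>)" using f by (simp add: ring_expand)
  ultimately have "f = \<zero> \<or> f \<ominus> \<one> = \<zero>" using f integral[of f "f \<ominus> \<one>"] by simp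
  moreover have "w' f < 1"
  proof -
    have "w' (\<one> \<ominus> (y \<oplus> y)) \<le> 9 / 8" using w'.v_diff[of \<one> "y \<oplus> y"] w'yy y(1) by simp
    then have "w' ((\<one> \<ominus> (y \<oplus> y)) \<otimes> t) \<le> 9 / 8 * (1 / 4)"
      using wt y(1) t(1) by (simp only: w'.v_mult a_closed minus_closed one_closed) (intro mult_mono, auto)
    then show ?thesis using w'.v_add[of y "(\<one> \<ominus> (y \<oplus> y)) \<otimes> t"] y t by (simp add: f_def)
  qed
  moreover have "w (\<one> \<ominus> f) < 1"
  proof -
    define y' where "y' = \<one> \<ominus> y"
    have y': "y' \<in> carrier F" "w y' \<le> 1 / 16" using y by (auto simp: y'_def)
    have eq: "\<one> \<ominus> f = y' \<oplus> (\<one> \<ominus> (y' \<oplus> y')) \<otimes> t"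
      unfolding f_def y'_def using newton_step_complement[OF y(1) t(1)] .
    have "w (\<one> \<ominus> (y' \<oplus> y')) \<le> 9 / 8" using w.v_diff[of \<one> "y' \<oplus> y'"] w.v_add[of y' y'] y' by simp
    then have "w ((\<one> \<ominus> (y' \<oplus> y')) \<otimes> t) \<le> 9 / 8 * (1 / 4)"
      using wt y'(1) t(1) by (simp only: w.v_mult a_closed minus_closed one_closed) (intro mult_mono, auto)
    then show ?thesis using w.v_add[of y' "(\<one> \<ominus> (y' \<oplus> y')) \<otimes> t"] y' t by (simp add: eq)
  qed
  ultimately show False
  proof (elim disjE)
    assume "f = \<zero>" "w (\<one> \<ominus> f) < 1"
    then show False by (simp add: a_minus_def)
  next
    assume "f \<ominus> \<one> = \<zero>" "w' f < 1"
    then have "f = \<one>" using f by simp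
    with \<open>w' f < 1\<close> show False by simp
  qed
qed

theorem unique_extension:
  assumes Q: "quad_henselian K v"
  shows "\<exists>!w. w \<in> extensional (carrier F) \<and> extends w"
proof -
  obtain w0 where "w0 \<in> S" using \<rho>_attained[OF one_closed one_not_zero] by blast
  have "w = w'" if w: "w \<in> S" and w': "w' \<in> S" for w w'
  proof (rule ccontr)
    assume ne: "w \<noteq> w'"
    have ext: "extends w" "extends w'" using w w' by (auto simp: S_def)
    obtain z where z: "z \<in> carrier F" "w (\<one> \<ominus> z) < 1 / 16" "\<forall>w'\<in>S - {w}. w' z < 1 / 16"
      using S_approx[of "S - {w}" w "1 / 16"] finite_S w by auto
    have avS: "absolute_value F g" if "g \<in> S" for g using that by (simp add: S_def extends_abs_def)
    \<comment> \<open>The radius is attained at some extension g. At g = w the factor 1 - z is at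
      most 1/16, at every other g the factor z is; the remaining factor is at most 17/16, and 17/256
      < 1/8.\<close>
    have "\<rho> (z \<otimes> z \<ominus> z) < 1 / 8"
    proof (cases "z \<otimes> z \<ominus> z = \<zero>")
      case True
      then show ?thesis by (simp add: nrm.spectral_radius_zero)
    next
      case False
      obtain g where g: "g \<in> S" "g (z \<otimes> z \<ominus> z) = \<rho> (z \<otimes> z \<ominus> z)"
        using \<rho>_attained[OF _ False] z(1) by auto
      interpret g: valued_field F g by (rule valued_fieldI[OF avS[OF g(1)]])
      obtain a b where ab: "a \<in> carrier F" "b \<in> carrier F" "\<ominus> (a \<otimes> b) = z \<otimes> z \<ominus> z" "g a \<le> 1 / 16" "g b \<le> 17 / 16"
      proof (cases "g = w")
        case True
        have "z = \<one> \<ominus> (\<one> \<ominus> z)" using z(1) by (simp add: ring_expand)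
        then have "g z \<le> 1 + g (\<one> \<ominus> z)" using g.v_diff[of \<one> "\<one> \<ominus> z"] z(1) by simp
        then have "g z \<le> 17 / 16" "g (\<one> \<ominus> z) \<le> 1 / 16" using z(2) True by auto
        moreover have "\<ominus> ((\<one> \<ominus> z) \<otimes> z) = z \<otimes> z \<ominus> z" using z(1) by (simp add: ring_expand)
        ultimately show thesis using that[of "\<one> \<ominus> z" z] z True by simp
      next
        case False
        have "\<ominus> (z \<otimes> (\<one> \<ominus> z)) = z \<otimes> z \<ominus> z" using z(1) by (simp add: ring_expand)
        moreover have gz: "g z \<le> 1 / 16" using z(3) g(1) False by force
        moreover have "g (\<one> \<ominus> z) \<le> 17 / 16" using g.v_diff[of \<one> z] z(1) gz by simp
        ultimately show thesis using that[of z "\<one> \<ominus> z"] z(1) by simp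
      qed
      have "g (\<ominus> (a \<otimes> b)) = g a * g b" using ab(1,2) by (simp add: g.v_mult)
      then have "\<rho> (z \<otimes> z \<ominus> z) = g a * g b" using g(2) unfolding ab(3) by simp
      also have "\<dots> \<le> 1 / 16 * (17 / 16)" using ab by (intro mult_mono) auto
      finally show ?thesis by simp
    qed
    moreover have "w' z \<le> 1 / 16" using z(3) w' ne by force
    ultimately have "\<exists>y\<in>carrier F. nrm (y \<otimes> y \<ominus> y) < e \<and> w (\<one> \<ominus> y) \<le> 1 / 16 \<and> w' y \<le> 1 / 16"
      if "0 < e" for e
      using newton_refine[OF z(1) _ that avS[OF w] less_imp_le[OF z(2)] avS[OF w'], of ?thesis] by blast
    then show False by (rule lift_idempotent[OF Q ext])
  qed
  with \<open>w0 \<in> S\<close> have "\<exists>!w. w \<in> S" by blast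
  then show ?thesis by (simp add: S_def)
qed

end

section \<open>Algebraic extensions\<close>

lemma (in ring) combine_eq_finsum:
  "\<lbrakk>length Ks = length Us; set Ks \<subseteq> carrier R; set Us \<subseteq> carrier R\<rbrakk> \<Longrightarrow>
    combine Ks Us = (\<Oplus>i\<in>{..<length Us}. Ks ! i \<otimes> Us ! i)"
proof (induction Ks Us rule: list_induct2)
  case (Cons k Ks u Us)
  have cl: "Ks ! i \<otimes> Us ! i \<in> carrier R" if "i < length Us" for i
    using Cons that by (intro m_closed subsetD[OF _ nth_mem]) auto
  have "(\<Oplus>i\<in>{..<length (u # Us)}. (k # Ks) ! i \<otimes> (u # Us) ! i) =
      (\<Oplus>i\<in>insert 0 (Suc ` {..<length Us}). (k # Ks) ! i \<otimes> (u # Us) ! i)"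
    by (simp add: lessThan_Suc_eq_insert_0)
  also have "\<dots> = k \<otimes> u \<oplus> (\<Oplus>i\<in>Suc ` {..<length Us}. (k # Ks) ! i \<otimes> (u # Us) ! i)"
    using Cons cl by (subst finsum_insert) auto
  also have "(\<Oplus>i\<in>Suc ` {..<length Us}. (k # Ks) ! i \<otimes> (u # Us) ! i) =
      (\<Oplus>i\<in>{..<length Us}. Ks ! i \<otimes> Us ! i)"
    using cl by (subst finsum_reindex) auto
  finally show ?case using Cons by simp
qed simp

text \<open>Supplies the data of \<open>finite_valued_extension\<close>. The coordinates are the
  coefficients singled out by the unique decomposition in a base, and their additivity and
  homogeneity follow from that uniqueness.\<close>

lemma (in ring) basis_coordinates:
  assumes K: "subfield K R" and dim: "dimension n K E"
  obtains bas c where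
    "\<And>i. i < n \<Longrightarrow> bas i \<in> E"
    "\<And>i x. i < n \<Longrightarrow> x \<in> E \<Longrightarrow> c i x \<in> K"
    "\<And>x. x \<in> E \<Longrightarrow> (\<Oplus>i\<in>{..<n}. c i x \<otimes> bas i) = x"
    "\<And>i x y. i < n \<Longrightarrow> x \<in> E \<Longrightarrow> y \<in> E \<Longrightarrow> c i (x \<oplus> y) = c i x \<oplus> c i y"
    "\<And>i a x. i < n \<Longrightarrow> a \<in> K \<Longrightarrow> x \<in> E \<Longrightarrow> c i (a \<otimes> x) = a \<otimes> c i x"
    "\<And>ys. (\<And>i. i \<le> n \<Longrightarrow> ys i \<in> E) \<Longrightarrow>
      \<exists>a. (\<forall>i\<le>n. a i \<in> K) \<and> (\<exists>i\<le>n. a i \<noteq> \<zero>) \<and> (\<Oplus>i\<in>{..n}. a i \<otimes> ys i) = \<zero>"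
proof -
  note sub = subringE[OF subfieldE(1)[OF K]]
  obtain Us where Us: "set Us \<subseteq> carrier R" "independent K Us" "length Us = n" "Span K Us = E"
    using exists_base[OF K dim] by blast
  define bas where "bas i = Us ! i" for i
  have bas_carrier: "bas i \<in> carrier R" if "i < n" for i
    using Us that by (auto simp: bas_def)
  have in_Us: "bas i \<in> E" if "i < n" for i
    using Us that Span_base_incl[OF K Us(1)] by (auto simp: bas_def)
  have E: "E \<subseteq> carrier R" using Span_in_carrier[OF _ Us(1), of K] sub(1) Us(4) by simp
  define D where "D x = (THE Ks. set Ks \<subseteq> K \<and> length Ks = n \<and> x = combine Ks Us)" for x
  define c where "c i x = D x ! i" for i x
  have ex1: "\<exists>!Ks. set Ks \<subseteq> K \<and> length Ks = n \<and> x = combine Ks Us" if "x \<in> E" for x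
    using unique_decomposition[OF K Us(2)] that Us by simp
  have D: "set (D x) \<subseteq> K \<and> length (D x) = n \<and> x = combine (D x) Us" if "x \<in> E" for x
    unfolding D_def by (rule theI'[OF ex1[OF that]])
  have c: "c i x \<in> K" if "i < n" "x \<in> E" for i x
    using D[OF that(2)] that(1) unfolding c_def by (metis nth_mem subsetD)
  have expand: "(\<Oplus>i\<in>{..<n}. c i x \<otimes> bas i) = x" if x: "x \<in> E" for x
  proof -
    have "combine (D x) Us = (\<Oplus>i\<in>{..<length Us}. D x ! i \<otimes> Us ! i)"
      using D[OF x] Us sub(1) by (intro combine_eq_finsum) auto
    then show ?thesis using D[OF x] Us by (simp add: c_def bas_def)
  qed
  have comb: "(\<Oplus>i\<in>{..<n}. a i \<otimes> bas i) = combine (map a [0..<n]) Us" if "\<And>i. i < n \<Longrightarrow> a i \<in> K" for a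
  proof -
    have "combine (map a [0..<n]) Us = (\<Oplus>i\<in>{..<length Us}. map a [0..<n] ! i \<otimes> Us ! i)"
      using that Us sub(1) by (intro combine_eq_finsum) auto
    also have "\<dots> = (\<Oplus>i\<in>{..<n}. a i \<otimes> bas i)"
      using that bas_carrier sub(1) Us(3) by (intro finsum_cong') (auto simp: bas_def)
    finally show ?thesis by simp
  qed
  have mem: "(\<Oplus>i\<in>{..<n}. a i \<otimes> bas i) \<in> E" if "\<And>i. i < n \<Longrightarrow> a i \<in> K" for a
  proof -
    have SpE: "E = {combine Ks Us | Ks. length Ks = length Us \<and> set Ks \<subseteq> K}"
      using Span_eq_combine_set_length_version[OF K Us(1)] Us(4) by (simp only:)
    have "combine (map a [0..<n]) Us \<in> E"
      unfolding SpE using that Us(3) by (intro CollectI exI[of _ "map a [0..<n]"]) auto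
    then show ?thesis by (simp only: comb[OF that])
  qed
  have uniq: "c i (\<Oplus>i\<in>{..<n}. a i \<otimes> bas i) = a i" if a: "\<And>i. i < n \<Longrightarrow> a i \<in> K" and i: "i < n" for a i
  proof -
    have "set (map a [0..<n]) \<subseteq> K" using a by auto
    then have "D (\<Oplus>i\<in>{..<n}. a i \<otimes> bas i) = map a [0..<n]"
      unfolding D_def by (intro the1_equality[OF ex1[OF mem[OF a]]]) (auto simp: comb[OF a])
    then show ?thesis using i by (simp add: c_def)
  qed
  show thesis
  proof (rule that)
    show "bas i \<in> E" if "i < n" for i by (rule in_Us[OF that])
    show "c i x \<in> K" if "i < n" "x \<in> E" for i x by (rule c[OF that])
    show "(\<Oplus>i\<in>{..<n}. c i x \<otimes> bas i) = x" if "x \<in> E" for x by (rule expand[OF that])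
    show "c i (x \<oplus> y) = c i x \<oplus> c i y" if i: "i < n" and x: "x \<in> E" and y: "y \<in> E" for i x y
    proof -
      have cx: "c j x \<in> carrier R" "c j y \<in> carrier R" if "j < n" for j using c x y that sub(1) by auto
      have "x \<oplus> y = (\<Oplus>i\<in>{..<n}. c i x \<otimes> bas i) \<oplus> (\<Oplus>i\<in>{..<n}. c i y \<otimes> bas i)"
        using expand x y by simp
      also have "\<dots> = (\<Oplus>i\<in>{..<n}. c i x \<otimes> bas i \<oplus> c i y \<otimes> bas i)"
        using cx bas_carrier by (intro finsum_addf[symmetric]) auto
      also have "\<dots> = (\<Oplus>i\<in>{..<n}. (c i x \<oplus> c i y) \<otimes> bas i)"
        using cx bas_carrier by (intro finsum_cong') (auto simp: l_distr)
      finally have eq: "x \<oplus> y = (\<Oplus>i\<in>{..<n}. (c i x \<oplus> c i y) \<otimes> bas i)" .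
      show ?thesis unfolding eq using c x y sub(7) i by (intro uniq) auto
    qed
    show "c i (a \<otimes> x) = a \<otimes> c i x" if i: "i < n" and a: "a \<in> K" and x: "x \<in> E" for i a x
    proof -
      have cx: "c j x \<in> carrier R" if "j < n" for j using c x that sub(1) by auto
      have aR: "a \<in> carrier R" using a sub(1) by auto
      have "a \<otimes> x = a \<otimes> (\<Oplus>i\<in>{..<n}. c i x \<otimes> bas i)" using expand x by simp
      also have "\<dots> = (\<Oplus>i\<in>{..<n}. a \<otimes> (c i x \<otimes> bas i))"
        using cx bas_carrier aR by (intro finsum_rdistr) auto
      also have "\<dots> = (\<Oplus>i\<in>{..<n}. (a \<otimes> c i x) \<otimes> bas i)"
        using cx bas_carrier aR by (intro finsum_cong') (auto simp: m_assoc)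
      finally have eq: "a \<otimes> x = (\<Oplus>i\<in>{..<n}. (a \<otimes> c i x) \<otimes> bas i)" .
      show ?thesis unfolding eq using c x a sub(6) i by (intro uniq) auto
    qed
    show "\<exists>a. (\<forall>i\<le>n. a i \<in> K) \<and> (\<exists>i\<le>n. a i \<noteq> \<zero>) \<and> (\<Oplus>i\<in>{..n}. a i \<otimes> ys i) = \<zero>"
      if ys: "\<And>i. i \<le> n \<Longrightarrow> ys i \<in> E" for ys
    proof -
      \<comment> \<open>One element more than the dimension, so the list cannot be
        independent.\<close>
      define Ys where "Ys = map ys [0..<Suc n]"
      have setY: "set Ys \<subseteq> E" using ys by (auto simp: Ys_def)
      then have YR: "set Ys \<subseteq> carrier R" using E by blast
      have len: "length Ys = Suc n" by (simp add: Ys_def)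
      have "dependent K Ys"
        using independent_length_le_dimension[OF K dim _ setY] len by auto
      then obtain Ks where Ks: "length Ks = length Ys" "combine Ks Ys = \<zero>" "set Ks \<subseteq> K" "set Ks \<noteq> {\<zero>}"
        using dependent_imp_non_trivial_combine[OF K YR] by blast
      have "combine Ks Ys = (\<Oplus>i\<in>{..<length Ys}. Ks ! i \<otimes> Ys ! i)"
        using Ks YR sub(1) by (intro combine_eq_finsum) auto
      also have "\<dots> = (\<Oplus>i\<in>{..n}. Ks ! i \<otimes> ys i)"
      proof (rule finsum_cong')
        show "(\<lambda>i. Ks ! i \<otimes> ys i) \<in> {..n} \<rightarrow> carrier R"
          using Ks(1,3) len ys E sub(1) by (auto intro!: m_closed) (metis less_Suc_eq_le nth_mem subsetD)
        show "Ks ! i \<otimes> Ys ! i = Ks ! i \<otimes> ys i" if "i \<in> {..n}" for i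
          using that nth_map[of i "[0..<Suc n]" ys] nth_upt[of 0 i "Suc n"] by (simp add: Ys_def del: upt_Suc)
      qed (auto simp: len)
      finally have sum0: "(\<Oplus>i\<in>{..n}. Ks ! i \<otimes> ys i) = \<zero>" using Ks(2) by simp
      have "Ks ! i \<in> K" if "i \<le> n" for i using Ks(1,3) len that by (metis less_Suc_eq_le nth_mem subsetD)
      moreover have "\<exists>i\<le>n. Ks ! i \<noteq> \<zero>"
      proof (rule ccontr)
        assume "\<not> ?thesis"
        then have "set Ks \<subseteq> {\<zero>}" using Ks(1) len by (auto simp: in_set_conv_nth less_Suc_eq_le)
        moreover have "set Ks \<noteq> {}" using Ks(1) len by auto
        ultimately show False using Ks(4) subset_singletonD by metis
      qed
      ultimately show ?thesis using sum0 by (intro exI[of _ "\<lambda>i. Ks ! i"]) auto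
    qed
  qed
qed

lemma (in ring) finsum_subring:
  assumes "subring F R" "finite I" "f \<in> I \<rightarrow> F"
  shows "finsum (R\<lparr>carrier := F\<rparr>) f I = finsum R f I"
proof -
  interpret F: ring "R\<lparr>carrier := F\<rparr>" by (rule subring_is_ring[OF assms(1)])
  show ?thesis using assms(2,3)
  proof (induction I rule: finite_induct)
    case (insert i I)
    have "F \<subseteq> carrier R" by (rule subringE(1)[OF assms(1)])
    then have f: "f i \<in> carrier R" "f \<in> I \<rightarrow> carrier R" "f i \<in> F" "f \<in> I \<rightarrow> F"
      using insert.prems by auto
    then have "finsum (R\<lparr>carrier := F\<rparr>) f (insert i I) = f i \<oplus> finsum (R\<lparr>carrier := F\<rparr>) f I"
      using F.finsum_insert[OF insert.hyps(1,2), of f] by simp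
    with f insert show ?case by simp
  qed simp
qed

theorem quad_henselian_imp_henselian:
  fixes K :: "('k, 'm) ring_scheme"
  assumes K: "field K" and v: "absolute_value K v" and Q: "quad_henselian K v"
  shows "henselian_field TYPE('l) K v"
  unfolding henselian_field_def
proof (intro conjI allI impI K v)
  fix L :: "'l ring" and h assume alg: "algebraic_extension K h L"
  then have L: "field L" and h: "h \<in> ring_hom K L"
    and algebraic: "\<And>a. a \<in> carrier L \<Longrightarrow> (ring.algebraic L over (h ` carrier K)) a"
    by (auto simp: algebraic_extension_def)
  interpret L: field L by (rule L)
  interpret K: field K by (rule K)
  interpret K: valued_field K v by (rule K.valued_fieldI[OF v])
  interpret h: ring_hom_ring K L h by unfold_locales (rule h)
  define K' where "K' = h ` carrier K"
  have K': "subfield K' L" and inj: "inj_on h (carrier K)"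
    unfolding K'_def using h.img_is_subfield[OF K.carrier_is_subfield] L.one_not_zero by auto
  note subK' = subringE[OF subfieldE(1)[OF K']]
  \<comment> \<open>The inverse of h on its image; it turns coordinates in the subfield K' of L into
    coordinates in K.\<close>
  define g where "g = inv_into (carrier K) h"
  have g: "g x \<in> carrier K" "h (g x) = x" if "x \<in> K'" for x
    using that inv_into_into[of x h "carrier K"] f_inv_into_f[of x h "carrier K"] by (auto simp: g_def K'_def)
  have gh: "g (h a) = a" if "a \<in> carrier K" for a using that inj by (simp add: g_def)
  have g_add: "g (x \<oplus>\<^bsub>L\<^esub> y) = g x \<oplus>\<^bsub>K\<^esub> g y" if "x \<in> K'" "y \<in> K'" for x y
    using that g gh[of "g x \<oplus>\<^bsub>K\<^esub> g y"] by simp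
  have g_mult: "g (h a \<otimes>\<^bsub>L\<^esub> y) = a \<otimes>\<^bsub>K\<^esub> g y" if "a \<in> carrier K" "y \<in> K'" for a y
    using that g gh[of "a \<otimes>\<^bsub>K\<^esub> g y"] by simp
  have fin: "\<exists>!w. w \<in> extensional F \<and> extends_abs K v h (L\<lparr>carrier := F\<rparr>) w"
    if F: "subfield F L" and KF: "K' \<subseteq> F" and dim: "ring.dimension L n K' F" for F n
  proof -
    note subF = subringE[OF subfieldE(1)[OF F]]
    interpret F: field "L\<lparr>carrier := F\<rparr>" using L.subfield_iff(2)[OF F] .
    obtain bas c where
      bas: "\<And>i. i < n \<Longrightarrow> bas i \<in> F"
      and c: "\<And>i x. i < n \<Longrightarrow> x \<in> F \<Longrightarrow> c i x \<in> K'"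
      and ex: "\<And>x. x \<in> F \<Longrightarrow> (\<Oplus>\<^bsub>L\<^esub>i\<in>{..<n}. c i x \<otimes>\<^bsub>L\<^esub> bas i) = x"
      and c_add: "\<And>i x y. i < n \<Longrightarrow> x \<in> F \<Longrightarrow> y \<in> F \<Longrightarrow> c i (x \<oplus>\<^bsub>L\<^esub> y) = c i x \<oplus>\<^bsub>L\<^esub> c i y"
      and c_mult: "\<And>i a x. i < n \<Longrightarrow> a \<in> K' \<Longrightarrow> x \<in> F \<Longrightarrow> c i (a \<otimes>\<^bsub>L\<^esub> x) = a \<otimes>\<^bsub>L\<^esub> c i x"
      and dep: "\<And>ys. (\<And>i. i \<le> n \<Longrightarrow> ys i \<in> F) \<Longrightarrow> \<exists>a. (\<forall>i\<le>n. a i \<in> K') \<and>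
        (\<exists>i\<le>n. a i \<noteq> \<zero>\<^bsub>L\<^esub>) \<and> (\<Oplus>\<^bsub>L\<^esub>i\<in>{..n}. a i \<otimes>\<^bsub>L\<^esub> ys i) = \<zero>\<^bsub>L\<^esub>"
      using L.basis_coordinates[OF K' dim] by blast
    have hF: "h a \<in> F" if "a \<in> carrier K" for a using that KF by (auto simp: K'_def)
    have fs: "finsum (L\<lparr>carrier := F\<rparr>) f I = finsum L f I" if "finite I" "f \<in> I \<rightarrow> F" for f and I :: "nat set"
      by (rule L.finsum_subring[OF subfieldE(1)[OF F] that])
    interpret E: finite_valued_extension K v "L\<lparr>carrier := F\<rparr>" h n bas "\<lambda>i x. g (c i x)"
    proof unfold_locales
      show "h \<in> ring_hom K (L\<lparr>carrier := F\<rparr>)" using h hF by (auto simp: ring_hom_def)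
      fix i assume i: "i < n"
      show "bas i \<in> carrier (L\<lparr>carrier := F\<rparr>)" using bas i by simp
      fix x assume x: "x \<in> carrier (L\<lparr>carrier := F\<rparr>)"
      show "g (c i x) \<in> carrier K" using g c i x by simp
      show "g (c i (x \<oplus>\<^bsub>L\<lparr>carrier := F\<rparr>\<^esub> y)) = g (c i x) \<oplus>\<^bsub>K\<^esub> g (c i y)"
        if "y \<in> carrier (L\<lparr>carrier := F\<rparr>)" for y
        using that i x c g_add by (simp add: c_add)
      show "g (c i (h a \<otimes>\<^bsub>L\<lparr>carrier := F\<rparr>\<^esub> x)) = a \<otimes>\<^bsub>K\<^esub> g (c i x)" if "a \<in> carrier K" for a
      proof -
        have "h a \<in> K'" using that by (simp add: K'_def)
        then show ?thesis using that i x c g_mult by (simp add: c_mult)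
      qed
    next
      fix x assume x: "x \<in> carrier (L\<lparr>carrier := F\<rparr>)"
      have "(\<Oplus>\<^bsub>L\<lparr>carrier := F\<rparr>\<^esub>i\<in>{..<n}. h (g (c i x)) \<otimes>\<^bsub>L\<lparr>carrier := F\<rparr>\<^esub> bas i) =
          (\<Oplus>\<^bsub>L\<^esub>i\<in>{..<n}. h (g (c i x)) \<otimes>\<^bsub>L\<^esub> bas i)"
      proof -
        have "(\<lambda>i. h (g (c i x)) \<otimes>\<^bsub>L\<^esub> bas i) \<in> {..<n} \<rightarrow> F"
          using g c x bas KF by (auto intro!: subF(6))
        from fs[OF _ this] show ?thesis by simp
      qed
      also have "\<dots> = (\<Oplus>\<^bsub>L\<^esub>i\<in>{..<n}. c i x \<otimes>\<^bsub>L\<^esub> bas i)"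
      proof (rule L.finsum_cong')
        show "(\<lambda>i. c i x \<otimes>\<^bsub>L\<^esub> bas i) \<in> {..<n} \<rightarrow> carrier L"
          by (intro Pi_I L.m_closed) (use c x bas subK'(1) subF(1) in \<open>auto simp: subset_iff\<close>)
      qed (use g c x in auto)
      finally show "(\<Oplus>\<^bsub>L\<lparr>carrier := F\<rparr>\<^esub>i\<in>{..<n}. h (g (c i x)) \<otimes>\<^bsub>L\<lparr>carrier := F\<rparr>\<^esub> bas i) = x"
        using ex x by simp
    next
      fix ys assume ys: "\<And>i. i \<le> n \<Longrightarrow> ys i \<in> carrier (L\<lparr>carrier := F\<rparr>)"
      then obtain a where a: "\<forall>i\<le>n. a i \<in> K'" "\<exists>i\<le>n. a i \<noteq> \<zero>\<^bsub>L\<^esub>"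
        "(\<Oplus>\<^bsub>L\<^esub>i\<in>{..n}. a i \<otimes>\<^bsub>L\<^esub> ys i) = \<zero>\<^bsub>L\<^esub>" using dep[of ys] by auto
      have "(\<Oplus>\<^bsub>L\<lparr>carrier := F\<rparr>\<^esub>i\<in>{..n}. h (g (a i)) \<otimes>\<^bsub>L\<lparr>carrier := F\<rparr>\<^esub> ys i) =
          (\<Oplus>\<^bsub>L\<^esub>i\<in>{..n}. h (g (a i)) \<otimes>\<^bsub>L\<^esub> ys i)"
      proof -
        have "(\<lambda>i. h (g (a i)) \<otimes>\<^bsub>L\<^esub> ys i) \<in> {..n} \<rightarrow> F"
          using g a ys KF by (auto intro!: subF(6))
        from fs[OF _ this] show ?thesis by simp
      qed
      also have "\<dots> = (\<Oplus>\<^bsub>L\<^esub>i\<in>{..n}. a i \<otimes>\<^bsub>L\<^esub> ys i)"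
      proof (rule L.finsum_cong')
        show "(\<lambda>i. a i \<otimes>\<^bsub>L\<^esub> ys i) \<in> {..n} \<rightarrow> carrier L"
          by (intro Pi_I L.m_closed) (use a(1) ys subK'(1) subF(1) in \<open>auto simp: subset_iff\<close>)
      qed (use g a(1) in auto)
      finally have "(\<Oplus>\<^bsub>L\<lparr>carrier := F\<rparr>\<^esub>i\<in>{..n}. h (g (a i)) \<otimes>\<^bsub>L\<lparr>carrier := F\<rparr>\<^esub> ys i) = \<zero>\<^bsub>L\<^esub>"
        using a(3) by simp
      moreover have "\<exists>i\<le>n. g (a i) \<noteq> \<zero>\<^bsub>K\<^esub>"
      proof -
        obtain i where i: "i \<le> n" "a i \<noteq> \<zero>\<^bsub>L\<^esub>" using a(2) by blast
        then have "h (g (a i)) \<noteq> \<zero>\<^bsub>L\<^esub>" using g a(1) by simp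
        then show ?thesis using i(1) h.hom_zero by metis
      qed
      ultimately show "\<exists>a. (\<forall>i\<le>n. a i \<in> carrier K) \<and> (\<exists>i\<le>n. a i \<noteq> \<zero>\<^bsub>K\<^esub>) \<and>
        (\<Oplus>\<^bsub>L\<lparr>carrier := F\<rparr>\<^esub>i\<in>{..n}. h (a i) \<otimes>\<^bsub>L\<lparr>carrier := F\<rparr>\<^esub> ys i) = \<zero>\<^bsub>L\<lparr>carrier := F\<rparr>\<^esub>"
        using g a(1) by (intro exI[of _ "\<lambda>i. g (a i)"]) auto
    qed
    show ?thesis using E.unique_extension[OF Q] by simp
  qed
  \<comment> \<open>Lists of generators index the finite subextensions: one generator determines w
    at an element, two suffice to compare sums and products, and the empty list covers the image of
    K.\<close>
  define Adj where "Adj as = L.finite_extension K' as" for as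
  define good where "good as \<longleftrightarrow> set as \<subseteq> carrier L" for as
  have Adj: "subfield (Adj as) L" "K' \<subseteq> Adj as" "set as \<subseteq> Adj as"
    "\<exists>!w. w \<in> extensional (Adj as) \<and> extends_abs K v h (L\<lparr>carrier := Adj as\<rparr>) w" if "good as" for as
  proof -
    have as: "set as \<subseteq> carrier L" using that by (simp add: good_def)
    have al: "\<And>x. x \<in> set as \<Longrightarrow> (L.algebraic over K') x" using algebraic as by (auto simp: K'_def)
    show Adj: "subfield (Adj as) L" unfolding Adj_def by (rule L.finite_extension_is_subfield[OF K' as al])
    show KX: "K' \<subseteq> Adj as" unfolding Adj_def by (rule L.finite_extension_incl[OF subK'(1) as])
    show "set as \<subseteq> Adj as" unfolding Adj_def by (rule L.finite_extension_mem[OF subfieldE(1)[OF K'] as])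
    have "L.finite_dimension K' (Adj as)"
      unfolding Adj_def by (rule L.finite_extension_finite_dimension(1)[OF K' as al])
    then obtain n where "L.dimension n K' (Adj as)" by (rule L.finite_dimensionE')
    from fin[OF Adj KX this] show "\<exists>!w. w \<in> extensional (Adj as) \<and> extends_abs K v h (L\<lparr>carrier := Adj as\<rparr>) w" .
  qed
  have av_restrict: "extends_abs K v h (L\<lparr>carrier := F\<rparr>) (restrict w F)"
    if "extends_abs K v h (L\<lparr>carrier := F'\<rparr>) w" "F \<subseteq> F'" "subfield F L" "K' \<subseteq> F" for w F F'
  proof -
    note subF = subringE[OF subfieldE(1)[OF that(3)]]
    have "h a \<in> F" if "a \<in> carrier K" for a using that \<open>K' \<subseteq> F\<close> by (auto simp: K'_def)
    then show ?thesis using that(1,2) subF(6,7)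
      by (auto simp: extends_abs_def absolute_value_def subset_iff)
  qed
  define W where "W as = (THE w. w \<in> extensional (Adj as) \<and> extends_abs K v h (L\<lparr>carrier := Adj as\<rparr>) w)" for as
  have W: "W as \<in> extensional (Adj as) \<and> extends_abs K v h (L\<lparr>carrier := Adj as\<rparr>) (W as)" if "good as" for as
    unfolding W_def by (rule theI'[OF Adj(4)[OF that]])
  \<comment> \<open>Serves twice: for the compatibility of the functions \<open>W as\<close> on
    nested subextensions, and, with F' the whole of L, for the uniqueness of the glued absolute
    value.\<close>
  have W_unique: "w x = W as x"
    if "good as" "extends_abs K v h (L\<lparr>carrier := F'\<rparr>) w" "Adj as \<subseteq> F'" "x \<in> Adj as" for w as F' x
  proof -
    have "restrict w (Adj as) = W as"
      unfolding W_def
      by (rule the1_equality[OF Adj(4)[OF that(1)], symmetric])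
        (use av_restrict[OF that(2,3) Adj(1,2)[OF that(1)]] in simp)
    then show ?thesis using that(4) by (metis restrict_apply')
  qed
  have Adj_min: "Adj as \<subseteq> F" if "subfield F L" "K' \<subseteq> F" "set as \<subseteq> F" for as F
    unfolding Adj_def by (rule L.finite_extension_subring_incl[OF subfieldE(1)[OF that(1)] that(2,3)])
  define w where "w = (\<lambda>a\<in>carrier L. W [a] a)"
  have g1: "good [a]" if "a \<in> carrier L" for a using that by (simp add: good_def)
  have g2: "good [a, b]" if "a \<in> carrier L" "b \<in> carrier L" for a b using that by (simp add: good_def)
  have w_eq: "w x = W as x" if "good as" "x \<in> Adj as" for x as
  proof -
    have x: "x \<in> carrier L" using that(2) subfieldE(3)[OF Adj(1)[OF that(1)]] by auto
    have "Adj [x] \<subseteq> Adj as" using that Adj_min[OF Adj(1,2)[OF that(1)], of "[x]"] by simp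
    moreover have "x \<in> Adj [x]" using Adj(3)[OF g1[OF x]] by simp
    ultimately have "W as x = W [x] x" using W[OF that(1)] by (intro W_unique[OF g1[OF x]]) auto
    then show ?thesis using x by (simp add: w_def)
  qed
  have "absolute_value L w"
    unfolding absolute_value_def
  proof (intro conjI ballI)
    fix a assume a: "a \<in> carrier L"
    have aX: "a \<in> Adj [a]" using Adj(3)[OF g1[OF a]] by simp
    show "0 \<le> w a" "w a = 0 \<longleftrightarrow> a = \<zero>\<^bsub>L\<^esub>"
      using W[OF g1[OF a]] aX w_eq[OF g1[OF a] aX] by (auto simp: extends_abs_def absolute_value_def)
    fix b assume b: "b \<in> carrier L"
    note sub = subringE[OF subfieldE(1)[OF Adj(1)[OF g2[OF a b]]]]
    have abX: "a \<in> Adj [a, b]" "b \<in> Adj [a, b]" using Adj(3)[OF g2[OF a b]] by auto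
    then show "w (a \<otimes>\<^bsub>L\<^esub> b) = w a * w b" "w (a \<oplus>\<^bsub>L\<^esub> b) \<le> w a + w b"
      using W[OF g2[OF a b]] sub(6,7) w_eq[OF g2[OF a b]] by (auto simp: extends_abs_def absolute_value_def)
  qed
  moreover have "w (h a) = v a" if "a \<in> carrier K" for a
  proof -
    have g0: "good []" by (simp add: good_def)
    have "h a \<in> Adj []" using Adj(2)[OF g0] that by (auto simp: K'_def)
    then show ?thesis using W[OF g0] that w_eq[OF g0] by (simp add: extends_abs_def)
  qed
  moreover have "w' = w" if "w' \<in> extensional (carrier L) \<and> absolute_value L w' \<and> (\<forall>a\<in>carrier K. w' (h a) = v a)" for w'
  proof (rule extensionalityI[of _ "carrier L"])
    fix a assume a: "a \<in> carrier L"
    have "extends_abs K v h (L\<lparr>carrier := carrier L\<rparr>) w'" using that by (simp add: extends_abs_def)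
    moreover have "Adj [a] \<subseteq> carrier L" using subfieldE(3)[OF Adj(1)[OF g1[OF a]]] .
    moreover have "a \<in> Adj [a]" using Adj(3)[OF g1[OF a]] by simp
    ultimately have "w' a = W [a] a" by (rule W_unique[OF g1[OF a]])
    then show "w' a = w a" using a by (simp add: w_def)
  qed (use that in \<open>auto simp: w_def\<close>)
  ultimately show "\<exists>!w. w \<in> extensional (carrier L) \<and> absolute_value L w \<and> (\<forall>a\<in>carrier K. w (h a) = v a)"
    by (intro ex1I[of _ w]) (auto simp: w_def)
qed

section \<open>Fraction fields and completions\<close>

text \<open>Operations on classes are encoded as unions over representatives. This evaluates such a
  union once independence of the representatives is known.\<close>

lemma UN_const_eq:
  assumes "A \<noteq> {}" "\<And>x. x \<in> A \<Longrightarrow> f x = c" shows "(\<Union>x\<in>A. f x) = c"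
  using assms by auto

lemma the_elem_image_const:
  assumes "A \<noteq> {}" "\<And>x. x \<in> A \<Longrightarrow> f x = c" shows "the_elem (f ` A) = c"
proof -
  have "f ` A = {c}" using assms by auto
  then show ?thesis by simp
qed

section \<open>The fraction field of a domain\<close>

context domain
begin

abbreviation "nz \<equiv> carrier R - {\<zero>}"

lemma fraction_eq_set:
  assumes "n \<in> carrier R" "d \<in> nz"
  shows "fraction R n d = {(n', d'). n' \<in> carrier R \<and> d' \<in> nz \<and> n \<otimes> d' = n' \<otimes> d}"
  using assms by (auto simp: fraction_def frac_rel_def)

lemma nz_mult: "d \<in> nz \<Longrightarrow> d' \<in> nz \<Longrightarrow> d \<otimes> d' \<in> nz"
  using integral_iff by auto

text \<open>Multiplying by the middle denominator makes the two sides equal, and it can be cancelled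
  in a domain.\<close>

lemma frac_trans:
  assumes "n \<in> carrier R" "d \<in> nz" "n' \<in> carrier R" "d' \<in> nz" "n'' \<in> carrier R" "d'' \<in> nz"
    "n \<otimes> d' = n' \<otimes> d" "n' \<otimes> d'' = n'' \<otimes> d'"
  shows "n \<otimes> d'' = n'' \<otimes> d"
proof -
  have c: "n \<in> carrier R" "d \<in> carrier R" "n' \<in> carrier R" "d' \<in> carrier R" "n'' \<in> carrier R" "d'' \<in> carrier R"
    using assms by auto
  have "d' \<otimes> (n \<otimes> d'') = (n \<otimes> d') \<otimes> d''" using c by (simp add: m_ac)
  also have "\<dots> = (n' \<otimes> d'') \<otimes> d" using c assms(7) by (simp add: m_ac)
  also have "\<dots> = d' \<otimes> (n'' \<otimes> d)" using c assms(8) by (simp add: m_ac)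
  finally show ?thesis using m_lcancel[of d' "n \<otimes> d''" "n'' \<otimes> d"] c assms(4) by auto
qed

lemma fraction_eq_iff:
  assumes "n \<in> carrier R" "d \<in> nz" "n' \<in> carrier R" "d' \<in> nz"
  shows "fraction R n d = fraction R n' d' \<longleftrightarrow> n \<otimes> d' = n' \<otimes> d"
proof
  assume "fraction R n d = fraction R n' d'"
  moreover have "(n', d') \<in> fraction R n' d'" using assms by (auto simp: fraction_eq_set)
  ultimately have "(n', d') \<in> fraction R n d" by simp
  then show "n \<otimes> d' = n' \<otimes> d" using assms by (auto simp: fraction_eq_set)
next
  assume e: "n \<otimes> d' = n' \<otimes> d"
  have "n \<otimes> b = a \<otimes> d \<longleftrightarrow> n' \<otimes> b = a \<otimes> d'" if "a \<in> carrier R" "b \<in> nz" for a b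
  proof
    show "n' \<otimes> b = a \<otimes> d'" if "n \<otimes> b = a \<otimes> d"
      using e by (intro frac_trans[OF assms(3,4,1,2) \<open>a \<in> carrier R\<close> \<open>b \<in> nz\<close> _ that]) simp
    show "n \<otimes> b = a \<otimes> d" if "n' \<otimes> b = a \<otimes> d'"
      by (rule frac_trans[OF assms \<open>a \<in> carrier R\<close> \<open>b \<in> nz\<close> e that])
  qed
  then show "fraction R n d = fraction R n' d'" using assms by (auto simp: fraction_eq_set)
qed

lemma frac_carrier: "carrier (frac_field R) = {fraction R n d | n d. n \<in> carrier R \<and> d \<in> nz}"
  by (auto simp: frac_field_def quotient_def fraction_def)

lemma fraction_closed: "n \<in> carrier R \<Longrightarrow> d \<in> nz \<Longrightarrow> fraction R n d \<in> carrier (frac_field R)"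
  by (auto simp: frac_carrier)

lemma fraction_mem: "n \<in> carrier R \<Longrightarrow> d \<in> nz \<Longrightarrow> (n, d) \<in> fraction R n d"
  by (simp add: fraction_eq_set)

lemma fraction_mult:
  assumes "n \<in> carrier R" "d \<in> nz" "n' \<in> carrier R" "d' \<in> nz"
  shows "fraction R n d \<otimes>\<^bsub>frac_field R\<^esub> fraction R n' d' = fraction R (n \<otimes> n') (d \<otimes> d')"
proof -
  have *: "fraction R (a \<otimes> a') (b \<otimes> b') = fraction R (n \<otimes> n') (d \<otimes> d')"
    if ab: "(a, b) \<in> fraction R n d" and ab': "(a', b') \<in> fraction R n' d'" for a b a' b'
  proof -
    have 1: "a \<in> carrier R" "b \<in> nz" "n \<otimes> b = a \<otimes> d" "a' \<in> carrier R" "b' \<in> nz" "n' \<otimes> b' = a' \<otimes> d'"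
      using ab ab' assms by (auto simp: fraction_eq_set)
    have c: "b \<in> carrier R" "b' \<in> carrier R" "d \<in> carrier R" "d' \<in> carrier R" using assms 1 by auto
    have "(a \<otimes> a') \<otimes> (d \<otimes> d') = (a \<otimes> d) \<otimes> (a' \<otimes> d')" using 1(1,4) c by (simp add: m_ac)
    also have "\<dots> = (n \<otimes> b) \<otimes> (n' \<otimes> b')" by (simp only: 1)
    also have "\<dots> = (n \<otimes> n') \<otimes> (b \<otimes> b')" using assms c by (simp add: m_ac)
    finally show ?thesis using 1 assms nz_mult by (subst fraction_eq_iff) auto
  qed
  have "(\<Union>(a', b')\<in>fraction R n' d'. fraction R (a \<otimes> a') (b \<otimes> b')) = fraction R (n \<otimes> n') (d \<otimes> d')"
    if "(a, b) \<in> fraction R n d" for a b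
    using fraction_mem[OF assms(3,4)] *[OF that] by (intro UN_const_eq) auto
  then have "(\<Union>(a, b)\<in>fraction R n d. \<Union>(a', b')\<in>fraction R n' d'. fraction R (a \<otimes> a') (b \<otimes> b')) =
      fraction R (n \<otimes> n') (d \<otimes> d')"
    using fraction_mem[OF assms(1,2)] by (intro UN_const_eq) auto
  then show ?thesis by (simp add: frac_field_def)
qed

lemma fraction_add:
  assumes "n \<in> carrier R" "d \<in> nz" "n' \<in> carrier R" "d' \<in> nz"
  shows "fraction R n d \<oplus>\<^bsub>frac_field R\<^esub> fraction R n' d' = fraction R (n \<otimes> d' \<oplus> n' \<otimes> d) (d \<otimes> d')"
proof -
  have *: "fraction R (a \<otimes> b' \<oplus> a' \<otimes> b) (b \<otimes> b') = fraction R (n \<otimes> d' \<oplus> n' \<otimes> d) (d \<otimes> d')"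
    if ab: "(a, b) \<in> fraction R n d" and ab': "(a', b') \<in> fraction R n' d'" for a b a' b'
  proof -
    have 1: "a \<in> carrier R" "b \<in> nz" "n \<otimes> b = a \<otimes> d" "a' \<in> carrier R" "b' \<in> nz" "n' \<otimes> b' = a' \<otimes> d'"
      using ab ab' assms by (auto simp: fraction_eq_set)
    have c: "b \<in> carrier R" "b' \<in> carrier R" "d \<in> carrier R" "d' \<in> carrier R" using assms 1 by auto
    have "(a \<otimes> b' \<oplus> a' \<otimes> b) \<otimes> (d \<otimes> d') = (a \<otimes> d) \<otimes> (b' \<otimes> d') \<oplus> (a' \<otimes> d') \<otimes> (b \<otimes> d)"
      using 1(1,4) c by (simp add: ring_expand)
    also have "\<dots> = (n \<otimes> b) \<otimes> (b' \<otimes> d') \<oplus> (n' \<otimes> b') \<otimes> (b \<otimes> d)" by (simp only: 1)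
    also have "\<dots> = (n \<otimes> d' \<oplus> n' \<otimes> d) \<otimes> (b \<otimes> b')"
      using assms(1,3) c by (simp add: ring_expand)
    finally show ?thesis using 1 assms nz_mult by (subst fraction_eq_iff) auto
  qed
  have "(\<Union>(a', b')\<in>fraction R n' d'. fraction R (a \<otimes> b' \<oplus> a' \<otimes> b) (b \<otimes> b')) =
      fraction R (n \<otimes> d' \<oplus> n' \<otimes> d) (d \<otimes> d')"
    if "(a, b) \<in> fraction R n d" for a b
    using fraction_mem[OF assms(3,4)] *[OF that] by (intro UN_const_eq) auto
  then have "(\<Union>(a, b)\<in>fraction R n d. \<Union>(a', b')\<in>fraction R n' d'. fraction R (a \<otimes> b' \<oplus> a' \<otimes> b) (b \<otimes> b')) =
      fraction R (n \<otimes> d' \<oplus> n' \<otimes> d) (d \<otimes> d')"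
    using fraction_mem[OF assms(1,2)] by (intro UN_const_eq) auto
  then show ?thesis by (simp add: frac_field_def)
qed

lemma frac_zero: "\<zero>\<^bsub>frac_field R\<^esub> = fraction R \<zero> \<one>" and frac_one: "\<one>\<^bsub>frac_field R\<^esub> = fraction R \<one> \<one>"
  by (simp_all add: frac_field_def)

lemma frac_cases:
  assumes "x \<in> carrier (frac_field R)"
  obtains n d where "n \<in> carrier R" "d \<in> carrier R" "d \<noteq> \<zero>" "x = fraction R n d"
  using assms by (auto simp: frac_carrier)

lemma fraction_eqI:
  assumes "n \<in> carrier R" "d \<in> nz" "n' \<in> carrier R" "d' \<in> nz" "n \<otimes> d' = n' \<otimes> d"
  shows "fraction R n d = fraction R n' d'"
  using assms by (subst fraction_eq_iff) auto

lemma frac_field_field: "field (frac_field R)"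
proof -
  have cl: "n \<otimes> d \<in> carrier R" "n \<otimes> d \<oplus> n' \<otimes> d' \<in> carrier R"
    if "n \<in> carrier R" "d \<in> carrier R" "n' \<in> carrier R" "d' \<in> carrier R" for n d n' d' using that by auto
  have one: "\<one> \<in> nz" by simp
  have ab: "abelian_group (frac_field R)"
  proof (rule abelian_groupI)
    fix x y assume xy: "x \<in> carrier (frac_field R)" "y \<in> carrier (frac_field R)"
    obtain n d where x: "n \<in> carrier R" "d \<in> carrier R" "d \<noteq> \<zero>" "x = fraction R n d" using frac_cases xy by blast
    obtain n' d' where y: "n' \<in> carrier R" "d' \<in> carrier R" "d' \<noteq> \<zero>" "y = fraction R n' d'" using frac_cases xy by blast
    show "x \<oplus>\<^bsub>frac_field R\<^esub> y \<in> carrier (frac_field R)"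
      using x y nz_mult by (simp add: fraction_add fraction_closed)
    show "x \<oplus>\<^bsub>frac_field R\<^esub> y = y \<oplus>\<^bsub>frac_field R\<^esub> x"
      using x y by (simp add: fraction_add m_comm a_comm)
    fix z assume "z \<in> carrier (frac_field R)"
    then obtain n'' d'' where z: "n'' \<in> carrier R" "d'' \<in> carrier R" "d'' \<noteq> \<zero>" "z = fraction R n'' d''" using frac_cases by blast
    have "fraction R ((n \<otimes> d' \<oplus> n' \<otimes> d) \<otimes> d'' \<oplus> n'' \<otimes> (d \<otimes> d')) (d \<otimes> d' \<otimes> d'') =
        fraction R (n \<otimes> (d' \<otimes> d'') \<oplus> (n' \<otimes> d'' \<oplus> n'' \<otimes> d') \<otimes> d) (d \<otimes> (d' \<otimes> d''))"
    proof (rule fraction_eqI)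
      show "((n \<otimes> d' \<oplus> n' \<otimes> d) \<otimes> d'' \<oplus> n'' \<otimes> (d \<otimes> d')) \<otimes> (d \<otimes> (d' \<otimes> d'')) =
          (n \<otimes> (d' \<otimes> d'') \<oplus> (n' \<otimes> d'' \<oplus> n'' \<otimes> d') \<otimes> d) \<otimes> (d \<otimes> d' \<otimes> d'')"
        using x(1,2) y(1,2) z(1,2) by (simp add: ring_expand)
    qed (use x y z nz_mult in auto)
    then show "x \<oplus>\<^bsub>frac_field R\<^esub> y \<oplus>\<^bsub>frac_field R\<^esub> z = x \<oplus>\<^bsub>frac_field R\<^esub> (y \<oplus>\<^bsub>frac_field R\<^esub> z)"
      using x y z nz_mult by (simp add: fraction_add)
  next
    show "\<zero>\<^bsub>frac_field R\<^esub> \<in> carrier (frac_field R)" using one by (simp add: frac_zero fraction_closed)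
    fix x assume "x \<in> carrier (frac_field R)"
    then obtain n d where x: "n \<in> carrier R" "d \<in> carrier R" "d \<noteq> \<zero>" "x = fraction R n d" using frac_cases by blast
    show "\<zero>\<^bsub>frac_field R\<^esub> \<oplus>\<^bsub>frac_field R\<^esub> x = x" using x by (simp add: frac_zero fraction_add)
    show "\<exists>y\<in>carrier (frac_field R). y \<oplus>\<^bsub>frac_field R\<^esub> x = \<zero>\<^bsub>frac_field R\<^esub>"
    proof (intro bexI[of _ "fraction R (\<ominus> n) d"])
      show "fraction R (\<ominus> n) d \<oplus>\<^bsub>frac_field R\<^esub> x = \<zero>\<^bsub>frac_field R\<^esub>"
        using x nz_mult[of d d] by (simp add: frac_zero fraction_add fraction_eq_iff l_minus l_neg)
    qed (use x in \<open>simp add: fraction_closed\<close>)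
  qed
  have mon: "comm_monoid (frac_field R)"
  proof (rule comm_monoidI)
    fix x y assume xy: "x \<in> carrier (frac_field R)" "y \<in> carrier (frac_field R)"
    obtain n d where x: "n \<in> carrier R" "d \<in> carrier R" "d \<noteq> \<zero>" "x = fraction R n d" using frac_cases xy by blast
    obtain n' d' where y: "n' \<in> carrier R" "d' \<in> carrier R" "d' \<noteq> \<zero>" "y = fraction R n' d'" using frac_cases xy by blast
    show "x \<otimes>\<^bsub>frac_field R\<^esub> y \<in> carrier (frac_field R)"
      using x y nz_mult by (simp add: fraction_mult fraction_closed)
    show "x \<otimes>\<^bsub>frac_field R\<^esub> y = y \<otimes>\<^bsub>frac_field R\<^esub> x"
      using x y by (simp add: fraction_mult m_comm)
    fix z assume "z \<in> carrier (frac_field R)"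
    then obtain n'' d'' where z: "n'' \<in> carrier R" "d'' \<in> carrier R" "d'' \<noteq> \<zero>" "z = fraction R n'' d''" using frac_cases by blast
    show "x \<otimes>\<^bsub>frac_field R\<^esub> y \<otimes>\<^bsub>frac_field R\<^esub> z = x \<otimes>\<^bsub>frac_field R\<^esub> (y \<otimes>\<^bsub>frac_field R\<^esub> z)"
      using x y z nz_mult by (simp add: fraction_mult m_assoc)
  next
    show "\<one>\<^bsub>frac_field R\<^esub> \<in> carrier (frac_field R)" using one by (simp add: frac_one fraction_closed)
    fix x assume "x \<in> carrier (frac_field R)"
    then obtain n d where x: "n \<in> carrier R" "d \<in> carrier R" "d \<noteq> \<zero>" "x = fraction R n d" using frac_cases by blast
    show "\<one>\<^bsub>frac_field R\<^esub> \<otimes>\<^bsub>frac_field R\<^esub> x = x" using x by (simp add: frac_one fraction_mult)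
  qed
  have "cring (frac_field R)"
  proof (rule cringI[OF ab mon])
    fix x y z assume xyz: "x \<in> carrier (frac_field R)" "y \<in> carrier (frac_field R)" "z \<in> carrier (frac_field R)"
    obtain n d where x: "n \<in> carrier R" "d \<in> carrier R" "d \<noteq> \<zero>" "x = fraction R n d" using frac_cases xyz by blast
    obtain n' d' where y: "n' \<in> carrier R" "d' \<in> carrier R" "d' \<noteq> \<zero>" "y = fraction R n' d'" using frac_cases xyz by blast
    obtain n'' d'' where z: "n'' \<in> carrier R" "d'' \<in> carrier R" "d'' \<noteq> \<zero>" "z = fraction R n'' d''" using frac_cases xyz by blast
    have c: "n \<in> carrier R" "d \<in> carrier R" "n' \<in> carrier R" "d' \<in> carrier R" "n'' \<in> carrier R" "d'' \<in> carrier R"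
      using x y z by auto
    have "((n \<otimes> d' \<oplus> n' \<otimes> d) \<otimes> n'') \<otimes> (d \<otimes> d'' \<otimes> (d' \<otimes> d'')) =
        (n \<otimes> n'' \<otimes> (d' \<otimes> d'') \<oplus> n' \<otimes> n'' \<otimes> (d \<otimes> d'')) \<otimes> (d \<otimes> d' \<otimes> d'')"
      using c by (simp add: ring_expand)
    then have "fraction R ((n \<otimes> d' \<oplus> n' \<otimes> d) \<otimes> n'') (d \<otimes> d' \<otimes> d'') =
        fraction R (n \<otimes> n'' \<otimes> (d' \<otimes> d'') \<oplus> n' \<otimes> n'' \<otimes> (d \<otimes> d'')) (d \<otimes> d'' \<otimes> (d' \<otimes> d''))"
      using x y z nz_mult by (intro fraction_eqI) auto
    then show "(x \<oplus>\<^bsub>frac_field R\<^esub> y) \<otimes>\<^bsub>frac_field R\<^esub> z =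
        x \<otimes>\<^bsub>frac_field R\<^esub> z \<oplus>\<^bsub>frac_field R\<^esub> y \<otimes>\<^bsub>frac_field R\<^esub> z"
      using x y z nz_mult by (simp add: fraction_add fraction_mult)
  qed
  then interpret Fr: cring "frac_field R" .
  show ?thesis
  proof (rule Fr.cring_fieldI2)
    show "\<zero>\<^bsub>frac_field R\<^esub> \<noteq> \<one>\<^bsub>frac_field R\<^esub>" by (simp add: frac_zero frac_one fraction_eq_iff)
    fix x assume x0: "x \<in> carrier (frac_field R)" "x \<noteq> \<zero>\<^bsub>frac_field R\<^esub>"
    then obtain n d where x: "n \<in> carrier R" "d \<in> carrier R" "d \<noteq> \<zero>" "x = fraction R n d" using frac_cases by blast
    then have n: "n \<noteq> \<zero>" using x0 by (auto simp: frac_zero fraction_eq_iff)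
    show "\<exists>y\<in>carrier (frac_field R). x \<otimes>\<^bsub>frac_field R\<^esub> y = \<one>\<^bsub>frac_field R\<^esub>"
      using x n nz_mult
      by (intro bexI[of _ "fraction R d n"]) (auto simp: fraction_mult frac_one fraction_eq_iff m_comm fraction_closed)
  qed
qed

lemma frac_embed_hom: "(\<lambda>a. fraction R a \<one>) \<in> ring_hom R (frac_field R)"
  by (rule ring_hom_memI) (auto simp: fraction_closed fraction_mult fraction_add frac_one)

text \<open>With u the absolute value that a point induces on the quotient of A by its kernel, this
  is \<open>point_field_abs\<close>.\<close>

definition frac_abs :: "('a \<Rightarrow> real) \<Rightarrow> ('a \<times> 'a) set \<Rightarrow> real" where
  "frac_abs u E = the_elem ((\<lambda>(C, D). u C / u D) ` E)"

lemma frac_abs_fraction: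
  assumes u: "absolute_value R u" and nd: "n \<in> carrier R" "d \<in> nz"
  shows "frac_abs u (fraction R n d) = u n / u d"
  unfolding frac_abs_def
proof (rule the_elem_image_const)
  show "fraction R n d \<noteq> {}" using fraction_mem[OF nd] by auto
  fix z assume "z \<in> fraction R n d"
  then obtain a b where z: "z = (a, b)" "a \<in> carrier R" "b \<in> nz" "n \<otimes> b = a \<otimes> d"
    using nd by (auto simp: fraction_eq_set)
  have "u n * u b = u a * u d" using u z nd by (metis DiffD1 absolute_value_def)
  moreover have "u b \<noteq> 0" "u d \<noteq> 0" using u z nd by (auto simp: absolute_value_def)
  ultimately show "(case z of (C, D) \<Rightarrow> u C / u D) = u n / u d" using z by (simp add: field_simps)
qed

lemma absolute_value_frac:
  assumes u: "absolute_value R u"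
  shows "absolute_value (frac_field R) (frac_abs u)"
  unfolding absolute_value_def
proof (intro conjI ballI)
  fix x assume "x \<in> carrier (frac_field R)"
  then obtain n d where x: "n \<in> carrier R" "d \<in> carrier R" "d \<noteq> \<zero>" "x = fraction R n d" using frac_cases by blast
  have un: "0 \<le> u n" "u n = 0 \<longleftrightarrow> n = \<zero>" "0 < u d"
    using u x by (auto simp: absolute_value_def order_less_le)
  show "0 \<le> frac_abs u x" "frac_abs u x = 0 \<longleftrightarrow> x = \<zero>\<^bsub>frac_field R\<^esub>"
    using x un u by (auto simp: frac_abs_fraction frac_zero fraction_eq_iff)
  fix y assume "y \<in> carrier (frac_field R)"
  then obtain n' d' where y: "n' \<in> carrier R" "d' \<in> carrier R" "d' \<noteq> \<zero>" "y = fraction R n' d'" using frac_cases by blast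
  have un': "0 \<le> u n'" "0 < u d'" using u y by (auto simp: absolute_value_def order_less_le)
  have um: "u (a \<otimes> b) = u a * u b" if "a \<in> carrier R" "b \<in> carrier R" for a b
    using u that by (auto simp: absolute_value_def)
  have ut: "u (a \<oplus> b) \<le> u a + u b" if "a \<in> carrier R" "b \<in> carrier R" for a b
    using u that by (auto simp: absolute_value_def)
  show "frac_abs u (x \<otimes>\<^bsub>frac_field R\<^esub> y) = frac_abs u x * frac_abs u y"
    using x y u nz_mult by (simp add: fraction_mult frac_abs_fraction um)
  have "u (n \<otimes> d' \<oplus> n' \<otimes> d) \<le> u n * u d' + u n' * u d"
    using ut[of "n \<otimes> d'" "n' \<otimes> d"] x y by (simp add: um)
  then have "u (n \<otimes> d' \<oplus> n' \<otimes> d) / (u d * u d') \<le> u n / u d + u n' / u d'"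
    using un un' by (simp add: field_simps)
  then show "frac_abs u (x \<oplus>\<^bsub>frac_field R\<^esub> y) \<le> frac_abs u x + frac_abs u y"
    using x y u nz_mult by (simp add: fraction_add frac_abs_fraction um)
qed

end

section \<open>The completion of a valued field\<close>

lemma (in valued_field) cauchy_bounded:
  fixes s :: "nat \<Rightarrow> 'a"
  assumes "range s \<subseteq> carrier R" "\<forall>e>0. \<exists>n0. \<forall>m\<ge>n0. \<forall>n\<ge>n0. v (s m \<ominus> s n) < e"
  obtains B where "0 < B" "\<And>n. v (s n) \<le> B"
proof -
  have s: "s n \<in> carrier R" for n using assms(1) by auto
  obtain n0 where n0: "\<And>m n. m \<ge> n0 \<Longrightarrow> n \<ge> n0 \<Longrightarrow> v (s m \<ominus> s n) < 1" using assms(2) by (metis zero_less_one)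
  define B where "B = 1 + v (s n0) + (\<Sum>i<n0. v (s i))"
  have sum: "0 \<le> (\<Sum>i<n0. v (s i))" using s by (intro sum_nonneg) auto
  have "v (s n) \<le> B" for n
  proof (cases "n < n0")
    case True
    have "v (s n) \<le> (\<Sum>i<n0. v (s i))" using True s by (intro member_le_sum) auto
    moreover have "0 \<le> v (s n0)" using s by simp
    ultimately show ?thesis by (simp add: B_def)
  next
    case False
    then have "\<bar>v (s n) - v (s n0)\<bar> < 1" using n0[of n n0] v_diff_ge[OF s s, of n n0] by simp
    then show ?thesis using sum by (simp add: B_def)
  qed
  moreover have "0 < B" using sum s[of n0] v_nonneg[of "s n0"] unfolding B_def by linarith
  ultimately show thesis using that by blast
qed

context valued_field
begin

abbreviation "CR \<equiv> cauchy_ring R v"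
abbreviation "NS \<equiv> null_sequences R v"

lemma CR_carrier: "s \<in> carrier CR \<longleftrightarrow> (\<forall>n. s n \<in> carrier R) \<and> (\<forall>e>0. \<exists>n0. \<forall>m\<ge>n0. \<forall>n\<ge>n0. v (s m \<ominus> s n) < e)"
  by (auto simp: cauchy_ring_def)

lemma CR_simps: "s \<otimes>\<^bsub>CR\<^esub> t = (\<lambda>n. s n \<otimes> t n)" "s \<oplus>\<^bsub>CR\<^esub> t = (\<lambda>n. s n \<oplus> t n)"
  "\<one>\<^bsub>CR\<^esub> = (\<lambda>n. \<one>)" "\<zero>\<^bsub>CR\<^esub> = (\<lambda>n. \<zero>)"
  by (simp_all add: cauchy_ring_def)

lemma CR_D: "s \<in> carrier CR \<Longrightarrow> s n \<in> carrier R"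
  by (simp add: CR_carrier)

lemma CR_cauchy: "s \<in> carrier CR \<Longrightarrow> 0 < e \<Longrightarrow> \<exists>n0. \<forall>m\<ge>n0. \<forall>n\<ge>n0. v (s m \<ominus> s n) < e"
  by (simp add: CR_carrier)

lemma CR_const: "a \<in> carrier R \<Longrightarrow> (\<lambda>n. a) \<in> carrier CR"
  by (auto simp: CR_carrier a_minus_def r_neg)

lemma CR_minus_closed: assumes "s \<in> carrier CR" shows "(\<lambda>n. \<ominus> s n) \<in> carrier CR"
proof -
  have "v (\<ominus> s m \<ominus> \<ominus> s n) = v (s m \<ominus> s n)" for m n
  proof -
    have "\<ominus> x \<ominus> \<ominus> y = \<ominus> (x \<ominus> y)" if "x \<in> carrier R" "y \<in> carrier R" for x y
      using that by (simp add: ring_expand)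
    then show ?thesis using CR_D[OF assms] v_minus[OF minus_closed] by metis
  qed
  then show ?thesis using assms by (simp add: CR_carrier)
qed

lemma CR_add_closed: assumes s: "s \<in> carrier CR" and t: "t \<in> carrier CR" shows "(\<lambda>n. s n \<oplus> t n) \<in> carrier CR"
  unfolding CR_carrier
proof (intro conjI allI impI)
  fix e :: real assume e: "0 < e"
  obtain a where a: "\<forall>m\<ge>a. \<forall>n\<ge>a. v (s m \<ominus> s n) < e / 2" using CR_cauchy[OF s, of "e / 2"] e by auto
  obtain b where b: "\<forall>m\<ge>b. \<forall>n\<ge>b. v (t m \<ominus> t n) < e / 2" using CR_cauchy[OF t, of "e / 2"] e by auto
  have "v (s m \<oplus> t m \<ominus> (s n \<oplus> t n)) < e" if mn: "m \<ge> max a b" "n \<ge> max a b" for m n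
  proof -
    have "v (s m \<oplus> t m \<ominus> (s n \<oplus> t n)) = v ((s m \<ominus> s n) \<oplus> (t m \<ominus> t n))"
      using CR_D[OF s] CR_D[OF t] by (simp add: a_minus_def minus_add a_ac)
    also have "\<dots> \<le> v (s m \<ominus> s n) + v (t m \<ominus> t n)"
      using CR_D[OF s] CR_D[OF t] by (intro v_add) auto
    finally have "v (s m \<oplus> t m \<ominus> (s n \<oplus> t n)) \<le> v (s m \<ominus> s n) + v (t m \<ominus> t n)" .
    moreover have "v (s m \<ominus> s n) < e / 2" "v (t m \<ominus> t n) < e / 2" using a b mn by auto
    ultimately show ?thesis by linarith
  qed
  then show "\<exists>n0. \<forall>m\<ge>n0. \<forall>n\<ge>n0. v (s m \<oplus> t m \<ominus> (s n \<oplus> t n)) < e" by blast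
qed (use CR_D s t in auto)

lemma CR_bounded: assumes "s \<in> carrier CR" obtains B where "0 < B" "\<And>n. v (s n) \<le> B"
  using cauchy_bounded[of s] assms by (auto simp: CR_carrier)

lemma CR_mult_closed: assumes s: "s \<in> carrier CR" and t: "t \<in> carrier CR" shows "(\<lambda>n. s n \<otimes> t n) \<in> carrier CR"
  unfolding CR_carrier
proof (intro conjI allI impI)
  fix e :: real assume e: "0 < e"
  obtain B where B: "0 < B" "\<And>n. v (s n) \<le> B" using CR_bounded[OF s] by blast
  obtain D where D: "0 < D" "\<And>n. v (t n) \<le> D" using CR_bounded[OF t] by blast
  obtain a where a: "\<forall>m\<ge>a. \<forall>n\<ge>a. v (s m \<ominus> s n) < e / (2 * D)" using CR_cauchy[OF s, of "e / (2 * D)"] e D by auto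
  obtain b where b: "\<forall>m\<ge>b. \<forall>n\<ge>b. v (t m \<ominus> t n) < e / (2 * B)" using CR_cauchy[OF t, of "e / (2 * B)"] e B by auto
  have "v (s m \<otimes> t m \<ominus> s n \<otimes> t n) < e" if mn: "m \<ge> max a b" "n \<ge> max a b" for m n
  proof -
    define x y x' y' where "x = s m" and "y = t m" and "x' = s n" and "y' = t n"
    have c: "x \<in> carrier R" "y \<in> carrier R" "x' \<in> carrier R" "y' \<in> carrier R"
      using CR_D s t by (auto simp: x_def y_def x'_def y'_def)
    have "v (x \<otimes> y \<ominus> x' \<otimes> y') \<le> v x * v (y \<ominus> y') + v (x \<ominus> x') * v y'"
      using c by (intro v_mult_diff) auto
    moreover have "v x * v (y \<ominus> y') \<le> B * v (y \<ominus> y')" "v (x \<ominus> x') * v y' \<le> v (x \<ominus> x') * D"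
      using B D c by (auto simp: x_def y'_def intro!: mult_right_mono mult_left_mono)
    moreover have "B * v (y \<ominus> y') < B * (e / (2 * B))"
      using b mn B(1) by (intro mult_strict_left_mono) (auto simp: y_def y'_def)
    moreover have "v (x \<ominus> x') * D < e / (2 * D) * D"
      using a mn D(1) by (intro mult_strict_right_mono) (auto simp: x_def x'_def)
    ultimately show ?thesis using B D by (simp add: x_def y_def x'_def y'_def)
  qed
  then show "\<exists>n0. \<forall>m\<ge>n0. \<forall>n\<ge>n0. v (s m \<otimes> t m \<ominus> s n \<otimes> t n) < e" by blast
qed (use CR_D s t in auto)

lemma CR_cring: "cring CR"
proof (rule cringI)
  show "abelian_group CR"
  proof (rule abelian_groupI)
    fix x assume x: "x \<in> carrier CR"
    show "\<exists>y\<in>carrier CR. y \<oplus>\<^bsub>CR\<^esub> x = \<zero>\<^bsub>CR\<^esub>"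
      using CR_minus_closed[OF x] CR_D[OF x] by (intro bexI) (auto simp: CR_simps l_neg)
  qed (auto simp: CR_simps CR_D CR_const CR_add_closed a_ac)
  show "comm_monoid CR"
    by (rule comm_monoidI) (auto simp: CR_simps CR_D CR_const CR_mult_closed m_ac)
qed (auto simp: CR_simps CR_D l_distr)

lemma CR_minus: assumes "s \<in> carrier CR" shows "\<ominus>\<^bsub>CR\<^esub> s = (\<lambda>n. \<ominus> s n)"
proof -
  interpret CR: cring CR by (rule CR_cring)
  show ?thesis
    by (rule CR.minus_equality) (use assms CR_minus_closed CR_D in \<open>auto simp: CR_simps l_neg\<close>)
qed

lemma NS_iff: "s \<in> NS \<longleftrightarrow> s \<in> carrier CR \<and> (\<lambda>n. v (s n)) \<longlonglongrightarrow> 0"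
  by (simp add: null_sequences_def)

lemma NS_I:
  assumes "s \<in> carrier CR" "f \<longlonglongrightarrow> 0" "\<And>n. v (s n) \<le> f n" shows "s \<in> NS"
proof -
  have "(\<lambda>n. v (s n)) \<longlonglongrightarrow> 0"
    by (rule tendsto_sandwich[OF _ _ tendsto_const assms(2)]) (use assms CR_D in auto)
  then show ?thesis using assms(1) by (simp add: NS_iff)
qed

lemma NS_ideal: "ideal NS CR"
proof -
  interpret CR: cring CR by (rule CR_cring)
  have mult: "x \<otimes>\<^bsub>CR\<^esub> a \<in> NS" if a: "a \<in> NS" and x: "x \<in> carrier CR" for a x
  proof -
    obtain B where B: "0 < B" "\<And>n. v (x n) \<le> B" using CR_bounded[OF x] by blast
    have ac: "a \<in> carrier CR" and la: "(\<lambda>n. v (a n)) \<longlonglongrightarrow> 0" using a by (auto simp: NS_iff)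
    show ?thesis
    proof (rule NS_I)
      show "(\<lambda>n. B * v (a n)) \<longlonglongrightarrow> 0" using tendsto_mult_right_zero[OF la] .
      show "v ((x \<otimes>\<^bsub>CR\<^esub> a) n) \<le> B * v (a n)" for n
        using B CR_D[OF x] CR_D[OF ac] by (simp add: CR_simps v_mult mult_right_mono)
    qed (use x ac in simp)
  qed
  show ?thesis
  proof (rule idealI)
    show "ring CR" by (rule CR.ring_axioms)
    show "subgroup NS (add_monoid CR)"
    proof (rule CR.add.subgroupI)
      show "NS \<subseteq> carrier CR" by (auto simp: NS_iff)
      have "\<zero>\<^bsub>CR\<^esub> \<in> NS" using CR.zero_closed by (simp add: NS_iff CR_simps)
      then show "NS \<noteq> {}" by blast
      fix a assume a: "a \<in> NS"
      then show "\<ominus>\<^bsub>CR\<^esub> a \<in> NS" using CR_minus_closed CR_D by (simp add: NS_iff CR_minus)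
      fix b assume b: "b \<in> NS"
      have ac: "a \<in> carrier CR" "b \<in> carrier CR" using a b by (auto simp: NS_iff)
      show "a \<oplus>\<^bsub>CR\<^esub> b \<in> NS"
      proof (rule NS_I)
        show "(\<lambda>n. v (a n) + v (b n)) \<longlonglongrightarrow> 0" using a b by (auto simp: NS_iff intro: tendsto_add_zero)
        show "v ((a \<oplus>\<^bsub>CR\<^esub> b) n) \<le> v (a n) + v (b n)" for n using ac CR_D by (simp add: CR_simps v_add)
      qed (use ac in simp)
    qed
    show "x \<otimes>\<^bsub>CR\<^esub> a \<in> NS" if "a \<in> NS" "x \<in> carrier CR" for a x by (rule mult[OF that])
    show "a \<otimes>\<^bsub>CR\<^esub> x \<in> NS" if "a \<in> NS" "x \<in> carrier CR" for a x
      using mult[OF that] that by (auto simp: NS_iff CR.m_comm)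
  qed
qed

abbreviation "cls s \<equiv> NS +>\<^bsub>CR\<^esub> s"
abbreviation "KC \<equiv> completion R v"
abbreviation "VC \<equiv> completion_abs v"

lemma cls_hom: "(\<lambda>s. cls s) \<in> ring_hom CR KC"
  using ideal.rcos_ring_hom[OF NS_ideal] by (simp add: completion_def)

lemma KC_cring: "cring KC"
  unfolding completion_def using ideal.quotient_is_cring[OF NS_ideal CR_cring] .

lemma KC_cases: assumes "C \<in> carrier KC" obtains s where "s \<in> carrier CR" "C = cls s"
  using assms by (auto simp: completion_def FactRing_def A_RCOSETS_def' )

lemma cls_closed: "s \<in> carrier CR \<Longrightarrow> cls s \<in> carrier KC"
  using ring_hom_closed[OF cls_hom] .

lemma cls_eq_iff: assumes "s \<in> carrier CR" "t \<in> carrier CR"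
  shows "cls s = cls t \<longleftrightarrow> (\<lambda>n. v (s n \<ominus> t n)) \<longlonglongrightarrow> 0"
proof -
  interpret CR: cring CR by (rule CR_cring)
  interpret NS: ideal NS CR by (rule NS_ideal)
  have "s \<ominus>\<^bsub>CR\<^esub> t = (\<lambda>n. s n \<ominus> t n)"
    using assms by (simp add: a_minus_def CR_minus CR_simps)
  then have "s \<ominus>\<^bsub>CR\<^esub> t \<in> NS \<longleftrightarrow> (\<lambda>n. v (s n \<ominus> t n)) \<longlonglongrightarrow> 0"
    using CR.minus_closed[OF assms] by (simp add: NS_iff)
  then show ?thesis using CR.quotient_eq_iff_same_a_r_cos[OF NS_ideal assms] by metis
qed

lemma v_convergent: assumes s: "s \<in> carrier CR" shows "(\<lambda>n. v (s n)) \<longlonglongrightarrow> lim (\<lambda>n. v (s n))"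
proof -
  have "Cauchy (\<lambda>n. v (s n))"
  proof (rule metric_CauchyI)
    fix e :: real assume "0 < e"
    then obtain a where a: "\<forall>m\<ge>a. \<forall>n\<ge>a. v (s m \<ominus> s n) < e" using CR_cauchy[OF s] by blast
    have "dist (v (s m)) (v (s n)) < e" if "m \<ge> a" "n \<ge> a" for m n
      using a that v_diff_ge[OF CR_D[OF s] CR_D[OF s], of m n] by (force simp: dist_real_def)
    then show "\<exists>M. \<forall>m\<ge>M. \<forall>n\<ge>M. dist (v (s m)) (v (s n)) < e" by blast
  qed
  then show ?thesis using Cauchy_convergent_iff convergent_LIMSEQ_iff by blast
qed

text \<open>Representatives of a class differ by null sequences, and | |t| - |s| | \<le> |t - s|, so
  the limits of their absolute values agree.\<close>

lemma VC_cls: assumes s: "s \<in> carrier CR" shows "VC (cls s) = lim (\<lambda>n. v (s n))"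
  unfolding completion_abs_def
proof (rule the_elem_image_const)
  interpret CR: cring CR by (rule CR_cring)
  interpret NS: ideal NS CR by (rule NS_ideal)
  show "cls s \<noteq> {}" using NS.a_rcos_self[OF s] by auto
  fix t assume t: "t \<in> cls s"
  then obtain i where i: "i \<in> NS" "t = (\<lambda>n. i n \<oplus> s n)" by (auto simp: a_r_coset_def' CR_simps)
  have ic: "i \<in> carrier CR" using i by (simp add: NS_iff)
  have "(\<lambda>n. v (t n) - v (s n)) \<longlonglongrightarrow> 0"
  proof (rule Lim_null_comparison[of _ "\<lambda>n. v (i n)"])
    have "\<bar>v (t n) - v (s n)\<bar> \<le> v (i n)" for n
    proof -
      have "t n \<ominus> s n = i n" using CR_D[OF ic] CR_D[OF s] by (simp add: i(2) a_minus_def a_assoc r_neg)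
      then show ?thesis using v_diff_ge[of "t n" "s n"] CR_D[OF ic] CR_D[OF s] by (simp add: i(2))
    qed
    then show "\<forall>\<^sub>F n in sequentially. Real_Vector_Spaces.norm (v (t n) - v (s n)) \<le> v (i n)" by simp
  qed (use i in \<open>simp add: NS_iff\<close>)
  from tendsto_add[OF this v_convergent[OF s]] show "lim (\<lambda>n. v (t n)) = lim (\<lambda>n. v (s n))"
    by (intro limI) simp
qed

lemma VC_lim: "s \<in> carrier CR \<Longrightarrow> (\<lambda>n. v (s n)) \<longlonglongrightarrow> VC (cls s)"
  using v_convergent VC_cls by simp

lemma KC_zero: "\<zero>\<^bsub>KC\<^esub> = cls (\<lambda>n. \<zero>)" and KC_one: "\<one>\<^bsub>KC\<^esub> = cls (\<lambda>n. \<one>)"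
proof -
  interpret CR: cring CR by (rule CR_cring)
  interpret KC: cring KC by (rule KC_cring)
  interpret hom: ring_hom_ring CR KC "\<lambda>s. cls s" by unfold_locales (rule cls_hom)
  show "\<zero>\<^bsub>KC\<^esub> = cls (\<lambda>n. \<zero>)" using hom.hom_zero by (simp add: CR_simps)
  show "\<one>\<^bsub>KC\<^esub> = cls (\<lambda>n. \<one>)" using hom.hom_one by (simp add: CR_simps)
qed

lemma cls_mult: "\<lbrakk>s \<in> carrier CR; t \<in> carrier CR\<rbrakk> \<Longrightarrow> cls s \<otimes>\<^bsub>KC\<^esub> cls t = cls (\<lambda>n. s n \<otimes> t n)"
  using ring_hom_mult[OF cls_hom] by (simp add: CR_simps)

lemma cls_add: "\<lbrakk>s \<in> carrier CR; t \<in> carrier CR\<rbrakk> \<Longrightarrow> cls s \<oplus>\<^bsub>KC\<^esub> cls t = cls (\<lambda>n. s n \<oplus> t n)"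
  using ring_hom_add[OF cls_hom] by (simp add: CR_simps)

lemma completion_absolute_value: "absolute_value KC VC"
  unfolding absolute_value_def
proof (intro conjI ballI)
  fix a assume "a \<in> carrier KC"
  then obtain s where s: "s \<in> carrier CR" "a = cls s" by (rule KC_cases)
  show "0 \<le> VC a" unfolding s(2) by (rule LIMSEQ_le_const[OF VC_lim[OF s(1)]]) (use CR_D[OF s(1)] in auto)
  show "VC a = 0 \<longleftrightarrow> a = \<zero>\<^bsub>KC\<^esub>"
  proof -
    have z: "(\<lambda>n. \<zero>) \<in> carrier CR" by (rule CR_const) simp
    have "s n \<ominus> \<zero> = s n" for n using CR_D[OF s(1)] by (simp add: a_minus_def)
    then have "a = \<zero>\<^bsub>KC\<^esub> \<longleftrightarrow> (\<lambda>n. v (s n)) \<longlonglongrightarrow> 0"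
      unfolding s(2) KC_zero cls_eq_iff[OF s(1) z] by simp
    moreover have "VC a = 0 \<longleftrightarrow> (\<lambda>n. v (s n)) \<longlonglongrightarrow> 0"
    proof
      show "(\<lambda>n. v (s n)) \<longlonglongrightarrow> 0" if "VC a = 0" using VC_lim[OF s(1)] that by (simp only: s(2))
      show "VC a = 0" if "(\<lambda>n. v (s n)) \<longlonglongrightarrow> 0"
        using LIMSEQ_unique[OF VC_lim[OF s(1)] that] by (simp only: s(2))
    qed
    ultimately show ?thesis by simp
  qed
  fix b assume "b \<in> carrier KC"
  then obtain t where t: "t \<in> carrier CR" "b = cls t" by (rule KC_cases)
  have "(\<lambda>n. v (s n \<otimes> t n)) \<longlonglongrightarrow> VC a * VC b"
    using tendsto_mult[OF VC_lim[OF s(1)] VC_lim[OF t(1)]] CR_D[OF s(1)] CR_D[OF t(1)] s(2) t(2) by (simp add: v_mult)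
  from LIMSEQ_unique[OF VC_lim[OF CR_mult_closed[OF s(1) t(1)]] this]
  show "VC (a \<otimes>\<^bsub>KC\<^esub> b) = VC a * VC b"
    by (simp add: s(2) t(2) cls_mult[OF s(1) t(1)])
  show "VC (a \<oplus>\<^bsub>KC\<^esub> b) \<le> VC a + VC b"
    unfolding s(2) t(2) cls_add[OF s(1) t(1)]
    by (rule LIMSEQ_le[OF VC_lim[OF CR_add_closed[OF s(1) t(1)]] tendsto_add[OF VC_lim[OF s(1)] VC_lim[OF t(1)]]])
      (use CR_D[OF s(1)] CR_D[OF t(1)] v_add in auto)
qed

lemma completion_field: "field KC"
proof (rule cring.cring_fieldI2[OF KC_cring])
  show "\<zero>\<^bsub>KC\<^esub> \<noteq> \<one>\<^bsub>KC\<^esub>"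
    unfolding KC_zero KC_one by (subst cls_eq_iff[OF CR_const CR_const]) (auto simp: a_minus_def LIMSEQ_const_iff)
  fix a assume a: "a \<in> carrier KC" "a \<noteq> \<zero>\<^bsub>KC\<^esub>"
  then obtain s where s: "s \<in> carrier CR" "a = cls s" using KC_cases by blast
  define l where "l = VC (cls s)"
  have l: "0 < l" using completion_absolute_value a unfolding absolute_value_def l_def s(2) by (simp add: order_less_le)
  have "\<forall>\<^sub>F n in sequentially. l / 2 < v (s n)" using order_tendstoD(1)[OF VC_lim[OF s(1)], of "l / 2"] l by (simp add: l_def)
  then obtain n1 where n1: "\<And>n. n \<ge> n1 \<Longrightarrow> l / 2 < v (s n)" by (auto simp: eventually_sequentially)
  \<comment> \<open>The terms before n1, where s may vanish, receive the default 0; finitely many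
    terms do not affect the class.\<close>
  define t where "t n = (if n \<ge> n1 then inv (s n) else \<zero>)" for n
  have nz: "s n \<noteq> \<zero>" if "n \<ge> n1" for n using n1[OF that] l by auto
  have tR: "t n \<in> carrier R" for n using CR_D[OF s(1)] nz inv_closed by (simp add: t_def)
  have t: "t \<in> carrier CR"
    unfolding CR_carrier
  proof (intro conjI allI impI tR)
    fix e :: real assume e: "0 < e"
    \<comment> \<open>The accuracy e (l/2)^2 is dictated by |1/x - 1/y| = |x - y| / (|x| |y|) with
      both denominators above l/2.\<close>
    then obtain n2 where n2: "\<forall>m\<ge>n2. \<forall>n\<ge>n2. v (s m \<ominus> s n) < e * (l / 2 * (l / 2))"
      using CR_cauchy[OF s(1), of "e * (l / 2 * (l / 2))"] l by auto
    have "v (t m \<ominus> t n) < e" if mn: "m \<ge> max n1 n2" "n \<ge> max n1 n2" for m n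
    proof -
      define x y i j where "x = s m" and "y = s n" and "i = inv x" and "j = inv y"
      have c: "x \<in> carrier R" "y \<in> carrier R" "x \<noteq> \<zero>" "y \<noteq> \<zero>" using CR_D[OF s(1)] nz mn by (auto simp: x_def y_def)
      have ij: "i \<in> carrier R" "j \<in> carrier R" "x \<otimes> i = \<one>" "y \<otimes> j = \<one>"
        using c inv_closed r_inv_field by (auto simp: i_def j_def)
      have "i \<ominus> j = i \<otimes> (y \<otimes> j) \<ominus> (x \<otimes> i) \<otimes> j" using ij by simp
      also have "\<dots> = (y \<ominus> x) \<otimes> (i \<otimes> j)" using c(1,2) ij(1,2) by (simp add: ring_expand)
      finally have eq: "v (i \<ominus> j) = v (y \<ominus> x) * (inverse (v x) * inverse (v y))"
        using c ij by (simp add: v_mult v_inv i_def j_def)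
      have lx: "l / 2 < v x" "l / 2 < v y" using n1 mn by (auto simp: x_def y_def)
      then have pos: "0 < v x" "0 < v y" using l by linarith+
      have "v (y \<ominus> x) < e * (l / 2 * (l / 2))" using n2 mn by (simp add: x_def y_def)
      also have "\<dots> \<le> e * (v x * v y)" using lx l e by (intro mult_left_mono mult_mono) auto
      finally have "v (i \<ominus> j) < e" unfolding eq using pos by (simp add: field_simps)
      then show ?thesis using mn by (simp add: t_def i_def j_def x_def y_def)
    qed
    then show "\<exists>n0. \<forall>m\<ge>n0. \<forall>n\<ge>n0. v (t m \<ominus> t n) < e" by blast
  qed
  have "\<forall>\<^sub>F n in sequentially. v (s n \<otimes> t n \<ominus> \<one>) = 0"
    using eventually_ge_at_top[of n1]
    by eventually_elim (use nz CR_D[OF s(1)] r_inv_field in \<open>auto simp: t_def a_minus_def r_neg\<close>)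
  then have "(\<lambda>n. v (s n \<otimes> t n \<ominus> \<one>)) \<longlonglongrightarrow> 0" by (rule tendsto_eventually)
  then have "a \<otimes>\<^bsub>KC\<^esub> cls t = \<one>\<^bsub>KC\<^esub>"
    unfolding s(2) cls_mult[OF s(1) t] KC_one
    by (subst cls_eq_iff[OF CR_mult_closed[OF s(1) t] CR_const]) auto
  then show "\<exists>b\<in>carrier KC. a \<otimes>\<^bsub>KC\<^esub> b = \<one>\<^bsub>KC\<^esub>" using cls_closed[OF t] by blast
qed

lemma embed_hom: "completion_embed R v \<in> ring_hom R KC"
  by (rule ring_hom_memI)
    (auto simp: completion_embed_def cls_closed CR_const cls_mult cls_add KC_one)

lemma embed_abs: "a \<in> carrier R \<Longrightarrow> VC (completion_embed R v a) = v a"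
  unfolding completion_embed_def by (simp add: VC_cls CR_const)

text \<open>Each C k is replaced by an element t k of the base field at distance at most 1/(k+1).
  The sequence t is then Cauchy, and its own class is the limit.\<close>

lemma completion_complete:
  assumes C: "\<And>n. C n \<in> carrier KC"
    and cau: "\<And>e. 0 < e \<Longrightarrow> \<exists>n0. \<forall>m\<ge>n0. \<forall>n\<ge>n0. VC (C m \<ominus>\<^bsub>KC\<^esub> C n) < e"
  shows "\<exists>l\<in>carrier KC. (\<lambda>n. VC (C n \<ominus>\<^bsub>KC\<^esub> l)) \<longlonglongrightarrow> 0"
proof -
  interpret KC: field KC by (rule completion_field)
  interpret KC: valued_field KC VC by (rule KC.valued_fieldI[OF completion_absolute_value])
  interpret CR: cring CR by (rule CR_cring)
  interpret hom: ring_hom_ring CR KC "\<lambda>s. cls s" by unfold_locales (rule cls_hom)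
  let ?E = "completion_embed R v"
  have cls_diff: "cls s \<ominus>\<^bsub>KC\<^esub> cls t = cls (\<lambda>n. s n \<ominus> t n)" if "s \<in> carrier CR" "t \<in> carrier CR" for s t
  proof -
    have "cls s \<ominus>\<^bsub>KC\<^esub> cls t = cls (s \<ominus>\<^bsub>CR\<^esub> t)" using that by (simp add: a_minus_def)
    then show ?thesis using that by (simp add: a_minus_def CR_minus CR_simps)
  qed
  have diff_closed: "(\<lambda>n. s n \<ominus> t n) \<in> carrier CR" if "s \<in> carrier CR" "t \<in> carrier CR" for s t
    using that CR_add_closed[OF that(1) CR_minus_closed[OF that(2)]] by (simp add: a_minus_def)
  have approx: "\<exists>a\<in>carrier R. VC (c \<ominus>\<^bsub>KC\<^esub> ?E a) \<le> e" if c: "c \<in> carrier KC" and e: "0 < e" for c e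
  proof -
    obtain s where s: "s \<in> carrier CR" "c = cls s" using KC_cases[OF c] by blast
    obtain n0 where n0: "\<forall>m\<ge>n0. \<forall>n\<ge>n0. v (s m \<ominus> s n) < e" using CR_cauchy[OF s(1) e] by blast
    have a: "s n0 \<in> carrier R" using CR_D[OF s(1)] .
    have "VC (c \<ominus>\<^bsub>KC\<^esub> ?E (s n0)) \<le> e"
      unfolding s(2) completion_embed_def cls_diff[OF s(1) CR_const[OF a]]
      by (rule LIMSEQ_le_const2[OF VC_lim[OF diff_closed[OF s(1) CR_const[OF a]]]]) (use n0 in \<open>force intro: less_imp_le\<close>)
    then show ?thesis using a by blast
  qed
  have "\<exists>a. a \<in> carrier R \<and> VC (C k \<ominus>\<^bsub>KC\<^esub> ?E a) \<le> 1 / real (Suc k)" for k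
    using approx[OF C, of "1 / real (Suc k)" k] by auto
  then obtain t where t: "\<And>k. t k \<in> carrier R" "\<And>k. VC (C k \<ominus>\<^bsub>KC\<^esub> ?E (t k)) \<le> 1 / real (Suc k)" by metis
  have E: "?E a \<in> carrier KC" if "a \<in> carrier R" for a using ring_hom_closed[OF embed_hom that] .
  have E_diff: "VC (?E a \<ominus>\<^bsub>KC\<^esub> ?E b) = v (a \<ominus> b)" if "a \<in> carrier R" "b \<in> carrier R" for a b
    using that cls_diff[OF CR_const CR_const, of a b] VC_cls[OF CR_const, of "a \<ominus> b"]
    by (simp add: completion_embed_def)
  have small: "\<exists>k0. \<forall>k\<ge>k0. 1 / real (Suc k) < e" if "0 < e" for e
  proof -
    have "(\<lambda>k. 1 / real (Suc k)) \<longlonglongrightarrow> 0" using LIMSEQ_inverse_real_of_nat by (simp add: inverse_eq_divide)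
    from order_tendstoD(2)[OF this that] show ?thesis by (simp add: eventually_sequentially)
  qed
  have tC: "t \<in> carrier CR"
    unfolding CR_carrier
  proof (intro conjI allI impI t(1))
    fix e :: real assume e: "0 < e"
    obtain a where a: "\<forall>k\<ge>a. 1 / real (Suc k) < e / 3" using small[of "e / 3"] e by auto
    obtain b where b: "\<forall>m\<ge>b. \<forall>n\<ge>b. VC (C m \<ominus>\<^bsub>KC\<^esub> C n) < e / 3" using cau[of "e / 3"] e by auto
    have "v (t m \<ominus> t n) < e" if mn: "m \<ge> max a b" "n \<ge> max a b" for m n
    proof -
      have "v (t m \<ominus> t n) = VC (?E (t m) \<ominus>\<^bsub>KC\<^esub> ?E (t n))" using E_diff t(1) by simp
      also have "\<dots> \<le> VC (?E (t m) \<ominus>\<^bsub>KC\<^esub> C m) + (VC (C m \<ominus>\<^bsub>KC\<^esub> C n) + VC (C n \<ominus>\<^bsub>KC\<^esub> ?E (t n)))"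
        using KC.v_diff_triangle[of "?E (t m)" "C m" "?E (t n)"] KC.v_diff_triangle[of "C m" "C n" "?E (t n)"]
          E t(1) C by fastforce
      also have "VC (?E (t m) \<ominus>\<^bsub>KC\<^esub> C m) = VC (C m \<ominus>\<^bsub>KC\<^esub> ?E (t m))"
        using E t(1) C by (intro KC.v_diff_commute) auto
      finally have "v (t m \<ominus> t n) \<le> VC (C m \<ominus>\<^bsub>KC\<^esub> ?E (t m)) +
          (VC (C m \<ominus>\<^bsub>KC\<^esub> C n) + VC (C n \<ominus>\<^bsub>KC\<^esub> ?E (t n)))" .
      moreover have "1 / real (Suc m) < e / 3" "1 / real (Suc n) < e / 3" using a mn by auto
      moreover have "VC (C m \<ominus>\<^bsub>KC\<^esub> C n) < e / 3" using b mn by auto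
      ultimately show ?thesis using t(2)[of m] t(2)[of n] by linarith
    qed
    then show "\<exists>n0. \<forall>m\<ge>n0. \<forall>n\<ge>n0. v (t m \<ominus> t n) < e" by blast
  qed
  have "(\<lambda>k. VC (C k \<ominus>\<^bsub>KC\<^esub> cls t)) \<longlonglongrightarrow> 0"
  proof (rule LIMSEQ_I)
    fix e :: real assume e: "0 < e"
    obtain a where a: "\<forall>k\<ge>a. 1 / real (Suc k) < e / 2" using small[of "e / 2"] e by auto
    obtain b where b: "\<forall>m\<ge>b. \<forall>n\<ge>b. v (t m \<ominus> t n) < e / 2" using CR_cauchy[OF tC, of "e / 2"] e by auto
    have "VC (C k \<ominus>\<^bsub>KC\<^esub> cls t) < e" if k: "k \<ge> max a b" for k
    proof -
      have "VC (?E (t k) \<ominus>\<^bsub>KC\<^esub> cls t) \<le> e / 2"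
        unfolding completion_embed_def cls_diff[OF CR_const[OF t(1)] tC]
        by (rule LIMSEQ_le_const2[OF VC_lim[OF diff_closed[OF CR_const[OF t(1)] tC]]]) (use b k in \<open>force intro: less_imp_le\<close>)
      moreover have "VC (C k \<ominus>\<^bsub>KC\<^esub> cls t) \<le> VC (C k \<ominus>\<^bsub>KC\<^esub> ?E (t k)) + VC (?E (t k) \<ominus>\<^bsub>KC\<^esub> cls t)"
        using E t(1) C cls_closed[OF tC] by (intro KC.v_diff_triangle) auto
      moreover have "1 / real (Suc k) < e / 2" using a k by simp
      ultimately show ?thesis using t(2)[of k] by linarith
    qed
    moreover have "0 \<le> VC (C k \<ominus>\<^bsub>KC\<^esub> cls t)" for k using C cls_closed[OF tC] by simp
    ultimately show "\<exists>n0. \<forall>k\<ge>n0. Real_Vector_Spaces.norm (VC (C k \<ominus>\<^bsub>KC\<^esub> cls t) - 0) < e"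
      by (auto intro!: exI[of _ "max a b"])
  qed
  then show ?thesis using cls_closed[OF tC] by blast
qed

end

section \<open>Quadratic systems over a complete field, and the fields of the spectrum\<close>

lemma (in valued_field) v_finsum_diff:
  assumes "finite I" "f \<in> I \<rightarrow> carrier R" "g \<in> I \<rightarrow> carrier R"
  shows "v (finsum R f I \<ominus> finsum R g I) \<le> (\<Sum>i\<in>I. v (f i \<ominus> g i))"
  using assms
proof (induction I rule: finite_induct)
  case empty
  then show ?case by (simp add: a_minus_def)
next
  case (insert i I)
  have c: "f i \<in> carrier R" "g i \<in> carrier R" "finsum R f I \<in> carrier R" "finsum R g I \<in> carrier R"
    using insert.prems by (auto intro!: finsum_closed)
  have eq: "(a \<oplus> x) \<ominus> (c \<oplus> y) = (a \<ominus> c) \<oplus> (x \<ominus> y)"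
    if "a \<in> carrier R" "x \<in> carrier R" "c \<in> carrier R" "y \<in> carrier R" for a x c y
    using that by (simp add: ring_expand)
  have "v (finsum R f (insert i I) \<ominus> finsum R g (insert i I)) =
      v ((f i \<ominus> g i) \<oplus> (finsum R f I \<ominus> finsum R g I))"
    using insert c eq[of "f i" "finsum R f I" "g i" "finsum R g I"] by simp
  also have "\<dots> \<le> v (f i \<ominus> g i) + v (finsum R f I \<ominus> finsum R g I)" using c by (intro v_add) auto
  also have "v (finsum R f I \<ominus> finsum R g I) \<le> (\<Sum>i\<in>I. v (f i \<ominus> g i))" using insert by auto
  finally show ?case using insert by simp
qed

definition quad_map :: "('k, 'm) ring_scheme \<Rightarrow> nat \<Rightarrow> (nat \<Rightarrow> nat \<Rightarrow> nat \<Rightarrow> 'k) \<Rightarrow> (nat \<Rightarrow> 'k) \<Rightarrow> (nat \<Rightarrow> 'k) \<Rightarrow> nat \<Rightarrow> 'k" where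
  "quad_map K d \<gamma> s t k =
     (\<Oplus>\<^bsub>K\<^esub>i\<in>{..<d}. \<Oplus>\<^bsub>K\<^esub>j\<in>{..<d}. t i \<otimes>\<^bsub>K\<^esub> t j \<otimes>\<^bsub>K\<^esub> \<gamma> i j k) \<oplus>\<^bsub>K\<^esub> s k"

text \<open>Fixed point iteration from 0. Each iterate is a polynomial expression in the
  coefficients, so it can be formed at all points of a neighbourhood at once and stays a uniform
  limit of fractions.\<close>

fun quad_iter :: "('k, 'm) ring_scheme \<Rightarrow> nat \<Rightarrow> (nat \<Rightarrow> nat \<Rightarrow> nat \<Rightarrow> 'k) \<Rightarrow> (nat \<Rightarrow> 'k) \<Rightarrow> nat \<Rightarrow> nat \<Rightarrow> 'k" where
  "quad_iter K d \<gamma> s 0 = (\<lambda>k. \<zero>\<^bsub>K\<^esub>)"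
| "quad_iter K d \<gamma> s (Suc n) = quad_map K d \<gamma> s (quad_iter K d \<gamma> s n)"

text \<open>Applied to \<H>(y) for all y near b with the same G and e, so that the rates of
  convergence do not depend on y.\<close>

locale quad_system = valued_field K v for K (structure) and v +
  fixes d :: nat and \<gamma> :: "nat \<Rightarrow> nat \<Rightarrow> nat \<Rightarrow> 'a" and s :: "nat \<Rightarrow> 'a" and G e :: real
  assumes G: "0 < G" and e: "0 < e" and Ge: "8 * G * (real d)\<^sup>2 * e \<le> 1"
    and \<gamma>: "\<And>i j k. i < d \<Longrightarrow> j < d \<Longrightarrow> k < d \<Longrightarrow> \<gamma> i j k \<in> carrier K"
    and \<gamma>G: "\<And>i j k. i < d \<Longrightarrow> j < d \<Longrightarrow> k < d \<Longrightarrow> v (\<gamma> i j k) \<le> G"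
    and s: "\<And>k. k < d \<Longrightarrow> s k \<in> carrier K" and se: "\<And>k. k < d \<Longrightarrow> v (s k) \<le> e"
begin

definition small :: "(nat \<Rightarrow> 'a) \<Rightarrow> bool" where
  "small t \<longleftrightarrow> (\<forall>k<d. t k \<in> carrier K \<and> v (t k) \<le> 2 * e)"

lemma quad_map_closed: "small t \<Longrightarrow> k < d \<Longrightarrow> quad_map K d \<gamma> s t k \<in> carrier K"
  unfolding quad_map_def using s \<gamma> by (auto simp: small_def intro!: a_closed finsum_closed)

text \<open>Each of the d^2 products changes by at most 2 (2e) D, times G for the coefficient. The
  sum 4 G d^2 e D is at most D/2 by the condition on G and e.\<close>

lemma quad_map_diff:
  assumes t: "small t" and t': "small t'" and D: "\<And>k. k < d \<Longrightarrow> v (t k \<ominus> t' k) \<le> D" and k: "k < d"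
  shows "v (quad_map K d \<gamma> s t k \<ominus> quad_map K d \<gamma> s t' k) \<le> D / 2"
proof -
  have tc: "t i \<in> carrier K" "t' i \<in> carrier K" "v (t i) \<le> 2 * e" "v (t' i) \<le> 2 * e" if "i < d" for i
    using t t' that by (auto simp: small_def)
  have "0 \<le> v (t k \<ominus> t' k)" using tc(1,2)[OF k] by simp
  with D[OF k] have D0: "0 \<le> D" by linarith
  let ?S = "\<lambda>t. \<Oplus>i\<in>{..<d}. \<Oplus>j\<in>{..<d}. t i \<otimes> t j \<otimes> \<gamma> i j k"
  have S: "?S t \<in> carrier K" "?S t' \<in> carrier K" using tc \<gamma> k by (auto intro!: finsum_closed)
  have eq: "quad_map K d \<gamma> s t k \<ominus> quad_map K d \<gamma> s t' k = ?S t \<ominus> ?S t'"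
  proof -
    have "(a \<oplus> c) \<ominus> (b \<oplus> c) = a \<ominus> b" if "a \<in> carrier K" "b \<in> carrier K" "c \<in> carrier K" for a b c
      using that by (simp add: ring_expand)
    then show ?thesis unfolding quad_map_def using S s[OF k] by blast
  qed
  have "v (?S t \<ominus> ?S t') \<le> (\<Sum>i<d. v ((\<Oplus>j\<in>{..<d}. t i \<otimes> t j \<otimes> \<gamma> i j k) \<ominus> (\<Oplus>j\<in>{..<d}. t' i \<otimes> t' j \<otimes> \<gamma> i j k)))"
    using tc \<gamma> k by (intro v_finsum_diff) (auto intro!: finsum_closed)
  also have "\<dots> \<le> (\<Sum>i<d. \<Sum>j<d. v (t i \<otimes> t j \<otimes> \<gamma> i j k \<ominus> t' i \<otimes> t' j \<otimes> \<gamma> i j k))"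
    using tc \<gamma> k by (intro sum_mono v_finsum_diff) auto
  also have "\<dots> \<le> (\<Sum>i<d. \<Sum>j<d. 4 * e * D * G)"
  proof (intro sum_mono)
    fix i j assume "i \<in> {..<d}" "j \<in> {..<d}"
    then have ij: "i < d" "j < d" by auto
    note c = tc[OF ij(1)] tc[OF ij(2)] \<gamma>[OF ij k]
    have "t i \<otimes> t j \<otimes> \<gamma> i j k \<ominus> t' i \<otimes> t' j \<otimes> \<gamma> i j k = (t i \<otimes> t j \<ominus> t' i \<otimes> t' j) \<otimes> \<gamma> i j k"
      using c by (simp add: a_minus_def l_distr l_minus)
    then have "v (t i \<otimes> t j \<otimes> \<gamma> i j k \<ominus> t' i \<otimes> t' j \<otimes> \<gamma> i j k) = v (t i \<otimes> t j \<ominus> t' i \<otimes> t' j) * v (\<gamma> i j k)"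
      using c by (simp add: v_mult)
    also have "\<dots> \<le> (v (t i) * v (t j \<ominus> t' j) + v (t i \<ominus> t' i) * v (t' j)) * v (\<gamma> i j k)"
      using c by (intro mult_right_mono v_mult_diff) auto
    also have "\<dots> \<le> (2 * e * D + D * (2 * e)) * G"
      using c D[OF ij(1)] D[OF ij(2)] \<gamma>G[OF ij k] e D0 by (intro mult_mono add_mono) auto
    finally show "v (t i \<otimes> t j \<otimes> \<gamma> i j k \<ominus> t' i \<otimes> t' j \<otimes> \<gamma> i j k) \<le> 4 * e * D * G" by (simp add: algebra_simps)
  qed
  also have "\<dots> = (8 * G * (real d)\<^sup>2 * e) * (D / 2)" by (simp add: real_square)
  also have "\<dots> \<le> 1 * (D / 2)" using Ge D0 by (intro mult_right_mono) auto
  finally show ?thesis by (simp add: eq)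
qed

lemma quad_map_zero: "k < d \<Longrightarrow> quad_map K d \<gamma> s (\<lambda>k. \<zero>) k = s k"
proof -
  assume k: "k < d"
  have "(\<Oplus>i\<in>{..<d}. \<Oplus>j\<in>{..<d}. \<zero> \<otimes> \<zero> \<otimes> \<gamma> i j k) = (\<Oplus>i\<in>{..<d}. \<zero>)"
  proof (rule finsum_cong')
    fix i assume i: "i \<in> {..<d}"
    have "(\<Oplus>j\<in>{..<d}. \<zero> \<otimes> \<zero> \<otimes> \<gamma> i j k) = (\<Oplus>j\<in>{..<d}. \<zero>)"
      using \<gamma> i k by (intro finsum_cong') auto
    then show "(\<Oplus>j\<in>{..<d}. \<zero> \<otimes> \<zero> \<otimes> \<gamma> i j k) = \<zero>" by (simp add: finsum_zero)
  qed auto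
  then show ?thesis using s[OF k] by (simp add: quad_map_def finsum_zero)
qed

lemma small_zero: "small (\<lambda>k. \<zero>)"
  using e by (simp add: small_def)

text \<open>Comparison with the value s at 0: the contraction turns the distance 2e into e, and s
  contributes at most e.\<close>

lemma small_quad_map:
  assumes t: "small t" shows "small (quad_map K d \<gamma> s t)"
  unfolding small_def
proof (intro allI impI conjI)
  fix k assume k: "k < d"
  show c: "quad_map K d \<gamma> s t k \<in> carrier K" by (rule quad_map_closed[OF t k])
  have "v (t k \<ominus> \<zero>) \<le> 2 * e" if "k < d" for k using t that by (simp add: small_def a_minus_def)
  from quad_map_diff[OF t small_zero this k]
  have "v (quad_map K d \<gamma> s t k \<ominus> s k) \<le> e" by (simp add: quad_map_zero[OF k])
  moreover have "\<bar>v (quad_map K d \<gamma> s t k) - v (s k)\<bar> \<le> v (quad_map K d \<gamma> s t k \<ominus> s k)"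
    by (rule v_diff_ge[OF c s[OF k]])
  ultimately show "v (quad_map K d \<gamma> s t k) \<le> 2 * e" using se[OF k] by linarith
qed

abbreviation "T \<equiv> quad_iter K d \<gamma> s"

lemma small_T: "small (T n)"
  by (induction n) (simp_all add: small_zero small_quad_map)

lemma T_closed: "k < d \<Longrightarrow> T n k \<in> carrier K" and T_le: "k < d \<Longrightarrow> v (T n k) \<le> 2 * e"
  using small_T[of n] by (auto simp: small_def)

lemma T_step: "k < d \<Longrightarrow> v (T (Suc n) k \<ominus> T n k) \<le> e / 2 ^ n"
proof (induction n arbitrary: k)
  case 0
  then show ?case using quad_map_zero s se by (simp add: a_minus_def)
next
  case (Suc n)
  have "v (quad_map K d \<gamma> s (T (Suc n)) k \<ominus> quad_map K d \<gamma> s (T n) k) \<le> e / 2 ^ n / 2"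
    by (rule quad_map_diff[OF small_T small_T Suc.IH Suc.prems])
  then show ?case by (simp add: mult.commute)
qed

text \<open>The bound is the exact partial sum of the geometric series of steps; in this form the
  induction on m closes.\<close>

lemma T_dist: assumes k: "k < d" and "n \<le> m" shows "v (T m k \<ominus> T n k) \<le> 2 * e / 2 ^ n - 2 * e / 2 ^ m"
  using assms(2)
proof (induction m rule: dec_induct)
  case base
  then show ?case using T_closed[OF k] by (simp add: a_minus_def r_neg)
next
  case (step m)
  have "v (T (Suc m) k \<ominus> T n k) \<le> v (T (Suc m) k \<ominus> T m k) + v (T m k \<ominus> T n k)"
    by (intro v_diff_triangle T_closed[OF k])
  also have "\<dots> \<le> e / 2 ^ m + (2 * e / 2 ^ n - 2 * e / 2 ^ m)"
    using T_step[OF k, of m] step.IH by (intro add_mono) auto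
  also have "\<dots> = 2 * e / 2 ^ n - 2 * e / 2 ^ Suc m" by simp
  finally show ?case .
qed

text \<open>The rate 2e / 2^n belongs to the conclusion because it is the same for all points of a
  neighbourhood and thus gives uniform convergence there.\<close>

lemma quad_solution:
  assumes complete: "\<And>C. \<lbrakk>\<And>n. C n \<in> carrier K; \<And>e. 0 < e \<Longrightarrow> \<exists>n0. \<forall>m\<ge>n0. \<forall>n\<ge>n0. v (C m \<ominus> C n) < e\<rbrakk>
    \<Longrightarrow> \<exists>l\<in>carrier K. (\<lambda>n. v (C n \<ominus> l)) \<longlonglongrightarrow> 0"
  shows "\<exists>t. \<forall>k<d. t k \<in> carrier K \<and> v (t k) \<le> 2 * e \<and> (\<forall>n. v (T n k \<ominus> t k) \<le> 2 * e / 2 ^ n) \<and>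
    t k = quad_map K d \<gamma> s t k"
proof -
  have lim0: "(\<lambda>n. 2 * e / 2 ^ n) \<longlonglongrightarrow> 0" by real_asymp
  have "\<exists>l\<in>carrier K. (\<lambda>n. v (T n k \<ominus> l)) \<longlonglongrightarrow> 0" if k: "k < d" for k
  proof (rule complete)
    show "T n k \<in> carrier K" for n by (rule T_closed[OF k])
    fix r :: real assume "0 < r"
    then have "\<forall>\<^sub>F n in sequentially. 2 * e / 2 ^ n < r" using lim0 by (intro order_tendstoD)
    then obtain n0 where n0: "\<And>n. n \<ge> n0 \<Longrightarrow> 2 * e / 2 ^ n < r" by (auto simp: eventually_sequentially)
    have *: "v (T m k \<ominus> T n k) < r" if mn: "n0 \<le> n" "n \<le> m" for m n
    proof -
      have "v (T m k \<ominus> T n k) \<le> 2 * e / 2 ^ n - 2 * e / 2 ^ m" by (rule T_dist[OF k mn(2)])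
      moreover have "0 \<le> 2 * e / 2 ^ m" using e by simp
      ultimately show ?thesis using n0[OF mn(1)] by linarith
    qed
    have "v (T m k \<ominus> T n k) < r" if "n0 \<le> m" "n0 \<le> n" for m n
    proof (cases "n \<le> m")
      case False
      then have "v (T n k \<ominus> T m k) < r" using * that by simp
      then show ?thesis using v_diff_commute[OF T_closed T_closed, of k k m n] k by simp
    qed (use * that in blast)
    then show "\<exists>n0. \<forall>m\<ge>n0. \<forall>n\<ge>n0. v (T m k \<ominus> T n k) < r" by blast
  qed
  then have "\<exists>l. l \<in> carrier K \<and> (\<lambda>n. v (T n k \<ominus> l)) \<longlonglongrightarrow> 0" if "k < d" for k using that by blast
  then have "\<exists>t. \<forall>k\<in>{..<d}. t k \<in> carrier K \<and> (\<lambda>n. v (T n k \<ominus> t k)) \<longlonglongrightarrow> 0" by (intro bchoice) blast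
  then obtain t where t: "\<And>k. k < d \<Longrightarrow> t k \<in> carrier K" "\<And>k. k < d \<Longrightarrow> (\<lambda>n. v (T n k \<ominus> t k)) \<longlonglongrightarrow> 0" by auto
  have dist: "v (T n k \<ominus> t k) \<le> 2 * e / 2 ^ n" if k: "k < d" for n k
  proof (rule LIMSEQ_le_const)
    show "(\<lambda>m. 2 * e / 2 ^ n + v (T m k \<ominus> t k)) \<longlonglongrightarrow> 2 * e / 2 ^ n"
      using tendsto_add[OF tendsto_const t(2)[OF k], of "2 * e / 2 ^ n"] by simp
    have "v (T n k \<ominus> t k) \<le> 2 * e / 2 ^ n + v (T m k \<ominus> t k)" if mn: "n \<le> m" for m
    proof -
      have "v (T n k \<ominus> t k) \<le> v (T n k \<ominus> T m k) + v (T m k \<ominus> t k)"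
        by (intro v_diff_triangle T_closed[OF k] t(1)[OF k])
      moreover have "v (T n k \<ominus> T m k) = v (T m k \<ominus> T n k)" by (rule v_diff_commute[OF T_closed[OF k] T_closed[OF k]])
      moreover have "v (T m k \<ominus> T n k) \<le> 2 * e / 2 ^ n - 2 * e / 2 ^ m" by (rule T_dist[OF k mn])
      moreover have "0 \<le> 2 * e / 2 ^ m" using e by simp
      ultimately show ?thesis by linarith
    qed
    then show "\<exists>N. \<forall>m\<ge>N. v (T n k \<ominus> t k) \<le> 2 * e / 2 ^ n + v (T m k \<ominus> t k)" by blast
  qed
  have te: "v (t k) \<le> 2 * e" if k: "k < d" for k
    using dist[OF k, of 0] t(1)[OF k] by (simp add: a_minus_def)
  have smt: "small t" using t(1) te by (simp add: small_def)
  have "t k = quad_map K d \<gamma> s t k" if k: "k < d" for k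
  proof -
    have qc: "quad_map K d \<gamma> s t k \<in> carrier K" by (rule quad_map_closed[OF smt k])
    have "v (t k \<ominus> quad_map K d \<gamma> s t k) \<le> 2 * (2 * e / 2 ^ n)" for n
    proof -
      have "v (t k \<ominus> quad_map K d \<gamma> s t k) \<le> v (t k \<ominus> T (Suc n) k) + v (T (Suc n) k \<ominus> quad_map K d \<gamma> s t k)"
        by (intro v_diff_triangle T_closed[OF k] t(1)[OF k] qc)
      moreover have "v (t k \<ominus> T (Suc n) k) \<le> 2 * e / 2 ^ Suc n"
        using dist[OF k, of "Suc n"] v_diff_commute[OF T_closed[OF k, of "Suc n"] t(1)[OF k]] by simp
      moreover have "v (T (Suc n) k \<ominus> quad_map K d \<gamma> s t k) \<le> 2 * e / 2 ^ n / 2"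
        using quad_map_diff[OF small_T smt dist k, of n] by simp
      moreover have "2 * e / 2 ^ Suc n \<le> 2 * e / 2 ^ n" "2 * e / 2 ^ n / 2 \<le> 2 * e / 2 ^ n"
        using e by (simp_all add: field_simps)
      ultimately show ?thesis by linarith
    qed
    moreover have "(\<lambda>n. 2 * (2 * e / 2 ^ n)) \<longlonglongrightarrow> 0" using tendsto_mult_right_zero[OF lim0] .
    ultimately have "v (t k \<ominus> quad_map K d \<gamma> s t k) \<le> 0" by (intro LIMSEQ_le_const) auto
    moreover have "0 \<le> v (t k \<ominus> quad_map K d \<gamma> s t k)" using qc t(1)[OF k] by simp
    ultimately have "v (t k \<ominus> quad_map K d \<gamma> s t k) = 0" by linarith
    then show ?thesis using qc t(1)[OF k] by simp
  qed
  then show ?thesis using t(1) te dist by blast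
qed

end

section \<open>The completed residue field of a point\<close>

locale mult_point = cring A for A :: "('a, 'm) ring_scheme" (structure) +
  fixes x :: "'a \<Rightarrow> real"
  assumes ms: "multiplicative_seminorm A x"
begin

lemma x_nonneg: "f \<in> carrier A \<Longrightarrow> 0 \<le> x f"
  and x_zero: "x \<zero> = 0" and x_one: "x \<one> = 1"
  and x_add: "\<lbrakk>f \<in> carrier A; g \<in> carrier A\<rbrakk> \<Longrightarrow> x (f \<oplus> g) \<le> x f + x g"
  and x_mult: "\<lbrakk>f \<in> carrier A; g \<in> carrier A\<rbrakk> \<Longrightarrow> x (f \<otimes> g) = x f * x g"
  using ms by (auto simp: multiplicative_seminorm_def)

abbreviation "I \<equiv> seminorm_kernel A x"

lemma I_iff: "f \<in> I \<longleftrightarrow> f \<in> carrier A \<and> x f = 0"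
  by (simp add: seminorm_kernel_def)

lemma x_minus: assumes "f \<in> carrier A" shows "x (\<ominus> f) = x f"
proof -
  have "x (\<ominus> \<one>) * x (\<ominus> \<one>) = 1" using x_mult[of "\<ominus> \<one>" "\<ominus> \<one>"] by (simp add: l_minus x_one)
  then have "(x (\<ominus> \<one>) - 1) * (x (\<ominus> \<one>) + 1) = 0" by (simp add: algebra_simps)
  then have "x (\<ominus> \<one>) = 1 \<or> x (\<ominus> \<one>) = -1" by auto
  moreover have "0 \<le> x (\<ominus> \<one>)" by (rule x_nonneg) simp
  ultimately have "x (\<ominus> \<one>) = 1" by linarith
  then show ?thesis using x_mult[of "\<ominus> \<one>" f] assms by (simp add: l_minus)
qed

lemma I_ideal: "ideal I A"
proof (rule idealI)
  show "ring A" by (rule ring_axioms)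
  show "subgroup I (add_monoid A)"
  proof (rule add.subgroupI)
    show "I \<subseteq> carrier A" by (auto simp: I_iff)
    have "\<zero> \<in> I" by (simp add: I_iff x_zero)
    then show "I \<noteq> {}" by blast
    fix a assume a: "a \<in> I"
    then show "\<ominus> a \<in> I" by (simp add: I_iff x_minus)
    fix b assume b: "b \<in> I"
    have "0 \<le> x (a \<oplus> b)" using a b by (intro x_nonneg) (auto simp: I_iff)
    then show "a \<oplus> b \<in> I" using a b x_add[of a b] by (auto simp: I_iff)
  qed
qed (auto simp: I_iff x_mult)

lemma I_prime: "primeideal I A"
proof (rule primeidealI[OF I_ideal is_cring])
  have "\<one> \<notin> I" by (simp add: I_iff x_one)
  then show "carrier A \<noteq> I" using one_closed by metis
  show "a \<in> I \<or> b \<in> I" if "a \<in> carrier A" "b \<in> carrier A" "a \<otimes> b \<in> I" for a b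
    using that by (auto simp: I_iff x_mult)
qed

abbreviation "Q \<equiv> A Quot I"

sublocale Q: domain Q
  by (rule primeideal.quotient_is_domain[OF I_prime])

lemma Q_hom: "(\<lambda>f. I +> f) \<in> ring_hom A Q"
  using ideal.rcos_ring_hom[OF I_ideal] .

lemma Q_cases: assumes "C \<in> carrier Q" obtains f where "f \<in> carrier A" "C = I +> f"
  using assms by (auto simp: FactRing_def A_RCOSETS_def')

lemma Q_closed: "f \<in> carrier A \<Longrightarrow> I +> f \<in> carrier Q"
  using ring_hom_closed[OF Q_hom] .

lemma Q_one: "I +> \<one> = \<one>\<^bsub>Q\<^esub>" by (simp add: FactRing_def)

text \<open>The absolute value induced by x on the quotient of A by the kernel of x;
  \<open>u_coset\<close> shows that x is constant on cosets.\<close>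

definition u :: "'a set \<Rightarrow> real" where "u C = the_elem (x ` C)"

lemma u_coset: assumes f: "f \<in> carrier A" shows "u (I +> f) = x f"
  unfolding u_def
proof (rule the_elem_image_const)
  interpret ideal I A by (rule I_ideal)
  show "I +> f \<noteq> {}" using a_rcos_self[OF f] by auto
  fix g assume "g \<in> I +> f"
  then obtain i where i: "i \<in> carrier A" "x i = 0" "g = i \<oplus> f" by (auto simp: a_r_coset_def' I_iff)
  have "f = \<ominus> i \<oplus> g" using i f by (simp add: a_assoc[symmetric] l_neg)
  then have "x f \<le> x g" using x_add[of "\<ominus> i" g] i f by (simp add: x_minus)
  moreover have "x g \<le> x f" using x_add[of i f] i f by simp
  ultimately show "x g = x f" by simp
qed

lemma u_av: "absolute_value Q u"
  unfolding absolute_value_def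
proof (intro conjI ballI)
  fix a assume "a \<in> carrier Q"
  then obtain f where f: "f \<in> carrier A" "a = I +> f" by (rule Q_cases)
  show "0 \<le> u a" using f by (simp add: u_coset x_nonneg)
  have "a = \<zero>\<^bsub>Q\<^esub> \<longleftrightarrow> f \<in> I"
    using quotient_eq_iff_same_a_r_cos[OF I_ideal f(1) zero_closed] f
      ring_hom_zero[OF Q_hom ring_axioms Q.ring_axioms] by (simp add: a_minus_def)
  then show "u a = 0 \<longleftrightarrow> a = \<zero>\<^bsub>Q\<^esub>" using f by (simp add: u_coset I_iff)
  fix b assume "b \<in> carrier Q"
  then obtain g where g: "g \<in> carrier A" "b = I +> g" by (rule Q_cases)
  have "a \<otimes>\<^bsub>Q\<^esub> b = I +> (f \<otimes> g)" using ring_hom_mult[OF Q_hom f(1) g(1)] f g by simp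
  then show "u (a \<otimes>\<^bsub>Q\<^esub> b) = u a * u b" using f g by (simp add: u_coset x_mult)
  have "a \<oplus>\<^bsub>Q\<^esub> b = I +> (f \<oplus> g)" using ring_hom_add[OF Q_hom f(1) g(1)] f g by simp
  then show "u (a \<oplus>\<^bsub>Q\<^esub> b) \<le> u a + u b" using f g by (simp add: u_coset x_add)
qed

abbreviation "PF \<equiv> point_field A x"
abbreviation "pv \<equiv> point_field_abs x"

lemma pv_eq: "pv = Q.frac_abs u"
  by (rule ext) (simp add: point_field_abs_def Q.frac_abs_def u_def)

sublocale PF: valued_field PF pv
  unfolding point_field_def pv_eq
  by (rule field.valued_fieldI[OF Q.frac_field_field Q.absolute_value_frac[OF u_av]])

lemma hfield_field: "field (hfield A x)"
  unfolding hfield_def by (rule PF.completion_field)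

lemma hfield_absolute_value: "absolute_value (hfield A x) (hfield_abs x)"
  unfolding hfield_def hfield_abs_def by (rule PF.completion_absolute_value)

lemma hfield_complete:
  assumes "\<And>n. C n \<in> carrier (hfield A x)"
    "\<And>e. 0 < e \<Longrightarrow> \<exists>n0. \<forall>m\<ge>n0. \<forall>n\<ge>n0. hfield_abs x (C m \<ominus>\<^bsub>hfield A x\<^esub> C n) < e"
  shows "\<exists>l\<in>carrier (hfield A x). (\<lambda>n. hfield_abs x (C n \<ominus>\<^bsub>hfield A x\<^esub> l)) \<longlonglongrightarrow> 0"
  using PF.completion_complete[of C] assms unfolding hfield_def hfield_abs_def by blast

lemma value_at_eq: "value_at A x f = completion_embed PF pv (fraction Q (I +> f) \<one>\<^bsub>Q\<^esub>)"
  by (simp add: value_at_def Q_one)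

lemma value_at_hom: "value_at A x \<in> ring_hom A (hfield A x)"
proof -
  have "completion_embed PF pv \<circ> ((\<lambda>a. fraction Q a \<one>\<^bsub>Q\<^esub>) \<circ> (\<lambda>f. I +> f)) \<in> ring_hom A (hfield A x)"
    unfolding hfield_def
    by (rule ring_hom_trans[OF ring_hom_trans[OF Q_hom Q.frac_embed_hom, folded point_field_def] PF.embed_hom])
  moreover have "completion_embed PF pv \<circ> ((\<lambda>a. fraction Q a \<one>\<^bsub>Q\<^esub>) \<circ> (\<lambda>f. I +> f)) = value_at A x"
    by (rule ext) (simp add: value_at_eq)
  ultimately show ?thesis by simp
qed

lemma value_at_abs: assumes f: "f \<in> carrier A" shows "hfield_abs x (value_at A x f) = x f"
proof -
  have c: "fraction Q (I +> f) \<one>\<^bsub>Q\<^esub> \<in> carrier PF"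
    unfolding point_field_def using Q_closed[OF f] by (intro Q.fraction_closed) auto
  have "hfield_abs x (value_at A x f) = pv (fraction Q (I +> f) \<one>\<^bsub>Q\<^esub>)"
    unfolding value_at_eq hfield_abs_def by (rule PF.embed_abs[OF c])
  also have "\<dots> = u (I +> f) / u \<one>\<^bsub>Q\<^esub>"
    unfolding pv_eq using Q_closed[OF f] by (intro Q.frac_abs_fraction[OF u_av]) auto
  also have "\<dots> = x f" using u_coset[OF f] u_coset[OF one_closed] x_one by (simp add: Q_one)
  finally show ?thesis .
qed

end

section \<open>Uniform limits of fractions\<close>

locale berkovich = cring A for A :: "('a, 'm) ring_scheme" (structure) +
  fixes N :: "'a \<Rightarrow> real"
begin

abbreviation "Sp \<equiv> spectrum A N"
abbreviation "Top \<equiv> spectrum_topology A N"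
abbreviation "H \<equiv> hfield A"
abbreviation "vH \<equiv> hfield_abs"

lemma point: "y \<in> Sp \<Longrightarrow> mult_point A y"
  by unfold_locales (simp add: spectrum_def)

lemma H_valued: "y \<in> Sp \<Longrightarrow> valued_field (H y) (vH y)"
  using field.valued_fieldI[OF mult_point.hfield_field mult_point.hfield_absolute_value] point by blast

definition fr :: "'a \<Rightarrow> 'a \<Rightarrow> ('a \<Rightarrow> real) \<Rightarrow> 'a hfield_elem" where
  "fr p q y = value_at A y p \<otimes>\<^bsub>H y\<^esub> inv\<^bsub>H y\<^esub> value_at A y q"

lemma value_closed: "y \<in> Sp \<Longrightarrow> p \<in> carrier A \<Longrightarrow> value_at A y p \<in> carrier (H y)"
  using ring_hom_closed[OF mult_point.value_at_hom[OF point]] .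

lemma value_hom:
  assumes "y \<in> Sp" "p \<in> carrier A" "q \<in> carrier A"
  shows "value_at A y (p \<otimes> q) = value_at A y p \<otimes>\<^bsub>H y\<^esub> value_at A y q"
    "value_at A y (p \<oplus> q) = value_at A y p \<oplus>\<^bsub>H y\<^esub> value_at A y q"
    "value_at A y \<one> = \<one>\<^bsub>H y\<^esub>" "value_at A y \<zero> = \<zero>\<^bsub>H y\<^esub>"
    "value_at A y (\<ominus> p) = \<ominus>\<^bsub>H y\<^esub> value_at A y p"
proof -
  interpret H: valued_field "H y" "vH y" by (rule H_valued[OF assms(1)])
  interpret hom: ring_hom_ring A "H y" "value_at A y"
    by unfold_locales (rule mult_point.value_at_hom[OF point[OF assms(1)]])
  show "value_at A y (p \<otimes> q) = value_at A y p \<otimes>\<^bsub>H y\<^esub> value_at A y q"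
    "value_at A y (p \<oplus> q) = value_at A y p \<oplus>\<^bsub>H y\<^esub> value_at A y q"
    "value_at A y \<one> = \<one>\<^bsub>H y\<^esub>" "value_at A y \<zero> = \<zero>\<^bsub>H y\<^esub>"
    "value_at A y (\<ominus> p) = \<ominus>\<^bsub>H y\<^esub> value_at A y p"
    using assms by auto
qed

lemma value_abs: "y \<in> Sp \<Longrightarrow> p \<in> carrier A \<Longrightarrow> vH y (value_at A y p) = y p"
  using mult_point.value_at_abs[OF point] .

lemma value_nz: assumes "y \<in> Sp" "q \<in> carrier A" "y q \<noteq> 0" shows "value_at A y q \<noteq> \<zero>\<^bsub>H y\<^esub>"
proof -
  interpret H: valued_field "H y" "vH y" by (rule H_valued[OF assms(1)])
  show ?thesis using value_abs[OF assms(1,2)] assms(3) by auto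
qed

lemma fr_closed: assumes "y \<in> Sp" "p \<in> carrier A" "q \<in> carrier A" "y q \<noteq> 0" shows "fr p q y \<in> carrier (H y)"
proof -
  interpret H: valued_field "H y" "vH y" by (rule H_valued[OF assms(1)])
  show ?thesis unfolding fr_def using assms value_closed value_nz H.inv_closed by simp
qed

lemma fr_abs: assumes "y \<in> Sp" "p \<in> carrier A" "q \<in> carrier A" "y q \<noteq> 0" shows "vH y (fr p q y) = y p / y q"
proof -
  interpret H: valued_field "H y" "vH y" by (rule H_valued[OF assms(1)])
  show ?thesis unfolding fr_def using assms value_closed value_nz H.inv_closed
    by (simp add: H.v_mult H.v_inv value_abs divide_inverse)
qed

lemma (in valued_field) inv_eqI: "\<lbrakk>x \<in> carrier R; y \<in> carrier R; x \<otimes> y = \<one>\<rbrakk> \<Longrightarrow> inv x = y"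
  using comm_inv_char by auto

lemma (in valued_field) inv_mult:
  assumes "x \<in> carrier R" "x \<noteq> \<zero>" "y \<in> carrier R" "y \<noteq> \<zero>"
  shows "inv (x \<otimes> y) = inv x \<otimes> inv y"
proof (rule inv_eqI)
  have i: "inv x \<in> carrier R" "inv y \<in> carrier R" using assms inv_closed by auto
  have "x \<otimes> y \<otimes> (inv x \<otimes> inv y) = (x \<otimes> inv x) \<otimes> (y \<otimes> inv y)" using assms i by (simp add: m_ac)
  then show "x \<otimes> y \<otimes> (inv x \<otimes> inv y) = \<one>" using assms r_inv_field by simp
qed (use assms inv_closed in auto)

lemma (in valued_field) frac_calc:
  assumes "a \<in> carrier R" "b \<in> carrier R" "b \<noteq> \<zero>" "c \<in> carrier R" "d \<in> carrier R" "d \<noteq> \<zero>"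
  shows "(a \<otimes> inv b) \<otimes> (c \<otimes> inv d) = (a \<otimes> c) \<otimes> inv (b \<otimes> d)"
    "(a \<otimes> inv b) \<oplus> (c \<otimes> inv d) = (a \<otimes> d \<oplus> c \<otimes> b) \<otimes> inv (b \<otimes> d)"
    "a \<noteq> \<zero> \<Longrightarrow> inv (a \<otimes> inv b) = b \<otimes> inv a"
proof -
  define i j where "i = inv b" and "j = inv d"
  have ij: "i \<in> carrier R" "j \<in> carrier R" "b \<otimes> i = \<one>" "d \<otimes> j = \<one>"
    using assms inv_closed r_inv_field by (auto simp: i_def j_def)
  show "(a \<otimes> inv b) \<otimes> (c \<otimes> inv d) = (a \<otimes> c) \<otimes> inv (b \<otimes> d)"
    using assms ij by (simp add: inv_mult i_def[symmetric] j_def[symmetric] m_ac)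
  have "(a \<otimes> i) \<oplus> (c \<otimes> j) = (a \<otimes> i) \<otimes> (d \<otimes> j) \<oplus> (c \<otimes> j) \<otimes> (b \<otimes> i)" using assms ij by simp
  also have "\<dots> = (a \<otimes> d \<oplus> c \<otimes> b) \<otimes> (i \<otimes> j)" using assms(1,2,4,5) ij(1,2) by (simp add: ring_expand)
  finally show "(a \<otimes> inv b) \<oplus> (c \<otimes> inv d) = (a \<otimes> d \<oplus> c \<otimes> b) \<otimes> inv (b \<otimes> d)"
    using assms by (simp add: inv_mult i_def j_def)
  show "inv (a \<otimes> inv b) = b \<otimes> inv a" if a: "a \<noteq> \<zero>"
  proof (rule inv_eqI)
    define k where "k = inv a"
    have k: "k \<in> carrier R" "a \<otimes> k = \<one>" using assms a inv_closed r_inv_field by (auto simp: k_def)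
    have "a \<otimes> i \<otimes> (b \<otimes> k) = (a \<otimes> k) \<otimes> (b \<otimes> i)"
      using assms(1,2,4,5) ij(1,2) k(1) by (simp add: ring_expand)
    then show "a \<otimes> inv b \<otimes> (b \<otimes> inv a) = \<one>" using k ij by (simp add: i_def k_def)
  qed (use assms a inv_closed in auto)
qed

lemma point_mult: "y \<in> Sp \<Longrightarrow> p \<in> carrier A \<Longrightarrow> q \<in> carrier A \<Longrightarrow> y (p \<otimes> q) = y p * y q"
  using mult_point.x_mult[OF point] .

lemma fr_ops:
  assumes y: "y \<in> Sp" and pq: "p \<in> carrier A" "q \<in> carrier A" "y q \<noteq> 0"
    and pq': "p' \<in> carrier A" "q' \<in> carrier A" "y q' \<noteq> 0"
  shows "fr p q y \<otimes>\<^bsub>H y\<^esub> fr p' q' y = fr (p \<otimes> p') (q \<otimes> q') y"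
    "fr p q y \<oplus>\<^bsub>H y\<^esub> fr p' q' y = fr (p \<otimes> q' \<oplus> p' \<otimes> q) (q \<otimes> q') y"
    "y p \<noteq> 0 \<Longrightarrow> inv\<^bsub>H y\<^esub> (fr p q y) = fr q p y"
proof -
  interpret H: valued_field "H y" "vH y" by (rule H_valued[OF y])
  note [simp] = value_closed[OF y] value_hom[OF y]
  show "fr p q y \<otimes>\<^bsub>H y\<^esub> fr p' q' y = fr (p \<otimes> p') (q \<otimes> q') y"
    "fr p q y \<oplus>\<^bsub>H y\<^esub> fr p' q' y = fr (p \<otimes> q' \<oplus> p' \<otimes> q) (q \<otimes> q') y"
    using assms value_nz by (simp_all add: fr_def H.frac_calc(1,2))
  show "inv\<^bsub>H y\<^esub> (fr p q y) = fr q p y" if "y p \<noteq> 0"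
    using assms value_nz that by (simp add: fr_def H.frac_calc(3)[where c="\<one>\<^bsub>H y\<^esub>" and d="\<one>\<^bsub>H y\<^esub>"])
qed

text \<open>Uniform limits of uniform limits on a fixed set \<open>W\<close> are again uniform limits on \<open>W\<close>. For sections,
  which are uniform limits only locally, this fails, as the neighbourhoods may shrink.\<close>

definition ulf :: "('a \<Rightarrow> real) set \<Rightarrow> (('a \<Rightarrow> real) \<Rightarrow> 'a hfield_elem) \<Rightarrow> bool" where
  "ulf W f \<longleftrightarrow> (\<forall>y\<in>W. f y \<in> carrier (H y)) \<and>
     (\<forall>e>0. \<exists>p\<in>carrier A. \<exists>q\<in>carrier A. \<forall>y\<in>W. y q \<noteq> 0 \<and> vH y (f y \<ominus>\<^bsub>H y\<^esub> fr p q y) < e)"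

lemma ulf_closed: "ulf W f \<Longrightarrow> y \<in> W \<Longrightarrow> f y \<in> carrier (H y)"
  by (simp add: ulf_def)

lemma ulfE:
  assumes "ulf W f" "0 < e"
  obtains p q where "p \<in> carrier A" "q \<in> carrier A" "\<And>y. y \<in> W \<Longrightarrow> y q \<noteq> 0"
    "\<And>y. y \<in> W \<Longrightarrow> vH y (f y \<ominus>\<^bsub>H y\<^esub> fr p q y) < e"
  using assms unfolding ulf_def by meson

text \<open>A sequence of fractions with errors tending to 0 is obtained by choosing one fraction
  for each tolerance 1/(n+1).\<close>

lemma ulf_iff:
  "ulf W f \<longleftrightarrow> (\<forall>y\<in>W. f y \<in> carrier (H y)) \<and> uniform_limit_of_fractions A W f"
proof
  assume u: "ulf W f"
  have "\<exists>p q. p \<in> carrier A \<and> q \<in> carrier A \<and> (\<forall>y\<in>W. y q \<noteq> 0) \<and>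
      (\<forall>y\<in>W. vH y (f y \<ominus>\<^bsub>H y\<^esub> fr p q y) < 1 / real (Suc n))" for n
    using ulfE[OF u, of "1 / real (Suc n)"] by (metis of_nat_0_less_iff zero_less_Suc zero_less_divide_1_iff)
  then obtain p q where pq: "\<And>n. p n \<in> carrier A \<and> q n \<in> carrier A \<and> (\<forall>y\<in>W. y (q n) \<noteq> 0) \<and>
      (\<forall>y\<in>W. vH y (f y \<ominus>\<^bsub>H y\<^esub> fr (p n) (q n) y) < 1 / real (Suc n))" by metis
  have "\<exists>n0. \<forall>n\<ge>n0. \<forall>y\<in>W. vH y (f y \<ominus>\<^bsub>H y\<^esub> fr (p n) (q n) y) < e" if "0 < e" for e
  proof -
    have "(\<lambda>k. 1 / real (Suc k)) \<longlonglongrightarrow> 0" using LIMSEQ_inverse_real_of_nat by (simp add: inverse_eq_divide)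
    from order_tendstoD(2)[OF this that] obtain n0 where "\<forall>n\<ge>n0. 1 / real (Suc n) < e"
      by (auto simp: eventually_sequentially)
    then show ?thesis using pq by (meson order.strict_trans)
  qed
  then show "(\<forall>y\<in>W. f y \<in> carrier (H y)) \<and> uniform_limit_of_fractions A W f"
    using u pq unfolding uniform_limit_of_fractions_def fr_def ulf_def by blast
next
  assume a: "(\<forall>y\<in>W. f y \<in> carrier (H y)) \<and> uniform_limit_of_fractions A W f"
  then obtain p q where pq: "\<And>n::nat. p n \<in> carrier A \<and> q n \<in> carrier A \<and> (\<forall>y\<in>W. y (q n) \<noteq> 0)"
    "\<And>e. 0 < e \<Longrightarrow> \<exists>n0. \<forall>n\<ge>n0. \<forall>y\<in>W. vH y (f y \<ominus>\<^bsub>H y\<^esub> fr (p n) (q n) y) < e"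
    unfolding uniform_limit_of_fractions_def fr_def by blast
  have "\<exists>p\<in>carrier A. \<exists>q\<in>carrier A. \<forall>y\<in>W. y q \<noteq> 0 \<and> vH y (f y \<ominus>\<^bsub>H y\<^esub> fr p q y) < e" if "0 < e" for e
    using pq(1) pq(2)[OF that] by (meson order_refl)
  then show "ulf W f" using a by (simp add: ulf_def)
qed

lemma ulf_mono: "ulf W f \<Longrightarrow> W' \<subseteq> W \<Longrightarrow> ulf W' f"
  unfolding ulf_def by (meson subsetD)

lemma ulf_cong: assumes "ulf W f" "\<And>y. y \<in> W \<Longrightarrow> g y = f y" shows "ulf W g"
  using assms unfolding ulf_def by simp

lemma ulf_fr:
  assumes "W \<subseteq> Sp" "p \<in> carrier A" "q \<in> carrier A" "\<And>y. y \<in> W \<Longrightarrow> y q \<noteq> 0"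
  shows "ulf W (fr p q)"
  unfolding ulf_def
proof (intro conjI ballI allI impI)
  show c: "fr p q y \<in> carrier (H y)" if "y \<in> W" for y using assms that by (intro fr_closed) auto
  fix e :: real assume "0 < e"
  have "vH y (fr p q y \<ominus>\<^bsub>H y\<^esub> fr p q y) < e" if y: "y \<in> W" for y
  proof -
    interpret H: valued_field "H y" "vH y" using H_valued assms y by blast
    show ?thesis using c[OF y] \<open>0 < e\<close> by (simp add: a_minus_def H.r_neg)
  qed
  then show "\<exists>p'\<in>carrier A. \<exists>q'\<in>carrier A. \<forall>y\<in>W. y q' \<noteq> 0 \<and> vH y (fr p q y \<ominus>\<^bsub>H y\<^esub> fr p' q' y) < e"
    using assms by blast
qed

text \<open>Reduces the closure properties below to approximating a function by single fractions,
  and later admits the solution of a quadratic system as limit of its iterates.\<close>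

lemma ulf_limit:
  assumes W: "W \<subseteq> Sp" and f: "\<And>y. y \<in> W \<Longrightarrow> f y \<in> carrier (H y)"
    and lim: "\<And>e. 0 < e \<Longrightarrow> \<exists>g. ulf W g \<and> (\<forall>y\<in>W. vH y (f y \<ominus>\<^bsub>H y\<^esub> g y) < e)"
  shows "ulf W f"
  unfolding ulf_def
proof (intro conjI ballI allI impI f)
  fix e :: real assume "0 < e"
  then have e: "0 < e / 2" by simp
  obtain g where g: "ulf W g" "\<forall>y\<in>W. vH y (f y \<ominus>\<^bsub>H y\<^esub> g y) < e / 2" using lim[OF e] by blast
  obtain p q where pq: "p \<in> carrier A" "q \<in> carrier A" "\<And>y. y \<in> W \<Longrightarrow> y q \<noteq> 0"
    "\<And>y. y \<in> W \<Longrightarrow> vH y (g y \<ominus>\<^bsub>H y\<^esub> fr p q y) < e / 2" using ulfE[OF g(1) e] by blast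
  have "vH y (f y \<ominus>\<^bsub>H y\<^esub> fr p q y) < e" if y: "y \<in> W" for y
  proof -
    interpret H: valued_field "H y" "vH y" using H_valued W y by blast
    have "vH y (f y \<ominus>\<^bsub>H y\<^esub> fr p q y) \<le> vH y (f y \<ominus>\<^bsub>H y\<^esub> g y) + vH y (g y \<ominus>\<^bsub>H y\<^esub> fr p q y)"
      using f y ulf_closed[OF g(1)] fr_closed pq W by (intro H.v_diff_triangle) auto
    moreover have "vH y (f y \<ominus>\<^bsub>H y\<^esub> g y) < e / 2" using g(2) y by blast
    ultimately show ?thesis using pq(4)[OF y] by linarith
  qed
  then show "\<exists>p\<in>carrier A. \<exists>q\<in>carrier A. \<forall>y\<in>W. y q \<noteq> 0 \<and> vH y (f y \<ominus>\<^bsub>H y\<^esub> fr p q y) < e"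
    using pq by blast
qed

lemma ulf_add:
  assumes W: "W \<subseteq> Sp" and f: "ulf W f" and g: "ulf W g"
  shows "ulf W (\<lambda>y. f y \<oplus>\<^bsub>H y\<^esub> g y)"
proof (rule ulf_limit[OF W])
  fix y assume y: "y \<in> W"
  interpret H: valued_field "H y" "vH y" using H_valued W y by blast
  show "f y \<oplus>\<^bsub>H y\<^esub> g y \<in> carrier (H y)" using ulf_closed f g y by simp
next
  fix e :: real assume "0 < e"
  then have e: "0 < e / 2" by simp
  obtain p q where pq: "p \<in> carrier A" "q \<in> carrier A" "\<And>y. y \<in> W \<Longrightarrow> y q \<noteq> 0"
    "\<And>y. y \<in> W \<Longrightarrow> vH y (f y \<ominus>\<^bsub>H y\<^esub> fr p q y) < e / 2" using ulfE[OF f e] by blast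
  obtain p' q' where pq': "p' \<in> carrier A" "q' \<in> carrier A" "\<And>y. y \<in> W \<Longrightarrow> y q' \<noteq> 0"
    "\<And>y. y \<in> W \<Longrightarrow> vH y (g y \<ominus>\<^bsub>H y\<^esub> fr p' q' y) < e / 2" using ulfE[OF g e] by blast
  have "ulf W (fr (p \<otimes> q' \<oplus> p' \<otimes> q) (q \<otimes> q'))"
  proof (rule ulf_fr[OF W])
    show "y (q \<otimes> q') \<noteq> 0" if "y \<in> W" for y
      using point_mult[OF subsetD[OF W that] pq(2) pq'(2)] pq(3)[OF that] pq'(3)[OF that] by simp
  qed (use pq pq' in auto)
  moreover have "vH y (f y \<oplus>\<^bsub>H y\<^esub> g y \<ominus>\<^bsub>H y\<^esub> fr (p \<otimes> q' \<oplus> p' \<otimes> q) (q \<otimes> q') y) < e" if y: "y \<in> W" for y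
  proof -
    interpret H: valued_field "H y" "vH y" using H_valued W y by blast
    have ySp: "y \<in> Sp" using W y by auto
    define a b c d where "a = f y" and "b = g y" and "c = fr p q y" and "d = fr p' q' y"
    have abcd: "a \<in> carrier (H y)" "b \<in> carrier (H y)" "c \<in> carrier (H y)" "d \<in> carrier (H y)"
      using ulf_closed f g y fr_closed ySp pq pq' by (auto simp: a_def b_def c_def d_def)
    have "f y \<oplus>\<^bsub>H y\<^esub> g y \<ominus>\<^bsub>H y\<^esub> fr (p \<otimes> q' \<oplus> p' \<otimes> q) (q \<otimes> q') y = a \<oplus>\<^bsub>H y\<^esub> b \<ominus>\<^bsub>H y\<^esub> (c \<oplus>\<^bsub>H y\<^esub> d)"
      using fr_ops(2)[OF ySp pq(1,2) pq(3)[OF y] pq'(1,2) pq'(3)[OF y]] by (simp add: a_def b_def c_def d_def)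
    also have "\<dots> = (a \<ominus>\<^bsub>H y\<^esub> c) \<oplus>\<^bsub>H y\<^esub> (b \<ominus>\<^bsub>H y\<^esub> d)"
      using abcd by (simp add: H.ring_expand)
    finally have "vH y (f y \<oplus>\<^bsub>H y\<^esub> g y \<ominus>\<^bsub>H y\<^esub> fr (p \<otimes> q' \<oplus> p' \<otimes> q) (q \<otimes> q') y) \<le>
        vH y (a \<ominus>\<^bsub>H y\<^esub> c) + vH y (b \<ominus>\<^bsub>H y\<^esub> d)" using abcd by (simp add: H.v_add)
    then show ?thesis using pq(4)[OF y] pq'(4)[OF y] by (simp add: a_def b_def c_def d_def)
  qed
  ultimately show "\<exists>h. ulf W h \<and> (\<forall>y\<in>W. vH y (f y \<oplus>\<^bsub>H y\<^esub> g y \<ominus>\<^bsub>H y\<^esub> h y) < e)" by blast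
qed

text \<open>A uniform limit of fractions on W may be unbounded there, and an error in one factor is
  multiplied by the size of the other; hence the bounds B and D.\<close>

lemma ulf_mult:
  assumes W: "W \<subseteq> Sp" and f: "ulf W f" and g: "ulf W g"
    and B: "\<And>y. y \<in> W \<Longrightarrow> vH y (f y) \<le> B" and D: "\<And>y. y \<in> W \<Longrightarrow> vH y (g y) \<le> D"
  shows "ulf W (\<lambda>y. f y \<otimes>\<^bsub>H y\<^esub> g y)"
proof (rule ulf_limit[OF W])
  fix y assume y: "y \<in> W"
  interpret H: valued_field "H y" "vH y" using H_valued W y by blast
  show "f y \<otimes>\<^bsub>H y\<^esub> g y \<in> carrier (H y)" using ulf_closed f g y by simp
next
  fix e :: real assume e: "0 < e"
  \<comment> \<open>Keeps the total error |B| r + r (|D| + 1) below e. The extra 1 accounts for the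
    approximating fraction, which exceeds D by less than r \<le> 1.\<close>
  define r where "r = min 1 (e / (2 * (\<bar>B\<bar> + \<bar>D\<bar> + 2)))"
  have r: "0 < r" "r \<le> 1" using e by (auto simp: r_def intro!: divide_pos_pos)
  have "r * (\<bar>B\<bar> + \<bar>D\<bar> + 2) \<le> e / (2 * (\<bar>B\<bar> + \<bar>D\<bar> + 2)) * (\<bar>B\<bar> + \<bar>D\<bar> + 2)"
    by (intro mult_right_mono) (auto simp: r_def)
  also have "\<dots> = e / 2" by (simp add: field_simps)
  finally have rB: "r * (\<bar>B\<bar> + \<bar>D\<bar> + 2) < e" using e by simp
  obtain p q where pq: "p \<in> carrier A" "q \<in> carrier A" "\<And>y. y \<in> W \<Longrightarrow> y q \<noteq> 0"
    "\<And>y. y \<in> W \<Longrightarrow> vH y (f y \<ominus>\<^bsub>H y\<^esub> fr p q y) < r" using ulfE[OF f r(1)] by blast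
  obtain p' q' where pq': "p' \<in> carrier A" "q' \<in> carrier A" "\<And>y. y \<in> W \<Longrightarrow> y q' \<noteq> 0"
    "\<And>y. y \<in> W \<Longrightarrow> vH y (g y \<ominus>\<^bsub>H y\<^esub> fr p' q' y) < r" using ulfE[OF g r(1)] by blast
  have "ulf W (fr (p \<otimes> p') (q \<otimes> q'))"
  proof (rule ulf_fr[OF W])
    show "y (q \<otimes> q') \<noteq> 0" if "y \<in> W" for y
      using point_mult[OF subsetD[OF W that] pq(2) pq'(2)] pq(3)[OF that] pq'(3)[OF that] by simp
  qed (use pq pq' in auto)
  moreover have "vH y (f y \<otimes>\<^bsub>H y\<^esub> g y \<ominus>\<^bsub>H y\<^esub> fr (p \<otimes> p') (q \<otimes> q') y) < e" if y: "y \<in> W" for y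
  proof -
    interpret H: valued_field "H y" "vH y" using H_valued W y by blast
    have ySp: "y \<in> Sp" using W y by auto
    have c: "f y \<in> carrier (H y)" "g y \<in> carrier (H y)" "fr p q y \<in> carrier (H y)" "fr p' q' y \<in> carrier (H y)"
      using ulf_closed f g y fr_closed ySp pq pq' by auto
    have "vH y (fr p' q' y) \<le> \<bar>D\<bar> + 1"
      using H.v_diff_ge[OF c(2,4)] D[OF y] pq'(4)[OF y] r by linarith
    moreover have "vH y (f y \<otimes>\<^bsub>H y\<^esub> g y \<ominus>\<^bsub>H y\<^esub> fr p q y \<otimes>\<^bsub>H y\<^esub> fr p' q' y) \<le>
        vH y (f y) * vH y (g y \<ominus>\<^bsub>H y\<^esub> fr p' q' y) + vH y (f y \<ominus>\<^bsub>H y\<^esub> fr p q y) * vH y (fr p' q' y)"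
      using c by (intro H.v_mult_diff) auto
    moreover have "vH y (f y) * vH y (g y \<ominus>\<^bsub>H y\<^esub> fr p' q' y) \<le> \<bar>B\<bar> * r"
      using B[OF y] pq'(4)[OF y] c by (intro mult_mono) auto
    moreover have "vH y (f y \<ominus>\<^bsub>H y\<^esub> fr p q y) * vH y (fr p' q' y) \<le> r * (\<bar>D\<bar> + 1)"
      using calculation(1) pq(4)[OF y] c r by (intro mult_mono) auto
    ultimately have "vH y (f y \<otimes>\<^bsub>H y\<^esub> g y \<ominus>\<^bsub>H y\<^esub> fr p q y \<otimes>\<^bsub>H y\<^esub> fr p' q' y) \<le> \<bar>B\<bar> * r + r * (\<bar>D\<bar> + 1)" by linarith
    also have "\<dots> \<le> r * (\<bar>B\<bar> + \<bar>D\<bar> + 2)" using r by (simp add: algebra_simps)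
    also note rB
    finally show ?thesis using fr_ops(1)[OF ySp pq(1,2) pq(3)[OF y] pq'(1,2) pq'(3)[OF y]] by simp
  qed
  ultimately show "\<exists>h. ulf W h \<and> (\<forall>y\<in>W. vH y (f y \<otimes>\<^bsub>H y\<^esub> g y \<ominus>\<^bsub>H y\<^esub> h y) < e)" by blast
qed

text \<open>The uniform lower bound \<delta> passes to the approximating fractions p/q. So p has no
  zero on W, and q/p is an admissible approximation of the inverse.\<close>

lemma ulf_inverse:
  assumes W: "W \<subseteq> Sp" and f: "ulf W f" and \<delta>: "0 < \<delta>" "\<And>y. y \<in> W \<Longrightarrow> \<delta> \<le> vH y (f y)"
  shows "ulf W (\<lambda>y. inv\<^bsub>H y\<^esub> (f y))"
proof (rule ulf_limit[OF W])
  fix y assume y: "y \<in> W"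
  interpret H: valued_field "H y" "vH y" using H_valued W y by blast
  have "f y \<noteq> \<zero>\<^bsub>H y\<^esub>" using \<delta>(1) \<delta>(2)[OF y] by auto
  then show "inv\<^bsub>H y\<^esub> (f y) \<in> carrier (H y)" using H.inv_closed ulf_closed f y by blast
next
  fix e :: real assume e: "0 < e"
  \<comment> \<open>The first entry keeps |p/q| above \<delta>/2. The second offsets the
    denominators in the difference of the inverses, whose product exceeds \<delta>
    (\<delta>/2).\<close>
  define r where "r = min (\<delta> / 2) (e * (\<delta> * (\<delta> / 2)))"
  have r: "0 < r" using e \<delta> by (auto simp: r_def)
  obtain p q where pq: "p \<in> carrier A" "q \<in> carrier A" "\<And>y. y \<in> W \<Longrightarrow> y q \<noteq> 0"
    "\<And>y. y \<in> W \<Longrightarrow> vH y (f y \<ominus>\<^bsub>H y\<^esub> fr p q y) < r" using ulfE[OF f r] by blast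
  have low: "\<delta> / 2 < vH y (fr p q y)" if y: "y \<in> W" for y
  proof -
    interpret H: valued_field "H y" "vH y" using H_valued W y by blast
    have "fr p q y \<in> carrier (H y)" using W y pq by (intro fr_closed) auto
    then have "\<bar>vH y (f y) - vH y (fr p q y)\<bar> < \<delta> / 2"
      using H.v_diff_ge[of "f y" "fr p q y"] ulf_closed[OF f y] pq(4)[OF y] by (simp add: r_def)
    then show ?thesis using \<delta>(2)[OF y] by linarith
  qed
  have yp: "y p \<noteq> 0" if y: "y \<in> W" for y
    using low[OF y] \<delta>(1) fr_abs[of y p q] W y pq by auto
  have "ulf W (fr q p)" using W pq yp by (intro ulf_fr) auto
  moreover have "vH y (inv\<^bsub>H y\<^esub> (f y) \<ominus>\<^bsub>H y\<^esub> fr q p y) < e" if y: "y \<in> W" for y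
  proof -
    interpret H: valued_field "H y" "vH y" using H_valued W y by blast
    have ySp: "y \<in> Sp" using W y by auto
    define a b i j where "a = f y" and "b = fr p q y" and "i = inv\<^bsub>H y\<^esub> a" and "j = inv\<^bsub>H y\<^esub> b"
    have ab: "a \<in> carrier (H y)" "b \<in> carrier (H y)" "\<delta> \<le> vH y a" "\<delta> / 2 < vH y b"
      using ulf_closed[OF f y] fr_closed ySp pq y \<delta>(2)[OF y] low[OF y] by (auto simp: a_def b_def)
    have nz: "a \<noteq> \<zero>\<^bsub>H y\<^esub>" "b \<noteq> \<zero>\<^bsub>H y\<^esub>" using ab(3,4) \<delta>(1) by auto
    have ij: "i \<in> carrier (H y)" "j \<in> carrier (H y)" "a \<otimes>\<^bsub>H y\<^esub> i = \<one>\<^bsub>H y\<^esub>" "b \<otimes>\<^bsub>H y\<^esub> j = \<one>\<^bsub>H y\<^esub>"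
      using ab(1,2) nz H.inv_closed H.r_inv_field by (auto simp: i_def j_def)
    have "i \<ominus>\<^bsub>H y\<^esub> j = i \<otimes>\<^bsub>H y\<^esub> (b \<otimes>\<^bsub>H y\<^esub> j) \<ominus>\<^bsub>H y\<^esub> (a \<otimes>\<^bsub>H y\<^esub> i) \<otimes>\<^bsub>H y\<^esub> j" using ij by simp
    also have "\<dots> = (b \<ominus>\<^bsub>H y\<^esub> a) \<otimes>\<^bsub>H y\<^esub> (i \<otimes>\<^bsub>H y\<^esub> j)" using ab(1,2) ij(1,2) by (simp add: H.ring_expand)
    finally have eq: "vH y (i \<ominus>\<^bsub>H y\<^esub> j) = vH y (a \<ominus>\<^bsub>H y\<^esub> b) * (inverse (vH y a) * inverse (vH y b))"
      using ab(1,2) ij nz H.v_diff_commute[OF ab(1,2)] by (simp add: H.v_mult H.v_inv i_def j_def)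
    have pos: "0 < vH y a" "0 < vH y b" using ab(3,4) \<delta>(1) by linarith+
    have "vH y (a \<ominus>\<^bsub>H y\<^esub> b) < e * (\<delta> * (\<delta> / 2))" using pq(4)[OF y] by (simp add: a_def b_def r_def)
    also have "\<dots> \<le> e * (vH y a * vH y b)" using ab(3,4) \<delta>(1) e by (intro mult_left_mono mult_mono) auto
    finally have "vH y (i \<ominus>\<^bsub>H y\<^esub> j) < e" unfolding eq using pos by (simp add: field_simps)
    then show ?thesis using fr_ops(3)[OF ySp pq(1,2) pq(3)[OF y] pq(1,2) pq(3)[OF y] yp[OF y]]
      by (simp add: i_def j_def a_def b_def)
  qed
  ultimately show "\<exists>h. ulf W h \<and> (\<forall>y\<in>W. vH y (inv\<^bsub>H y\<^esub> (f y) \<ominus>\<^bsub>H y\<^esub> h y) < e)" by blast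
qed

lemma assumes W: "W \<subseteq> Sp" shows ulf_zero: "ulf W (\<lambda>y. \<zero>\<^bsub>H y\<^esub>)" and ulf_one: "ulf W (\<lambda>y. \<one>\<^bsub>H y\<^esub>)"
proof -
  have y1: "y \<one> \<noteq> 0" if "y \<in> W" for y using mult_point.x_one[OF point, of y] W that by auto
  have "fr \<zero> \<one> y = \<zero>\<^bsub>H y\<^esub>" "fr \<one> \<one> y = \<one>\<^bsub>H y\<^esub>" if "y \<in> W" for y
  proof -
    interpret H: valued_field "H y" "vH y" using H_valued W that by blast
    have ySp: "y \<in> Sp" using W that by auto
    show "fr \<zero> \<one> y = \<zero>\<^bsub>H y\<^esub>" "fr \<one> \<one> y = \<one>\<^bsub>H y\<^esub>"
      using value_hom(3,4)[OF ySp one_closed one_closed] by (simp_all add: fr_def)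
  qed
  note fr01 = this
  have "ulf W (fr \<zero> \<one>)" "ulf W (fr \<one> \<one>)"
    by (rule ulf_fr[OF W]; use y1 in auto)+
  then show "ulf W (\<lambda>y. \<zero>\<^bsub>H y\<^esub>)" "ulf W (\<lambda>y. \<one>\<^bsub>H y\<^esub>)"
    using fr01 by (auto intro: ulf_cong)
qed

lemma ulf_minus: assumes W: "W \<subseteq> Sp" and f: "ulf W f" shows "ulf W (\<lambda>y. \<ominus>\<^bsub>H y\<^esub> f y)"
proof (rule ulf_limit[OF W])
  fix y assume y: "y \<in> W"
  interpret H: valued_field "H y" "vH y" using H_valued W y by blast
  show "\<ominus>\<^bsub>H y\<^esub> f y \<in> carrier (H y)" using ulf_closed f y by simp
next
  fix e :: real assume e: "0 < e"
  obtain p q where pq: "p \<in> carrier A" "q \<in> carrier A" "\<And>y. y \<in> W \<Longrightarrow> y q \<noteq> 0"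
    "\<And>y. y \<in> W \<Longrightarrow> vH y (f y \<ominus>\<^bsub>H y\<^esub> fr p q y) < e" using ulfE[OF f e] by blast
  have "ulf W (fr (\<ominus> p) q)" using W pq by (intro ulf_fr) auto
  moreover have "vH y (\<ominus>\<^bsub>H y\<^esub> f y \<ominus>\<^bsub>H y\<^esub> fr (\<ominus> p) q y) < e" if y: "y \<in> W" for y
  proof -
    interpret H: valued_field "H y" "vH y" using H_valued W y by blast
    have ySp: "y \<in> Sp" using W y by auto
    define a b where "a = f y" and "b = fr p q y"
    have ab: "a \<in> carrier (H y)" "b \<in> carrier (H y)"
      using ulf_closed[OF f y] fr_closed ySp pq y by (auto simp: a_def b_def)
    have "value_at A y q \<noteq> \<zero>\<^bsub>H y\<^esub>" using value_nz[OF ySp] pq y by auto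
    then have "inv\<^bsub>H y\<^esub> value_at A y q \<in> carrier (H y)" using H.inv_closed value_closed[OF ySp] pq by auto
    then have "fr (\<ominus> p) q y = \<ominus>\<^bsub>H y\<^esub> b"
      using value_hom(5)[OF ySp pq(1,1)] value_closed[OF ySp] pq by (simp add: fr_def b_def H.l_minus)
    moreover have "\<ominus>\<^bsub>H y\<^esub> a \<ominus>\<^bsub>H y\<^esub> \<ominus>\<^bsub>H y\<^esub> b = \<ominus>\<^bsub>H y\<^esub> (a \<ominus>\<^bsub>H y\<^esub> b)"
      using ab by (simp add: H.ring_expand)
    moreover have "vH y (\<ominus>\<^bsub>H y\<^esub> (a \<ominus>\<^bsub>H y\<^esub> b)) = vH y (a \<ominus>\<^bsub>H y\<^esub> b)" using ab by (intro H.v_minus) auto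
    ultimately show ?thesis using pq(4)[OF y] by (simp add: a_def b_def)
  qed
  ultimately show "\<exists>h. ulf W h \<and> (\<forall>y\<in>W. vH y (\<ominus>\<^bsub>H y\<^esub> f y \<ominus>\<^bsub>H y\<^esub> h y) < e)" by blast
qed

lemma ulf_finsum:
  assumes W: "W \<subseteq> Sp" and "finite I" and f: "\<And>i. i \<in> I \<Longrightarrow> ulf W (f i)"
  shows "ulf W (\<lambda>y. \<Oplus>\<^bsub>H y\<^esub>i\<in>I. f i y)"
  using assms(2) f
proof (induction I rule: finite_induct)
  case empty
  have "(\<Oplus>\<^bsub>H y\<^esub>i\<in>{}. f i y) = \<zero>\<^bsub>H y\<^esub>" if "y \<in> W" for y
  proof -
    interpret H: valued_field "H y" "vH y" using H_valued W that by blast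
    show ?thesis by simp
  qed
  then show ?case by (rule ulf_cong[OF ulf_zero[OF W]])
next
  case (insert i I)
  have eq: "(\<Oplus>\<^bsub>H y\<^esub>i\<in>insert i I. f i y) = f i y \<oplus>\<^bsub>H y\<^esub> (\<Oplus>\<^bsub>H y\<^esub>i\<in>I. f i y)" if "y \<in> W" for y
  proof -
    interpret H: valued_field "H y" "vH y" using H_valued W that by blast
    have "f j y \<in> carrier (H y)" if "j \<in> insert i I" for j using ulf_closed[OF insert.prems[OF that] \<open>y \<in> W\<close>] .
    then show ?thesis using insert.hyps by (intro H.finsum_insert) auto
  qed
  have u: "ulf W (\<lambda>y. f i y \<oplus>\<^bsub>H y\<^esub> (\<Oplus>\<^bsub>H y\<^esub>i\<in>I. f i y))"
    using insert by (intro ulf_add[OF W]) auto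
  show ?case by (rule ulf_cong[OF u]) (rule eq)
qed

lemma openin_basic: "f \<in> carrier A \<Longrightarrow> open U \<Longrightarrow> openin Top {y \<in> Sp. y f \<in> U}"
  unfolding spectrum_topology_def by (rule topology_generated_by_Basis) blast

lemma openin_Sp: "openin Top Sp"
  using openin_basic[OF zero_closed open_UNIV] by simp

lemma openin_subset_Sp: assumes "openin Top W" shows "W \<subseteq> Sp"
proof -
  have "topspace Top \<subseteq> Sp" unfolding spectrum_topology_def topology_generated_by_topspace by blast
  then show ?thesis using openin_subset[OF assms] by blast
qed

text \<open>The topology is generated by conditions on single elements of A. Near a point of the
  set, a threshold m strictly between the two sides splits the comparison into two such
  conditions.\<close>

lemma openin_less:
  assumes p: "p \<in> carrier A" and q: "q \<in> carrier A" and r: "0 \<le> r" "0 \<le> r'"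
  shows "openin Top {y \<in> Sp. r' * y p < r * y q}"
proof (subst openin_subopen, intro ballI)
  fix x assume x: "x \<in> {y \<in> Sp. r' * y p < r * y q}"
  define m where "m = (r' * x p + r * x q) / 2"
  define U1 where "U1 = {t::real. r' * t < m}"
  define U2 where "U2 = {t::real. m < r * t}"
  have "open U1" "open U2" unfolding U1_def U2_def by (intro open_Collect_less continuous_intros)+
  then have "openin Top ({y \<in> Sp. y p \<in> U1} \<inter> {y \<in> Sp. y q \<in> U2})"
    using openin_basic p q by blast
  moreover have "x \<in> {y \<in> Sp. y p \<in> U1} \<inter> {y \<in> Sp. y q \<in> U2}" using x by (auto simp: U1_def U2_def m_def)
  moreover have "{y \<in> Sp. y p \<in> U1} \<inter> {y \<in> Sp. y q \<in> U2} \<subseteq> {y \<in> Sp. r' * y p < r * y q}"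
    by (auto simp: U1_def U2_def)
  ultimately show "\<exists>T. openin Top T \<and> x \<in> T \<and> T \<subseteq> {y \<in> Sp. r' * y p < r * y q}" by blast
qed

text \<open>Uniformly on W, |f(y)| differs by less than e from |p(y)|/|q(y)|, and bounding this
  quotient is an open condition by \<open>openin_less\<close>.\<close>

lemma ulf_bounded_near:
  assumes W: "openin Top W" "b \<in> W" and f: "ulf W f" and r: "vH b (f b) < r"
  obtains W' where "openin Top W'" "b \<in> W'" "W' \<subseteq> W" "\<And>y. y \<in> W' \<Longrightarrow> vH y (f y) < r"
proof -
  have WS: "W \<subseteq> Sp" by (rule openin_subset_Sp[OF W(1)])
  have bS: "b \<in> Sp" using WS W by auto
  interpret Hb: valued_field "H b" "vH b" by (rule H_valued[OF bS])
  \<comment> \<open>A quarter of the room: at b the quotient is below |f(b)| + e. Requiring it to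
    stay below |f(b)| + 2e leaves |f| below |f(b)| + 3e < r.\<close>
  define e where "e = (r - vH b (f b)) / 4"
  have e: "0 < e" using r by (simp add: e_def)
  obtain p q where pq: "p \<in> carrier A" "q \<in> carrier A" "\<And>y. y \<in> W \<Longrightarrow> y q \<noteq> 0"
    "\<And>y. y \<in> W \<Longrightarrow> vH y (f y \<ominus>\<^bsub>H y\<^esub> fr p q y) < e" using ulfE[OF f e] by blast
  define s where "s = vH b (f b) + 2 * e"
  have s0: "0 \<le> s" using ulf_closed[OF f W(2)] e by (simp add: s_def)
  have near: "\<bar>vH y (f y) - y p / y q\<bar> < e \<and> 0 < y q" if y: "y \<in> W" for y
  proof -
    interpret H: valued_field "H y" "vH y" using H_valued WS y by blast
    have yS: "y \<in> Sp" using WS y by auto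
    have "fr p q y \<in> carrier (H y)" using fr_closed yS pq y by auto
    then have "\<bar>vH y (f y) - vH y (fr p q y)\<bar> < e"
      using H.v_diff_ge[of "f y" "fr p q y"] ulf_closed[OF f y] pq(4)[OF y] by simp
    moreover have "0 \<le> y q" using mult_point.x_nonneg[OF point[OF yS] pq(2)] .
    ultimately show ?thesis using fr_abs[OF yS pq(1,2) pq(3)[OF y]] pq(3)[OF y] by simp
  qed
  define W' where "W' = W \<inter> {y \<in> Sp. 1 * y p < s * y q}"
  show thesis
  proof (rule that[of W'])
    show "openin Top W'" unfolding W'_def using W(1) openin_less[OF pq(1,2) s0, of 1] by (intro openin_Int) auto
    have "b p / b q < s" using near[OF W(2)] by (simp add: s_def abs_less_iff)
    then show "b \<in> W'" using near[OF W(2)] W bS by (simp add: W'_def pos_divide_less_eq)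
    show "W' \<subseteq> W" by (auto simp: W'_def)
    fix y assume y: "y \<in> W'"
    then have yW: "y \<in> W" by (simp add: W'_def)
    have "y p / y q < s" using y near[OF yW] by (simp add: W'_def pos_divide_less_eq)
    then have "vH y (f y) < s + e" using near[OF yW] by (auto simp: abs_less_iff)
    also have "s + e = r - e" by (simp add: s_def e_def field_simps)
    also have "\<dots> < r" using e by simp
    finally show "vH y (f y) < r" .
  qed
qed

lemma ulf_bounded_below_near:
  assumes W: "openin Top W" "b \<in> W" and f: "ulf W f" and nz: "f b \<noteq> \<zero>\<^bsub>H b\<^esub>"
  obtains W' \<delta> where "openin Top W'" "b \<in> W'" "W' \<subseteq> W" "0 < \<delta>" "\<And>y. y \<in> W' \<Longrightarrow> \<delta> \<le> vH y (f y)"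
proof -
  have WS: "W \<subseteq> Sp" by (rule openin_subset_Sp[OF W(1)])
  have bS: "b \<in> Sp" using WS W by auto
  interpret Hb: valued_field "H b" "vH b" by (rule H_valued[OF bS])
  \<comment> \<open>At b the quotient |p|/|q| exceeds 3e. Requiring more than 2e is an open
    condition and leaves |f| above e nearby.\<close>
  define e where "e = vH b (f b) / 4"
  have e: "0 < e" using Hb.v_pos[OF ulf_closed[OF f W(2)] nz] by (simp add: e_def)
  obtain p q where pq: "p \<in> carrier A" "q \<in> carrier A" "\<And>y. y \<in> W \<Longrightarrow> y q \<noteq> 0"
    "\<And>y. y \<in> W \<Longrightarrow> vH y (f y \<ominus>\<^bsub>H y\<^esub> fr p q y) < e" using ulfE[OF f e] by blast
  have near: "\<bar>vH y (f y) - y p / y q\<bar> < e \<and> 0 < y q" if y: "y \<in> W" for y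
  proof -
    interpret H: valued_field "H y" "vH y" using H_valued WS y by blast
    have yS: "y \<in> Sp" using WS y by auto
    have "fr p q y \<in> carrier (H y)" using fr_closed yS pq y by auto
    then have "\<bar>vH y (f y) - vH y (fr p q y)\<bar> < e"
      using H.v_diff_ge[of "f y" "fr p q y"] ulf_closed[OF f y] pq(4)[OF y] by simp
    moreover have "0 \<le> y q" using mult_point.x_nonneg[OF point[OF yS] pq(2)] .
    ultimately show ?thesis using fr_abs[OF yS pq(1,2) pq(3)[OF y]] pq(3)[OF y] by simp
  qed
  define W' where "W' = W \<inter> {y \<in> Sp. (2 * e) * y q < 1 * y p}"
  show thesis
  proof (rule that[of W' e])
    show "openin Top W'" unfolding W'_def using W(1) openin_less[OF pq(2,1), of 1 "2 * e"] e by (intro openin_Int) auto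
    have "vH b (f b) - b p / b q < e" using near[OF W(2)] by (simp only: abs_less_iff)
    moreover have "vH b (f b) = 4 * e" by (simp add: e_def)
    ultimately have "2 * e < b p / b q" using e by linarith
    then show "b \<in> W'" using near[OF W(2)] W bS by (simp add: W'_def pos_less_divide_eq)
    show "W' \<subseteq> W" by (auto simp: W'_def)
    fix y assume y: "y \<in> W'"
    then have yW: "y \<in> W" by (simp add: W'_def)
    have "2 * e < y p / y q" using y near[OF yW] by (simp add: W'_def pos_less_divide_eq)
    then show "e \<le> vH y (f y)" using near[OF yW] by (auto simp: abs_less_iff)
  qed (rule e)
qed

end

section \<open>Stalks\<close>

context berkovich
begin

lemma section_iff:
  "f \<in> carrier (sections A N U) \<longleftrightarrow> f \<in> (\<Pi>\<^sub>E x\<in>U. carrier (H x)) \<and>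
     (\<forall>x\<in>U. \<exists>W. openin Top W \<and> x \<in> W \<and> W \<subseteq> U \<and> ulf W f)"
proof -
  have "ulf W f \<longleftrightarrow> uniform_limit_of_fractions A W f" if "f \<in> (\<Pi>\<^sub>E x\<in>U. carrier (H x))" "W \<subseteq> U" for W
    using that by (auto simp: ulf_iff)
  then have "(\<exists>W. openin Top W \<and> x \<in> W \<and> W \<subseteq> U \<and> ulf W f) \<longleftrightarrow>
      (\<exists>W. openin Top W \<and> x \<in> W \<and> W \<subseteq> U \<and> uniform_limit_of_fractions A W f)"
    if "f \<in> (\<Pi>\<^sub>E x\<in>U. carrier (H x))" for x using that by blast
  then show ?thesis unfolding sections_def by (simp cong: conj_cong)
qed

lemma section_ops:
  "f \<otimes>\<^bsub>sections A N U\<^esub> g = (\<lambda>x\<in>U. f x \<otimes>\<^bsub>H x\<^esub> g x)"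
  "f \<oplus>\<^bsub>sections A N U\<^esub> g = (\<lambda>x\<in>U. f x \<oplus>\<^bsub>H x\<^esub> g x)"
  "\<one>\<^bsub>sections A N U\<^esub> = (\<lambda>x\<in>U. \<one>\<^bsub>H x\<^esub>)" "\<zero>\<^bsub>sections A N U\<^esub> = (\<lambda>x\<in>U. \<zero>\<^bsub>H x\<^esub>)"
  by (simp_all add: sections_def)

end

locale berkovich_point = berkovich +
  fixes b assumes b: "b \<in> Sp"
begin

sublocale Hb: valued_field "H b" "vH b" by (rule H_valued[OF b])

abbreviation "LS \<equiv> local_sections A N b"
abbreviation "grm \<equiv> germ A N b"
abbreviation "Stk \<equiv> stalk A N b"

lemma LS_iff: "(U, f) \<in> LS \<longleftrightarrow> openin Top U \<and> b \<in> U \<and> f \<in> carrier (sections A N U)"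
  by (simp add: local_sections_def)

lemma LS_D: assumes "(U, f) \<in> LS" shows "openin Top U" "b \<in> U" "U \<subseteq> Sp" "\<And>y. y \<in> U \<Longrightarrow> f y \<in> carrier (H y)"
  using assms openin_subset_Sp by (auto simp: LS_iff section_iff)

lemma LS_E:
  assumes "(U, f) \<in> LS" "x \<in> U"
  obtains W where "openin Top W" "x \<in> W" "W \<subseteq> U" "ulf W f"
  using assms by (auto simp: LS_iff section_iff)

lemma LS_I:
  assumes U: "openin Top U" "b \<in> U"
    and loc: "\<And>x. x \<in> U \<Longrightarrow> \<exists>W. openin Top W \<and> x \<in> W \<and> W \<subseteq> U \<and> ulf W f"
  shows "(U, \<lambda>x\<in>U. f x) \<in> LS"
proof -
  have "(\<lambda>x\<in>U. f x) \<in> (\<Pi>\<^sub>E x\<in>U. carrier (H x))"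
  proof (intro restrict_PiE_iff[THEN iffD2] ballI)
    fix x assume "x \<in> U"
    then show "f x \<in> carrier (H x)" using loc ulf_closed by blast
  qed
  moreover have "\<exists>W. openin Top W \<and> x \<in> W \<and> W \<subseteq> U \<and> ulf W (\<lambda>x\<in>U. f x)" if x: "x \<in> U" for x
  proof -
    obtain W where W: "openin Top W" "x \<in> W" "W \<subseteq> U" "ulf W f" using loc[OF x] by blast
    have "ulf W (\<lambda>x\<in>U. f x)" by (rule ulf_cong[OF W(4)]) (use W(3) in auto)
    then show ?thesis using W by blast
  qed
  ultimately show ?thesis using U by (simp add: LS_iff section_iff)
qed

lemma LS_ulf: assumes "openin Top W" "b \<in> W" "ulf W f" shows "(W, \<lambda>x\<in>W. f x) \<in> LS"
  using assms by (intro LS_I) auto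

lemma germ_rel_iff: "((U, f), (V, g)) \<in> germ_rel A N b \<longleftrightarrow> (U, f) \<in> LS \<and> (V, g) \<in> LS \<and>
    (\<exists>W. openin Top W \<and> b \<in> W \<and> W \<subseteq> U \<inter> V \<and> (\<forall>y\<in>W. f y = g y))"
  by (simp add: germ_rel_def)

lemma germ_relI:
  assumes "(U, f) \<in> LS" "(V, g) \<in> LS" "openin Top W" "b \<in> W" "W \<subseteq> U" "W \<subseteq> V" "\<And>y. y \<in> W \<Longrightarrow> f y = g y"
  shows "((U, f), (V, g)) \<in> germ_rel A N b"
  unfolding germ_rel_iff using assms by (intro conjI exI[of _ W] Int_greatest ballI)

lemma germ_relE:
  assumes "((U, f), (V, g)) \<in> germ_rel A N b"
  obtains W where "(U, f) \<in> LS" "(V, g) \<in> LS" "openin Top W" "b \<in> W" "W \<subseteq> U" "W \<subseteq> V"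
    "\<And>y. y \<in> W \<Longrightarrow> f y = g y"
  using assms unfolding germ_rel_iff by (elim conjE exE) (simp add: Int_subset_iff)

lemma germ_equiv: "equiv LS (germ_rel A N b)"
proof (rule equivI)
  show "germ_rel A N b \<subseteq> LS \<times> LS" by (auto simp: germ_rel_def)
  show "refl_on LS (germ_rel A N b)"
  proof (rule refl_onI, clarify)
    fix U f assume f: "(U, f) \<in> LS"
    show "((U, f), (U, f)) \<in> germ_rel A N b"
      by (rule germ_relI[OF f f LS_D(1,2)[OF f]]) auto
  qed
  show "sym (germ_rel A N b)"
  proof (rule symI, clarify)
    fix U f V g assume "((U, f), (V, g)) \<in> germ_rel A N b"
    then show "((V, g), (U, f)) \<in> germ_rel A N b"
    proof (rule germ_relE)
      fix W assume W: "(U, f) \<in> LS" "(V, g) \<in> LS" "openin Top W" "b \<in> W" "W \<subseteq> U" "W \<subseteq> V"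
        "\<And>y. y \<in> W \<Longrightarrow> f y = g y"
      show ?thesis by (rule germ_relI[OF W(2,1,3,4,6,5)]) (simp add: W(7))
    qed
  qed
  show "trans (germ_rel A N b)"
  proof (rule transI, clarify)
    fix U f V g Z h assume fg: "((U, f), (V, g)) \<in> germ_rel A N b" and gh: "((V, g), (Z, h)) \<in> germ_rel A N b"
    from fg show "((U, f), (Z, h)) \<in> germ_rel A N b"
    proof (rule germ_relE)
      fix W assume W: "(U, f) \<in> LS" "(V, g) \<in> LS" "openin Top W" "b \<in> W" "W \<subseteq> U" "W \<subseteq> V"
        "\<And>y. y \<in> W \<Longrightarrow> f y = g y"
      from gh show ?thesis
      proof (rule germ_relE)
        fix W' assume W': "(V, g) \<in> LS" "(Z, h) \<in> LS" "openin Top W'" "b \<in> W'" "W' \<subseteq> V" "W' \<subseteq> Z"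
          "\<And>y. y \<in> W' \<Longrightarrow> g y = h y"
        show ?thesis
          by (rule germ_relI[OF W(1) W'(2) openin_Int[OF W(3) W'(3)]]) (use W W' in auto)
      qed
    qed
  qed
qed

lemma germ_eq_iff:
  assumes "(U, f) \<in> LS" "(V, g) \<in> LS"
  shows "grm U f = grm V g \<longleftrightarrow> (\<exists>W. openin Top W \<and> b \<in> W \<and> W \<subseteq> U \<inter> V \<and> (\<forall>y\<in>W. f y = g y))"
  unfolding germ_def using eq_equiv_class_iff[OF germ_equiv assms] assms by (simp add: germ_rel_iff)

lemma germ_eqI:
  assumes "(U, f) \<in> LS" "(V, g) \<in> LS" "\<And>y. y \<in> U \<Longrightarrow> y \<in> V \<Longrightarrow> f y = g y"
  shows "grm U f = grm V g"
  unfolding germ_eq_iff[OF assms(1,2)] using assms LS_D[OF assms(1)] LS_D[OF assms(2)]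
  by (intro exI[of _ "U \<inter> V"]) auto

lemma germ_mem: "(V, g) \<in> grm U f \<longleftrightarrow> ((U, f), (V, g)) \<in> germ_rel A N b"
  by (simp add: germ_def)

lemma germ_self: "(U, f) \<in> LS \<Longrightarrow> (U, f) \<in> grm U f"
  unfolding germ_mem using germ_equiv by (auto simp: equiv_def refl_on_def)

lemma stalk_carrier: "carrier Stk = {grm U f | U f. (U, f) \<in> LS}"
  unfolding stalk_def germ_def by (auto simp: quotient_def)

lemma stalk_cases: assumes "s \<in> carrier Stk" obtains U f where "(U, f) \<in> LS" "s = grm U f"
  using assms by (auto simp: stalk_carrier)

lemma stalk_closed: "(U, f) \<in> LS \<Longrightarrow> grm U f \<in> carrier Stk"
  by (auto simp: stalk_carrier)

lemma LS_add:
  assumes f: "(U, f) \<in> LS" and g: "(V, g) \<in> LS"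
  shows "(U \<inter> V, \<lambda>x\<in>U \<inter> V. f x \<oplus>\<^bsub>H x\<^esub> g x) \<in> LS"
proof (rule LS_I)
  fix x assume x: "x \<in> U \<inter> V"
  obtain W where W: "openin Top W" "x \<in> W" "W \<subseteq> U" "ulf W f" using LS_E[OF f] x by blast
  obtain W' where W': "openin Top W'" "x \<in> W'" "W' \<subseteq> V" "ulf W' g" using LS_E[OF g] x by blast
  have op: "openin Top (W \<inter> W')" using W W' by blast
  have "ulf (W \<inter> W') (\<lambda>x. f x \<oplus>\<^bsub>H x\<^esub> g x)"
    by (rule ulf_add[OF openin_subset_Sp[OF op] ulf_mono[OF W(4)] ulf_mono[OF W'(4)]]) auto
  then show "\<exists>W. openin Top W \<and> x \<in> W \<and> W \<subseteq> U \<inter> V \<and> ulf W (\<lambda>x. f x \<oplus>\<^bsub>H x\<^esub> g x)"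
    using op W W' by (intro exI[of _ "W \<inter> W'"]) auto
qed (use LS_D[OF f] LS_D[OF g] in auto)

text \<open>The bounds demanded by \<open>ulf_mult\<close> are obtained by shrinking the
  neighbourhood of each point.\<close>

lemma LS_mult:
  assumes f: "(U, f) \<in> LS" and g: "(V, g) \<in> LS"
  shows "(U \<inter> V, \<lambda>x\<in>U \<inter> V. f x \<otimes>\<^bsub>H x\<^esub> g x) \<in> LS"
proof (rule LS_I)
  fix x assume x: "x \<in> U \<inter> V"
  obtain W1 where W1: "openin Top W1" "x \<in> W1" "W1 \<subseteq> U" "ulf W1 f" using LS_E[OF f] x by blast
  obtain W2 where W2: "openin Top W2" "x \<in> W2" "W2 \<subseteq> V" "ulf W2 g" using LS_E[OF g] x by blast
  obtain W where W: "openin Top W" "x \<in> W" "W \<subseteq> W1" "\<And>y. y \<in> W \<Longrightarrow> vH y (f y) < vH x (f x) + 1"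
    using ulf_bounded_near[OF W1(1,2,4), of "vH x (f x) + 1"] by auto
  obtain W' where W': "openin Top W'" "x \<in> W'" "W' \<subseteq> W2" "\<And>y. y \<in> W' \<Longrightarrow> vH y (g y) < vH x (g x) + 1"
    using ulf_bounded_near[OF W2(1,2,4), of "vH x (g x) + 1"] by auto
  have op: "openin Top (W \<inter> W')" using W W' by blast
  have "ulf (W \<inter> W') (\<lambda>x. f x \<otimes>\<^bsub>H x\<^esub> g x)"
  proof (rule ulf_mult[OF openin_subset_Sp[OF op] ulf_mono[OF W1(4)] ulf_mono[OF W2(4)]])
    show "vH y (f y) \<le> vH x (f x) + 1" "vH y (g y) \<le> vH x (g x) + 1" if "y \<in> W \<inter> W'" for y
      using W(4)[of y] W'(4)[of y] that by auto
  qed (use W W' in auto)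
  then show "\<exists>W. openin Top W \<and> x \<in> W \<and> W \<subseteq> U \<inter> V \<and> ulf W (\<lambda>x. f x \<otimes>\<^bsub>H x\<^esub> g x)"
    using op W W' W1 W2 by (intro exI[of _ "W \<inter> W'"]) auto
qed (use LS_D[OF f] LS_D[OF g] in auto)

lemma LS_minus:
  assumes f: "(U, f) \<in> LS"
  shows "(U, \<lambda>x\<in>U. \<ominus>\<^bsub>H x\<^esub> f x) \<in> LS"
proof (rule LS_I)
  fix x assume x: "x \<in> U"
  obtain W where W: "openin Top W" "x \<in> W" "W \<subseteq> U" "ulf W f" using LS_E[OF f] x by blast
  then show "\<exists>W. openin Top W \<and> x \<in> W \<and> W \<subseteq> U \<and> ulf W (\<lambda>x. \<ominus>\<^bsub>H x\<^esub> f x)"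
    using ulf_minus[OF openin_subset_Sp[OF W(1)] W(4)] by blast
qed (use LS_D[OF f] in auto)

lemma shows LS_zero: "(Sp, \<lambda>x\<in>Sp. \<zero>\<^bsub>H x\<^esub>) \<in> LS" and LS_one: "(Sp, \<lambda>x\<in>Sp. \<one>\<^bsub>H x\<^esub>) \<in> LS"
  using LS_ulf[OF openin_Sp b ulf_zero[OF subset_refl]] LS_ulf[OF openin_Sp b ulf_one[OF subset_refl]] by auto

text \<open>Common treatment of sum and product. Representatives of the two germs agree with f and g
  on smaller neighbourhoods of b, and the pointwise results agree on their intersection.\<close>

lemma germ_op:
  assumes f: "(U, f) \<in> LS" and g: "(V, g) \<in> LS"
    and cl: "\<And>U f V g. (U, f) \<in> LS \<Longrightarrow> (V, g) \<in> LS \<Longrightarrow> (U \<inter> V, \<lambda>x\<in>U \<inter> V. F x (f x) (g x)) \<in> LS"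
  shows "(\<Union>(U, f)\<in>grm U f. \<Union>(V, g)\<in>grm V g. grm (U \<inter> V) (\<lambda>x\<in>U \<inter> V. F x (f x) (g x))) =
    grm (U \<inter> V) (\<lambda>x\<in>U \<inter> V. F x (f x) (g x))"
proof -
  have *: "grm (U' \<inter> V') (\<lambda>x\<in>U' \<inter> V'. F x (f' x) (g' x)) = grm (U \<inter> V) (\<lambda>x\<in>U \<inter> V. F x (f x) (g x))"
    if f': "(U', f') \<in> grm U f" and g': "(V', g') \<in> grm V g" for U' f' V' g'
  proof -
    obtain W where "(U, f) \<in> LS" and fL: "(U', f') \<in> LS" and W: "openin Top W" "b \<in> W" "W \<subseteq> U" "W \<subseteq> U'" "\<And>y. y \<in> W \<Longrightarrow> f y = f' y"
      using f' unfolding germ_mem by (rule germ_relE) (rule that, auto)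
    obtain W' where "(V, g) \<in> LS" and gL: "(V', g') \<in> LS" and W': "openin Top W'" "b \<in> W'" "W' \<subseteq> V" "W' \<subseteq> V'" "\<And>y. y \<in> W' \<Longrightarrow> g y = g' y"
      using g' unfolding germ_mem by (rule germ_relE) (rule that, auto)
    show ?thesis
      unfolding germ_eq_iff[OF cl[OF fL gL] cl[OF f g]]
      using W W' by (intro exI[of _ "W \<inter> W'"]) (auto simp: subset_iff)
  qed
  have "(\<Union>(V', g')\<in>grm V g. grm (U' \<inter> V') (\<lambda>x\<in>U' \<inter> V'. F x (f' x) (g' x))) =
      grm (U \<inter> V) (\<lambda>x\<in>U \<inter> V. F x (f x) (g x))" if "(U', f') \<in> grm U f" for U' f'
    using germ_self[OF g] *[OF that] by (intro UN_const_eq) auto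
  then show ?thesis using germ_self[OF f] by (intro UN_const_eq) auto
qed

lemma germ_add:
  assumes "(U, f) \<in> LS" "(V, g) \<in> LS"
  shows "grm U f \<oplus>\<^bsub>Stk\<^esub> grm V g = grm (U \<inter> V) (\<lambda>x\<in>U \<inter> V. f x \<oplus>\<^bsub>H x\<^esub> g x)"
  using germ_op[OF assms LS_add] by (simp add: stalk_def section_ops)

lemma germ_mult:
  assumes "(U, f) \<in> LS" "(V, g) \<in> LS"
  shows "grm U f \<otimes>\<^bsub>Stk\<^esub> grm V g = grm (U \<inter> V) (\<lambda>x\<in>U \<inter> V. f x \<otimes>\<^bsub>H x\<^esub> g x)"
  using germ_op[OF assms LS_mult] by (simp add: stalk_def section_ops)

lemma stalk_zero: "\<zero>\<^bsub>Stk\<^esub> = grm Sp (\<lambda>x\<in>Sp. \<zero>\<^bsub>H x\<^esub>)" and stalk_one: "\<one>\<^bsub>Stk\<^esub> = grm Sp (\<lambda>x\<in>Sp. \<one>\<^bsub>H x\<^esub>)"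
  by (simp_all add: stalk_def section_ops)

text \<open>Each axiom is checked pointwise in the field \<H>(z) on a common domain;
  \<open>germ_eqI\<close> takes care of the differing domains of the two sides.\<close>

lemma stalk_cring: "cring Stk"
proof (rule cringI)
  show "abelian_group Stk"
  proof (rule abelian_groupI)
    fix x y assume xy: "x \<in> carrier Stk" "y \<in> carrier Stk"
    obtain U f where f: "(U, f) \<in> LS" "x = grm U f" using stalk_cases xy(1) by blast
    obtain V g where g: "(V, g) \<in> LS" "y = grm V g" using stalk_cases xy(2) by blast
    show "x \<oplus>\<^bsub>Stk\<^esub> y \<in> carrier Stk"
      unfolding f(2) g(2) germ_add[OF f(1) g(1)] by (rule stalk_closed[OF LS_add[OF f(1) g(1)]])
    show "x \<oplus>\<^bsub>Stk\<^esub> y = y \<oplus>\<^bsub>Stk\<^esub> x"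
      unfolding f(2) g(2) germ_add[OF f(1) g(1)] germ_add[OF g(1) f(1)]
    proof (rule germ_eqI[OF LS_add[OF f(1) g(1)] LS_add[OF g(1) f(1)]])
      fix z assume z: "z \<in> U \<inter> V" "z \<in> V \<inter> U"
      interpret H: valued_field "H z" "vH z" using H_valued LS_D(3)[OF f(1)] z by blast
      show "(\<lambda>x\<in>U \<inter> V. f x \<oplus>\<^bsub>H x\<^esub> g x) z = (\<lambda>x\<in>V \<inter> U. g x \<oplus>\<^bsub>H x\<^esub> f x) z"
        using z LS_D(4)[OF f(1)] LS_D(4)[OF g(1)] by (simp add: H.a_comm)
    qed
    fix t assume "t \<in> carrier Stk"
    then obtain Z k where k: "(Z, k) \<in> LS" "t = grm Z k" using stalk_cases by blast
    show "x \<oplus>\<^bsub>Stk\<^esub> y \<oplus>\<^bsub>Stk\<^esub> t = x \<oplus>\<^bsub>Stk\<^esub> (y \<oplus>\<^bsub>Stk\<^esub> t)"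
      unfolding f(2) g(2) k(2) germ_add[OF f(1) g(1)] germ_add[OF g(1) k(1)]
        germ_add[OF LS_add[OF f(1) g(1)] k(1)] germ_add[OF f(1) LS_add[OF g(1) k(1)]]
    proof (rule germ_eqI[OF LS_add[OF LS_add[OF f(1) g(1)] k(1)] LS_add[OF f(1) LS_add[OF g(1) k(1)]]])
      fix z assume z: "z \<in> U \<inter> V \<inter> Z" "z \<in> U \<inter> (V \<inter> Z)"
      interpret H: valued_field "H z" "vH z" using H_valued LS_D(3)[OF f(1)] z by blast
      show "(\<lambda>x\<in>U \<inter> V \<inter> Z. (\<lambda>x\<in>U \<inter> V. f x \<oplus>\<^bsub>H x\<^esub> g x) x \<oplus>\<^bsub>H x\<^esub> k x) z =
          (\<lambda>x\<in>U \<inter> (V \<inter> Z). f x \<oplus>\<^bsub>H x\<^esub> (\<lambda>x\<in>V \<inter> Z. g x \<oplus>\<^bsub>H x\<^esub> k x) x) z"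
        using z LS_D(4)[OF f(1)] LS_D(4)[OF g(1)] LS_D(4)[OF k(1)] by (simp add: H.a_assoc)
    qed
  next
    show "\<zero>\<^bsub>Stk\<^esub> \<in> carrier Stk" unfolding stalk_zero by (rule stalk_closed[OF LS_zero])
    fix x assume "x \<in> carrier Stk"
    then obtain U f where f: "(U, f) \<in> LS" "x = grm U f" using stalk_cases by blast
    show "\<zero>\<^bsub>Stk\<^esub> \<oplus>\<^bsub>Stk\<^esub> x = x"
      unfolding stalk_zero f(2) germ_add[OF LS_zero f(1)]
    proof (rule germ_eqI[OF LS_add[OF LS_zero f(1)] f(1)])
      fix z assume z: "z \<in> Sp \<inter> U" "z \<in> U"
      interpret H: valued_field "H z" "vH z" using H_valued z by blast
      show "(\<lambda>x\<in>Sp \<inter> U. (\<lambda>x\<in>Sp. \<zero>\<^bsub>H x\<^esub>) x \<oplus>\<^bsub>H x\<^esub> f x) z = f z"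
        using z LS_D(4)[OF f(1)] by simp
    qed
    show "\<exists>y\<in>carrier Stk. y \<oplus>\<^bsub>Stk\<^esub> x = \<zero>\<^bsub>Stk\<^esub>"
    proof (rule bexI[OF _ stalk_closed[OF LS_minus[OF f(1)]]])
      show "grm U (\<lambda>x\<in>U. \<ominus>\<^bsub>H x\<^esub> f x) \<oplus>\<^bsub>Stk\<^esub> x = \<zero>\<^bsub>Stk\<^esub>"
        unfolding stalk_zero f(2) germ_add[OF LS_minus[OF f(1)] f(1)]
      proof (rule germ_eqI[OF LS_add[OF LS_minus[OF f(1)] f(1)] LS_zero])
        fix z assume z: "z \<in> U \<inter> U" "z \<in> Sp"
        interpret H: valued_field "H z" "vH z" using H_valued z by blast
        show "(\<lambda>x\<in>U \<inter> U. (\<lambda>x\<in>U. \<ominus>\<^bsub>H x\<^esub> f x) x \<oplus>\<^bsub>H x\<^esub> f x) z = (\<lambda>x\<in>Sp. \<zero>\<^bsub>H x\<^esub>) z"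
          using z LS_D(4)[OF f(1)] by (simp add: H.l_neg)
      qed
    qed
  qed
  show "comm_monoid Stk"
  proof (rule comm_monoidI)
    fix x y assume xy: "x \<in> carrier Stk" "y \<in> carrier Stk"
    obtain U f where f: "(U, f) \<in> LS" "x = grm U f" using stalk_cases xy(1) by blast
    obtain V g where g: "(V, g) \<in> LS" "y = grm V g" using stalk_cases xy(2) by blast
    show "x \<otimes>\<^bsub>Stk\<^esub> y \<in> carrier Stk"
      unfolding f(2) g(2) germ_mult[OF f(1) g(1)] by (rule stalk_closed[OF LS_mult[OF f(1) g(1)]])
    show "x \<otimes>\<^bsub>Stk\<^esub> y = y \<otimes>\<^bsub>Stk\<^esub> x"
      unfolding f(2) g(2) germ_mult[OF f(1) g(1)] germ_mult[OF g(1) f(1)]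
    proof (rule germ_eqI[OF LS_mult[OF f(1) g(1)] LS_mult[OF g(1) f(1)]])
      fix z assume z: "z \<in> U \<inter> V" "z \<in> V \<inter> U"
      interpret H: valued_field "H z" "vH z" using H_valued LS_D(3)[OF f(1)] z by blast
      show "(\<lambda>x\<in>U \<inter> V. f x \<otimes>\<^bsub>H x\<^esub> g x) z = (\<lambda>x\<in>V \<inter> U. g x \<otimes>\<^bsub>H x\<^esub> f x) z"
        using z LS_D(4)[OF f(1)] LS_D(4)[OF g(1)] by (simp add: H.m_comm)
    qed
    fix t assume "t \<in> carrier Stk"
    then obtain Z k where k: "(Z, k) \<in> LS" "t = grm Z k" using stalk_cases by blast
    show "x \<otimes>\<^bsub>Stk\<^esub> y \<otimes>\<^bsub>Stk\<^esub> t = x \<otimes>\<^bsub>Stk\<^esub> (y \<otimes>\<^bsub>Stk\<^esub> t)"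
      unfolding f(2) g(2) k(2) germ_mult[OF f(1) g(1)] germ_mult[OF g(1) k(1)]
        germ_mult[OF LS_mult[OF f(1) g(1)] k(1)] germ_mult[OF f(1) LS_mult[OF g(1) k(1)]]
    proof (rule germ_eqI[OF LS_mult[OF LS_mult[OF f(1) g(1)] k(1)] LS_mult[OF f(1) LS_mult[OF g(1) k(1)]]])
      fix z assume z: "z \<in> U \<inter> V \<inter> Z" "z \<in> U \<inter> (V \<inter> Z)"
      interpret H: valued_field "H z" "vH z" using H_valued LS_D(3)[OF f(1)] z by blast
      show "(\<lambda>x\<in>U \<inter> V \<inter> Z. (\<lambda>x\<in>U \<inter> V. f x \<otimes>\<^bsub>H x\<^esub> g x) x \<otimes>\<^bsub>H x\<^esub> k x) z =
          (\<lambda>x\<in>U \<inter> (V \<inter> Z). f x \<otimes>\<^bsub>H x\<^esub> (\<lambda>x\<in>V \<inter> Z. g x \<otimes>\<^bsub>H x\<^esub> k x) x) z"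
        using z LS_D(4)[OF f(1)] LS_D(4)[OF g(1)] LS_D(4)[OF k(1)] by (simp add: H.m_assoc)
    qed
  next
    show "\<one>\<^bsub>Stk\<^esub> \<in> carrier Stk" unfolding stalk_one by (rule stalk_closed[OF LS_one])
    fix x assume "x \<in> carrier Stk"
    then obtain U f where f: "(U, f) \<in> LS" "x = grm U f" using stalk_cases by blast
    show "\<one>\<^bsub>Stk\<^esub> \<otimes>\<^bsub>Stk\<^esub> x = x"
      unfolding stalk_one f(2) germ_mult[OF LS_one f(1)]
    proof (rule germ_eqI[OF LS_mult[OF LS_one f(1)] f(1)])
      fix z assume z: "z \<in> Sp \<inter> U" "z \<in> U"
      interpret H: valued_field "H z" "vH z" using H_valued z by blast
      show "(\<lambda>x\<in>Sp \<inter> U. (\<lambda>x\<in>Sp. \<one>\<^bsub>H x\<^esub>) x \<otimes>\<^bsub>H x\<^esub> f x) z = f z"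
        using z LS_D(4)[OF f(1)] by simp
    qed
  qed
  fix x y t assume xyt: "x \<in> carrier Stk" "y \<in> carrier Stk" "t \<in> carrier Stk"
  obtain U f where f: "(U, f) \<in> LS" "x = grm U f" using stalk_cases xyt(1) by blast
  obtain V g where g: "(V, g) \<in> LS" "y = grm V g" using stalk_cases xyt(2) by blast
  obtain Z k where k: "(Z, k) \<in> LS" "t = grm Z k" using stalk_cases xyt(3) by blast
  show "(x \<oplus>\<^bsub>Stk\<^esub> y) \<otimes>\<^bsub>Stk\<^esub> t = x \<otimes>\<^bsub>Stk\<^esub> t \<oplus>\<^bsub>Stk\<^esub> y \<otimes>\<^bsub>Stk\<^esub> t"
    unfolding f(2) g(2) k(2) germ_add[OF f(1) g(1)] germ_mult[OF LS_add[OF f(1) g(1)] k(1)]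
      germ_mult[OF f(1) k(1)] germ_mult[OF g(1) k(1)] germ_add[OF LS_mult[OF f(1) k(1)] LS_mult[OF g(1) k(1)]]
  proof (rule germ_eqI[OF LS_mult[OF LS_add[OF f(1) g(1)] k(1)] LS_add[OF LS_mult[OF f(1) k(1)] LS_mult[OF g(1) k(1)]]])
    fix z assume z: "z \<in> U \<inter> V \<inter> Z" "z \<in> U \<inter> Z \<inter> (V \<inter> Z)"
    interpret H: valued_field "H z" "vH z" using H_valued LS_D(3)[OF f(1)] z by blast
    show "(\<lambda>x\<in>U \<inter> V \<inter> Z. (\<lambda>x\<in>U \<inter> V. f x \<oplus>\<^bsub>H x\<^esub> g x) x \<otimes>\<^bsub>H x\<^esub> k x) z =
        (\<lambda>x\<in>U \<inter> Z \<inter> (V \<inter> Z). (\<lambda>x\<in>U \<inter> Z. f x \<otimes>\<^bsub>H x\<^esub> k x) x \<oplus>\<^bsub>H x\<^esub> (\<lambda>x\<in>V \<inter> Z. g x \<otimes>\<^bsub>H x\<^esub> k x) x) z"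
      using z LS_D(4)[OF f(1)] LS_D(4)[OF g(1)] LS_D(4)[OF k(1)] by (simp add: H.l_distr)
  qed
qed

lemma germ_value_germ: assumes f: "(U, f) \<in> LS" shows "germ_value b (grm U f) = f b"
  unfolding germ_value_def
proof (rule the_elem_image_const)
  show "grm U f \<noteq> {}" using germ_self[OF f] by auto
  fix z assume "z \<in> grm U f"
  then show "(case z of (U, f) \<Rightarrow> f b) = f b" by (cases z) (auto simp: germ_mem germ_rel_iff)
qed

lemma germ_value_hom: "germ_value b \<in> ring_hom Stk (H b)"
proof (rule ring_hom_memI)
  fix x assume "x \<in> carrier Stk"
  then obtain U f where f: "(U, f) \<in> LS" "x = grm U f" using stalk_cases by blast
  show "germ_value b x \<in> carrier (H b)" using f LS_D[OF f(1)] by (simp add: germ_value_germ)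
  fix y assume "y \<in> carrier Stk"
  then obtain V g where g: "(V, g) \<in> LS" "y = grm V g" using stalk_cases by blast
  show "germ_value b (x \<otimes>\<^bsub>Stk\<^esub> y) = germ_value b x \<otimes>\<^bsub>H b\<^esub> germ_value b y"
    "germ_value b (x \<oplus>\<^bsub>Stk\<^esub> y) = germ_value b x \<oplus>\<^bsub>H b\<^esub> germ_value b y"
    using f g LS_D[OF f(1)] LS_D[OF g(1)]
    by (simp_all add: germ_mult germ_add germ_value_germ LS_mult LS_add)
qed (use b in \<open>simp add: stalk_one germ_value_germ LS_one\<close>)

end

section \<open>The residue field\<close>

context berkovich_point
begin

sublocale Stk: cring Stk by (rule stalk_cring)
sublocale ev: ring_hom_ring Stk "H b" "germ_value b" by unfold_locales (rule germ_value_hom)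

abbreviation "mx \<equiv> stalk_max_ideal A N b"
abbreviation "\<kappa> \<equiv> residue_field A N b"
abbreviation "emb \<equiv> residue_embed b"

lemma mx_D: assumes "i \<in> mx" shows "i \<in> carrier Stk" "germ_value b i = \<zero>\<^bsub>H b\<^esub>"
  using assms unfolding stalk_max_ideal_def by blast+

lemma mx_ideal: "ideal mx Stk"
proof -
  have "mx = a_kernel Stk (H b) (germ_value b)"
    unfolding stalk_max_ideal_def a_kernel_def' by (rule refl)
  then show ?thesis using ev.kernel_is_ideal by (simp only:)
qed

lemma \<kappa>_cring: "cring \<kappa>"
  unfolding residue_field_def by (rule ideal.quotient_is_cring[OF mx_ideal stalk_cring])

lemma cls_hom: "(\<lambda>s. mx +>\<^bsub>Stk\<^esub> s) \<in> ring_hom Stk \<kappa>"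
  unfolding residue_field_def by (rule ideal.rcos_ring_hom[OF mx_ideal])

lemma \<kappa>_cases: assumes "c \<in> carrier \<kappa>" obtains s where "s \<in> carrier Stk" "c = mx +>\<^bsub>Stk\<^esub> s"
  using assms by (auto simp: residue_field_def FactRing_def A_RCOSETS_def')

lemma emb_coset: assumes s: "s \<in> carrier Stk" shows "emb (mx +>\<^bsub>Stk\<^esub> s) = germ_value b s"
  unfolding residue_embed_def
proof (rule the_elem_image_const)
  interpret mx: ideal mx Stk by (rule mx_ideal)
  show "mx +>\<^bsub>Stk\<^esub> s \<noteq> {}" using mx.a_rcos_self[OF s] by auto
  fix t assume "t \<in> mx +>\<^bsub>Stk\<^esub> s"
  then obtain i where i: "i \<in> mx" "t = i \<oplus>\<^bsub>Stk\<^esub> s"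
    unfolding a_r_coset_def' by blast
  show "germ_value b t = germ_value b s"
    unfolding i(2) using s mx_D[OF i(1)] by simp
qed

lemma emb_hom: "emb \<in> ring_hom \<kappa> (H b)"
proof (rule ring_hom_memI)
  fix x assume "x \<in> carrier \<kappa>"
  then obtain s where s: "s \<in> carrier Stk" "x = mx +>\<^bsub>Stk\<^esub> s" by (rule \<kappa>_cases)
  show "emb x \<in> carrier (H b)" using s by (simp add: emb_coset)
  fix y assume "y \<in> carrier \<kappa>"
  then obtain t where t: "t \<in> carrier Stk" "y = mx +>\<^bsub>Stk\<^esub> t" by (rule \<kappa>_cases)
  have "x \<otimes>\<^bsub>\<kappa>\<^esub> y = mx +>\<^bsub>Stk\<^esub> (s \<otimes>\<^bsub>Stk\<^esub> t)" "x \<oplus>\<^bsub>\<kappa>\<^esub> y = mx +>\<^bsub>Stk\<^esub> (s \<oplus>\<^bsub>Stk\<^esub> t)"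
    using ring_hom_mult[OF cls_hom s(1) t(1)] ring_hom_add[OF cls_hom s(1) t(1)] s t by auto
  then show "emb (x \<otimes>\<^bsub>\<kappa>\<^esub> y) = emb x \<otimes>\<^bsub>H b\<^esub> emb y" "emb (x \<oplus>\<^bsub>\<kappa>\<^esub> y) = emb x \<oplus>\<^bsub>H b\<^esub> emb y"
    using s t by (simp_all add: emb_coset)
next
  have "\<one>\<^bsub>\<kappa>\<^esub> = mx +>\<^bsub>Stk\<^esub> \<one>\<^bsub>Stk\<^esub>" using ring_hom_one[OF cls_hom] by simp
  then show "emb \<one>\<^bsub>\<kappa>\<^esub> = \<one>\<^bsub>H b\<^esub>" by (simp add: emb_coset)
qed

sublocale \<kappa>: cring \<kappa> by (rule \<kappa>_cring)
sublocale emb: ring_hom_ring \<kappa> "H b" emb by unfold_locales (rule emb_hom)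

lemma emb_hom_cring: "ring_hom_cring \<kappa> (H b) emb"
  by (intro ring_hom_cring.intro \<kappa>_cring Hb.is_cring) (simp add: ring_hom_cring_axioms_def emb_hom)

lemma emb_zero_iff: assumes "c \<in> carrier \<kappa>" shows "emb c = \<zero>\<^bsub>H b\<^esub> \<longleftrightarrow> c = \<zero>\<^bsub>\<kappa>\<^esub>"
proof
  assume 0: "emb c = \<zero>\<^bsub>H b\<^esub>"
  obtain s where s: "s \<in> carrier Stk" "c = mx +>\<^bsub>Stk\<^esub> s" by (rule \<kappa>_cases[OF assms])
  have "germ_value b s = \<zero>\<^bsub>H b\<^esub>" using 0 s by (simp add: emb_coset)
  then have "s \<in> mx" using s(1) by (simp add: stalk_max_ideal_def)
  then have "mx +>\<^bsub>Stk\<^esub> s = mx +>\<^bsub>Stk\<^esub> \<zero>\<^bsub>Stk\<^esub>"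
    using Stk.quotient_eq_iff_same_a_r_cos[OF mx_ideal s(1) Stk.zero_closed] s(1) by (simp add: a_minus_def)
  then show "c = \<zero>\<^bsub>\<kappa>\<^esub>" using s ring_hom_zero[OF cls_hom Stk.ring_axioms \<kappa>.ring_axioms] by simp
qed simp

lemma emb_inj: assumes "c \<in> carrier \<kappa>" "c' \<in> carrier \<kappa>" "emb c = emb c'" shows "c = c'"
proof -
  have "emb (c \<ominus>\<^bsub>\<kappa>\<^esub> c') = emb c \<ominus>\<^bsub>H b\<^esub> emb c'"
    unfolding a_minus_def using assms(1,2) by simp
  also have "\<dots> = \<zero>\<^bsub>H b\<^esub>"
    unfolding assms(3) a_minus_def by (rule Hb.r_neg[OF emb.hom_closed[OF assms(2)]])
  finally have "c \<ominus>\<^bsub>\<kappa>\<^esub> c' = \<zero>\<^bsub>\<kappa>\<^esub>"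
    using emb_zero_iff[OF \<kappa>.minus_closed[OF assms(1,2)]] by blast
  then show ?thesis using \<kappa>.r_right_minus_eq[OF assms(1,2)] by (simp only:)
qed

text \<open>Together with \<open>emb_represent\<close> this describes \<kappa>(b) inside \<H>(b) as
  the values at b of uniform limits of fractions on a single neighbourhood. Germs and cosets are not
  handled explicitly from here on.\<close>

lemma emb_lift:
  assumes W: "openin Top W" "b \<in> W" and f: "ulf W f"
  obtains c where "c \<in> carrier \<kappa>" "emb c = f b"
proof -
  have L: "(W, \<lambda>x\<in>W. f x) \<in> LS" by (rule LS_ulf[OF W f])
  show thesis
  proof (rule that)
    show "mx +>\<^bsub>Stk\<^esub> grm W (\<lambda>x\<in>W. f x) \<in> carrier \<kappa>" using ring_hom_closed[OF cls_hom stalk_closed[OF L]] .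
    show "emb (mx +>\<^bsub>Stk\<^esub> grm W (\<lambda>x\<in>W. f x)) = f b" using W by (simp add: emb_coset stalk_closed L germ_value_germ)
  qed
qed

lemma emb_represent:
  assumes "c \<in> carrier \<kappa>"
  obtains W f where "openin Top W" "b \<in> W" "ulf W f" "emb c = f b"
proof -
  obtain s where s: "s \<in> carrier Stk" "c = mx +>\<^bsub>Stk\<^esub> s" by (rule \<kappa>_cases[OF assms])
  obtain U f where f: "(U, f) \<in> LS" "s = grm U f" using stalk_cases s(1) by blast
  obtain W where W: "openin Top W" "b \<in> W" "W \<subseteq> U" "ulf W f" using LS_E[OF f(1) LS_D(2)[OF f(1)]] by blast
  have "emb c = f b" using s f by (simp add: emb_coset germ_value_germ)
  then show thesis using that W by blast
qed

text \<open>A uniform limit of fractions that is nonzero at b is bounded away from 0 near b, so its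
  inverse is again a uniform limit of fractions there.\<close>

lemma \<kappa>_field: "field \<kappa>"
proof (rule \<kappa>.cring_fieldI2)
  show "\<zero>\<^bsub>\<kappa>\<^esub> \<noteq> \<one>\<^bsub>\<kappa>\<^esub>" using emb.hom_zero emb.hom_one Hb.zero_not_one by metis
  fix c assume c: "c \<in> carrier \<kappa>" "c \<noteq> \<zero>\<^bsub>\<kappa>\<^esub>"
  obtain W f where f: "openin Top W" "b \<in> W" "ulf W f" "emb c = f b" using emb_represent[OF c(1)] by blast
  have nz: "f b \<noteq> \<zero>\<^bsub>H b\<^esub>" using emb_zero_iff[OF c(1)] c(2) unfolding f(4) by blast
  obtain W' \<delta> where W': "openin Top W'" "b \<in> W'" "W' \<subseteq> W" "0 < \<delta>" "\<And>y. y \<in> W' \<Longrightarrow> \<delta> \<le> vH y (f y)"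
    using ulf_bounded_below_near[OF f(1,2,3) nz] by blast
  have "ulf W' (\<lambda>y. inv\<^bsub>H y\<^esub> (f y))"
    by (rule ulf_inverse[OF openin_subset_Sp[OF W'(1)] ulf_mono[OF f(3) W'(3)] W'(4,5)])
  then obtain c' where c': "c' \<in> carrier \<kappa>" "emb c' = inv\<^bsub>H b\<^esub> (f b)" using emb_lift[OF W'(1,2)] by blast
  have "emb (c \<otimes>\<^bsub>\<kappa>\<^esub> c') = emb c \<otimes>\<^bsub>H b\<^esub> emb c'" using c(1) c'(1) by simp
  also have "\<dots> = \<one>\<^bsub>H b\<^esub>"
    unfolding f(4) c'(2) by (rule Hb.r_inv_field[OF ulf_closed[OF f(3,2)] nz])
  finally have "emb (c \<otimes>\<^bsub>\<kappa>\<^esub> c') = emb \<one>\<^bsub>\<kappa>\<^esub>" by simp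
  then have "c \<otimes>\<^bsub>\<kappa>\<^esub> c' = \<one>\<^bsub>\<kappa>\<^esub>"
    by (rule emb_inj[OF \<kappa>.m_closed[OF c(1) c'(1)] \<kappa>.one_closed])
  then show "\<exists>c'\<in>carrier \<kappa>. c \<otimes>\<^bsub>\<kappa>\<^esub> c' = \<one>\<^bsub>\<kappa>\<^esub>" using c'(1) by blast
qed

abbreviation "v\<kappa> \<equiv> residue_abs b"

lemma v\<kappa>_eq: "v\<kappa> c = vH b (emb c)" by (simp add: residue_abs_def)

lemma \<kappa>_absolute_value: "absolute_value \<kappa> v\<kappa>"
  unfolding absolute_value_def v\<kappa>_eq by (auto simp: emb_zero_iff Hb.v_mult Hb.v_add)

text \<open>It is the strict inequality at b that spreads to a neighbourhood, which is why
  \<open>quad_henselian\<close> is stated with strict bounds on its data.\<close>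

lemma represent_bounded:
  assumes c: "c \<in> carrier \<kappa>" "v\<kappa> c < r"
  shows "\<exists>W f. openin Top W \<and> b \<in> W \<and> ulf W f \<and> emb c = f b \<and> (\<forall>y\<in>W. vH y (f y) < r)"
proof -
  obtain W f where f: "openin Top W" "b \<in> W" "ulf W f" "emb c = f b" using emb_represent[OF c(1)] by blast
  have "vH b (f b) < r" using c(2) f(4) by (simp add: v\<kappa>_eq)
  then obtain W' where W': "openin Top W'" "b \<in> W'" "W' \<subseteq> W" "\<And>y. y \<in> W' \<Longrightarrow> vH y (f y) < r"
    using ulf_bounded_near[OF f(1,2,3)] by blast
  then show ?thesis using f ulf_mono[OF f(3) W'(3)] by blast
qed

text \<open>The system is solved at every point of W although only b matters in the end: the
  solution at b belongs to \<kappa>(b) because it is the value of a function on W that is a uniform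
  limit of fractions.\<close>

lemma \<kappa>_quad_henselian: "quad_henselian \<kappa> v\<kappa>"
  unfolding quad_henselian_def
proof (intro allI impI, elim conjE)
  fix d :: nat and \<gamma> s and G e :: real
  assume G: "0 < G" and e: "0 < e" and Ge: "8 * G * (real d)\<^sup>2 * e \<le> 1"
    and \<gamma>: "\<forall>i<d. \<forall>j<d. \<forall>k<d. \<gamma> i j k \<in> carrier \<kappa> \<and> v\<kappa> (\<gamma> i j k) < G"
    and s: "\<forall>k<d. s k \<in> carrier \<kappa> \<and> v\<kappa> (s k) < e"
  let ?I = "{..<d} \<times> {..<d} \<times> {..<d}"
  have "\<forall>p\<in>?I. \<exists>Wf. openin Top (fst Wf) \<and> b \<in> fst Wf \<and> ulf (fst Wf) (snd Wf) \<and>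
      emb (case p of (i, j, k) \<Rightarrow> \<gamma> i j k) = snd Wf b \<and> (\<forall>y\<in>fst Wf. vH y (snd Wf y) < G)"
    using represent_bounded \<gamma> by fastforce
  from bchoice[OF this] obtain \<Gamma> where \<Gamma>': "\<forall>p\<in>?I. openin Top (fst (\<Gamma> p)) \<and> b \<in> fst (\<Gamma> p) \<and>
      ulf (fst (\<Gamma> p)) (snd (\<Gamma> p)) \<and> emb (case p of (i, j, k) \<Rightarrow> \<gamma> i j k) = snd (\<Gamma> p) b \<and>
      (\<forall>y\<in>fst (\<Gamma> p). vH y (snd (\<Gamma> p) y) < G)" by blast
  have "\<forall>k\<in>{..<d}. \<exists>Wf. openin Top (fst Wf) \<and> b \<in> fst Wf \<and> ulf (fst Wf) (snd Wf) \<and>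
      emb (s k) = snd Wf b \<and> (\<forall>y\<in>fst Wf. vH y (snd Wf y) < e)"
    using represent_bounded s by fastforce
  from bchoice[OF this] obtain \<Sigma> where \<Sigma>': "\<forall>k\<in>{..<d}. openin Top (fst (\<Sigma> k)) \<and> b \<in> fst (\<Sigma> k) \<and>
      ulf (fst (\<Sigma> k)) (snd (\<Sigma> k)) \<and> emb (s k) = snd (\<Sigma> k) b \<and> (\<forall>y\<in>fst (\<Sigma> k). vH y (snd (\<Sigma> k) y) < e)" by blast
  \<comment> \<open>For d = 0 both indexed intersections are over the empty set; the factor
    \<open>Sp\<close> keeps W an open subset of the spectrum.\<close>
  define W where "W = Sp \<inter> (\<Inter>p\<in>?I. fst (\<Gamma> p)) \<inter> (\<Inter>k\<in>{..<d}. fst (\<Sigma> k))"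
  define \<gamma>' where "\<gamma>' y i j k = snd (\<Gamma> (i, j, k)) y" for y i j k
  define s' where "s' y k = snd (\<Sigma> k) y" for y k
  have fin: "openin Top (Sp \<inter> \<Inter> (F ` I))" if "finite I" "\<And>i. i \<in> I \<Longrightarrow> openin Top (F i)" for F and I :: "'x set"
    using that by (induction I rule: finite_induct) (auto simp: openin_Sp Int_left_commute intro: openin_Int)
  have W: "openin Top W"
  proof -
    have "openin Top ((Sp \<inter> (\<Inter>p\<in>?I. fst (\<Gamma> p))) \<inter> (Sp \<inter> (\<Inter>k\<in>{..<d}. fst (\<Sigma> k))))"
      using \<Gamma>' \<Sigma>' by (intro openin_Int fin) auto
    moreover have "(Sp \<inter> (\<Inter>p\<in>?I. fst (\<Gamma> p))) \<inter> (Sp \<inter> (\<Inter>k\<in>{..<d}. fst (\<Sigma> k))) = W" by (auto simp: W_def)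
    ultimately show ?thesis by simp
  qed
  have WS: "W \<subseteq> Sp" by (auto simp: W_def)
  have bW: "b \<in> W" using b \<Gamma>' \<Sigma>' by (auto simp: W_def)
  have W_sub: "W \<subseteq> fst (\<Gamma> (i, j, k))" "W \<subseteq> fst (\<Sigma> k)" if "i < d" "j < d" "k < d" for i j k
    using that by (auto simp: W_def)
  have \<gamma>'u: "ulf W (\<lambda>y. \<gamma>' y i j k)" and \<gamma>'b: "emb (\<gamma> i j k) = \<gamma>' b i j k"
    and \<gamma>'G: "\<And>y. y \<in> W \<Longrightarrow> vH y (\<gamma>' y i j k) \<le> G" if "i < d" "j < d" "k < d" for i j k
  proof -
    have p: "(i, j, k) \<in> ?I" using that by auto
    note P = bspec[OF \<Gamma>' p]
    show "ulf W (\<lambda>y. \<gamma>' y i j k)" unfolding \<gamma>'_def using P ulf_mono[OF _ W_sub(1)[OF that]] by simp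
    show "emb (\<gamma> i j k) = \<gamma>' b i j k" unfolding \<gamma>'_def using P by simp
    show "vH y (\<gamma>' y i j k) \<le> G" if "y \<in> W" for y
      unfolding \<gamma>'_def using P subsetD[OF W_sub(1)[OF \<open>i < d\<close> \<open>j < d\<close> \<open>k < d\<close>] that] by (simp add: less_imp_le)
  qed
  have s'u: "ulf W (\<lambda>y. s' y k)" and s'b: "emb (s k) = s' b k" and s'e: "\<And>y. y \<in> W \<Longrightarrow> vH y (s' y k) \<le> e"
    if k: "k < d" for k
  proof -
    have p: "k \<in> {..<d}" using k by auto
    note P = bspec[OF \<Sigma>' p]
    show "ulf W (\<lambda>y. s' y k)" unfolding s'_def using P ulf_mono[OF _ W_sub(2)[OF k k k]] by simp
    show "emb (s k) = s' b k" unfolding s'_def using P by simp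
    show "vH y (s' y k) \<le> e" if "y \<in> W" for y
      unfolding s'_def using P subsetD[OF W_sub(2)[OF k k k] that] by (simp add: less_imp_le)
  qed
  have qs: "quad_system (H y) (vH y) d (\<gamma>' y) (s' y) G e" if y: "y \<in> W" for y
  proof -
    interpret H: valued_field "H y" "vH y" using H_valued WS y by blast
    show ?thesis
      by unfold_locales (use G e Ge \<gamma>'G[OF _ _ _ y] s'e[OF _ y] ulf_closed[OF \<gamma>'u y] ulf_closed[OF s'u y] in auto)
  qed
  define T where "T n k y = quad_iter (H y) d (\<gamma>' y) (s' y) n k" for n k y
  \<comment> \<open>The iterates are built by sums and products, and \<open>ulf_mult\<close> applies
    because they are bounded by 2e and the coefficients by G on all of W.\<close>
  have Tu: "ulf W (T n k)" if "k < d" for n k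
    using that
  proof (induction n arbitrary: k)
    case 0
    then show ?case unfolding T_def using ulf_zero[OF WS] by simp
  next
    case (Suc n)
    have Tb: "vH y (T n i y) \<le> 2 * e" if "i < d" "y \<in> W" for i y
      unfolding T_def using quad_system.T_le[OF qs[OF that(2)] that(1)] .
    have TT: "ulf W (\<lambda>y. T n i y \<otimes>\<^bsub>H y\<^esub> T n j y)" if "i < d" "j < d" for i j
      by (rule ulf_mult[OF WS Suc.IH[OF that(1)] Suc.IH[OF that(2)] Tb[OF that(1)] Tb[OF that(2)]])
    have TTb: "vH y (T n i y \<otimes>\<^bsub>H y\<^esub> T n j y) \<le> 2 * e * (2 * e)" if ij: "i < d" "j < d" and y: "y \<in> W" for i j y
    proof -
      interpret H: valued_field "H y" "vH y" using H_valued WS y by blast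
      note c = ulf_closed[OF Suc.IH[OF ij(1)] y] ulf_closed[OF Suc.IH[OF ij(2)] y]
      have "vH y (T n i y) * vH y (T n j y) \<le> 2 * e * (2 * e)"
        using Tb[OF ij(1) y] Tb[OF ij(2) y] c e by (intro mult_mono) auto
      then show ?thesis unfolding H.v_mult[OF c] .
    qed
    have U0: "ulf W (\<lambda>y. T n i y \<otimes>\<^bsub>H y\<^esub> T n j y \<otimes>\<^bsub>H y\<^esub> \<gamma>' y i j k)" if "i < d" "j < d" for i j
      by (rule ulf_mult[OF WS TT[OF that] \<gamma>'u[OF that Suc.prems] TTb[OF that] \<gamma>'G[OF that Suc.prems]])
    have U1: "ulf W (\<lambda>y. \<Oplus>\<^bsub>H y\<^esub>j\<in>{..<d}. T n i y \<otimes>\<^bsub>H y\<^esub> T n j y \<otimes>\<^bsub>H y\<^esub> \<gamma>' y i j k)" if "i < d" for i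
      by (rule ulf_finsum[OF WS]) (use U0[OF that] in auto)
    have U2: "ulf W (\<lambda>y. \<Oplus>\<^bsub>H y\<^esub>i\<in>{..<d}. \<Oplus>\<^bsub>H y\<^esub>j\<in>{..<d}. T n i y \<otimes>\<^bsub>H y\<^esub> T n j y \<otimes>\<^bsub>H y\<^esub> \<gamma>' y i j k)"
      by (rule ulf_finsum[OF WS]) (use U1 in auto)
    from ulf_add[OF WS U2 s'u[OF Suc.prems]]
    show ?case by (rule ulf_cong) (simp add: T_def quad_map_def)
  qed
  have "\<forall>y\<in>W. \<exists>t. \<forall>k<d. t k \<in> carrier (H y) \<and> vH y (t k) \<le> 2 * e \<and>
      (\<forall>n. vH y (T n k y \<ominus>\<^bsub>H y\<^esub> t k) \<le> 2 * e / 2 ^ n) \<and> t k = quad_map (H y) d (\<gamma>' y) (s' y) t k"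
  proof
    fix y assume y: "y \<in> W"
    have yS: "y \<in> Sp" using WS y by auto
    show "\<exists>t. \<forall>k<d. t k \<in> carrier (H y) \<and> vH y (t k) \<le> 2 * e \<and>
      (\<forall>n. vH y (T n k y \<ominus>\<^bsub>H y\<^esub> t k) \<le> 2 * e / 2 ^ n) \<and> t k = quad_map (H y) d (\<gamma>' y) (s' y) t k"
      unfolding T_def
      by (rule quad_system.quad_solution[OF qs[OF y]]) (rule mult_point.hfield_complete[OF point[OF yS]])
  qed
  \<comment> \<open>Choosing a solution separately at each y introduces no arbitrariness: its
    distance to the iterates forces it to be their limit in \<H>(y).\<close>
  from bchoice[OF this] obtain t where t: "\<forall>y\<in>W. \<forall>k<d. t y k \<in> carrier (H y) \<and> vH y (t y k) \<le> 2 * e \<and>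
      (\<forall>n. vH y (T n k y \<ominus>\<^bsub>H y\<^esub> t y k) \<le> 2 * e / 2 ^ n) \<and> t y k = quad_map (H y) d (\<gamma>' y) (s' y) (t y) k" by blast
  have t1: "t y k \<in> carrier (H y)" and t2: "vH y (t y k) \<le> 2 * e"
    and t3: "vH y (T n k y \<ominus>\<^bsub>H y\<^esub> t y k) \<le> 2 * e / 2 ^ n"
    and t4: "quad_map (H y) d (\<gamma>' y) (s' y) (t y) k = t y k" if "y \<in> W" "k < d" for y k n
    using bspec[OF t that(1), rule_format, OF that(2)] by (blast intro: sym)+
  have tu: "ulf W (\<lambda>y. t y k)" if k: "k < d" for k
  proof (rule ulf_limit[OF WS])
    show "t y k \<in> carrier (H y)" if "y \<in> W" for y by (rule t1[OF that k])
    fix r :: real assume r: "0 < r"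
    have "(\<lambda>n. 2 * e / 2 ^ n) \<longlonglongrightarrow> 0" by real_asymp
    then have "\<forall>\<^sub>F n in sequentially. 2 * e / 2 ^ n < r" using r by (rule order_tendstoD(2))
    then obtain n where n: "2 * e / 2 ^ n < r" by (auto simp: eventually_sequentially)
    have "vH y (t y k \<ominus>\<^bsub>H y\<^esub> T n k y) < r" if y: "y \<in> W" for y
    proof -
      interpret H: valued_field "H y" "vH y" using H_valued WS y by blast
      have "vH y (t y k \<ominus>\<^bsub>H y\<^esub> T n k y) = vH y (T n k y \<ominus>\<^bsub>H y\<^esub> t y k)"
        by (rule H.v_diff_commute[OF t1[OF y k] ulf_closed[OF Tu[OF k] y]])
      also have "\<dots> \<le> 2 * e / 2 ^ n" by (rule t3[OF y k])
      finally show ?thesis using n by simp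
    qed
    then show "\<exists>g. ulf W g \<and> (\<forall>y\<in>W. vH y (t y k \<ominus>\<^bsub>H y\<^esub> g y) < r)" using Tu[OF k] by blast
  qed
  have "\<forall>k\<in>{..<d}. \<exists>c. c \<in> carrier \<kappa> \<and> emb c = t b k"
  proof
    fix k assume "k \<in> {..<d}"
    then have k: "k < d" by simp
    show "\<exists>c. c \<in> carrier \<kappa> \<and> emb c = t b k"
      by (rule emb_lift[OF W bW tu[OF k]]) (intro exI conjI)
  qed
  from bchoice[OF this] obtain \<tau> where \<tau>: "\<forall>k\<in>{..<d}. \<tau> k \<in> carrier \<kappa> \<and> emb (\<tau> k) = t b k" by blast
  \<comment> \<open>The system holds at b in \<H>(b); the embedding is an injective homomorphism, so
    it holds already in \<kappa>(b).\<close>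
  have "\<tau> k = (\<Oplus>\<^bsub>\<kappa>\<^esub>i\<in>{..<d}. \<Oplus>\<^bsub>\<kappa>\<^esub>j\<in>{..<d}. \<tau> i \<otimes>\<^bsub>\<kappa>\<^esub> \<tau> j \<otimes>\<^bsub>\<kappa>\<^esub> \<gamma> i j k) \<oplus>\<^bsub>\<kappa>\<^esub> s k" (is "_ = ?S \<oplus>\<^bsub>\<kappa>\<^esub> s k")
    if k: "k < d" for k
  proof (rule emb_inj)
    show "\<tau> k \<in> carrier \<kappa>" using \<tau> k by auto
    have in1: "(\<lambda>j. \<tau> i \<otimes>\<^bsub>\<kappa>\<^esub> \<tau> j \<otimes>\<^bsub>\<kappa>\<^esub> \<gamma> i j k) \<in> {..<d} \<rightarrow> carrier \<kappa>" if "i < d" for i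
      using \<tau> \<gamma> k that by auto
    have in2: "(\<lambda>i. \<Oplus>\<^bsub>\<kappa>\<^esub>j\<in>{..<d}. \<tau> i \<otimes>\<^bsub>\<kappa>\<^esub> \<tau> j \<otimes>\<^bsub>\<kappa>\<^esub> \<gamma> i j k) \<in> {..<d} \<rightarrow> carrier \<kappa>"
      using in1 by (auto intro!: \<kappa>.finsum_closed)
    have S: "?S \<in> carrier \<kappa>" by (rule \<kappa>.finsum_closed[OF in2])
    then show "?S \<oplus>\<^bsub>\<kappa>\<^esub> s k \<in> carrier \<kappa>" using s k by simp
    have e1: "emb (\<Oplus>\<^bsub>\<kappa>\<^esub>j\<in>{..<d}. \<tau> i \<otimes>\<^bsub>\<kappa>\<^esub> \<tau> j \<otimes>\<^bsub>\<kappa>\<^esub> \<gamma> i j k) =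
        (\<Oplus>\<^bsub>H b\<^esub>j\<in>{..<d}. t b i \<otimes>\<^bsub>H b\<^esub> t b j \<otimes>\<^bsub>H b\<^esub> \<gamma>' b i j k)" if i: "i < d" for i
    proof -
      have "emb (\<Oplus>\<^bsub>\<kappa>\<^esub>j\<in>{..<d}. \<tau> i \<otimes>\<^bsub>\<kappa>\<^esub> \<tau> j \<otimes>\<^bsub>\<kappa>\<^esub> \<gamma> i j k) =
          (\<Oplus>\<^bsub>H b\<^esub>j\<in>{..<d}. (emb \<circ> (\<lambda>j. \<tau> i \<otimes>\<^bsub>\<kappa>\<^esub> \<tau> j \<otimes>\<^bsub>\<kappa>\<^esub> \<gamma> i j k)) j)"
        by (rule ring_hom_cring.hom_finsum[OF emb_hom_cring in1[OF i]])
      also have "\<dots> = (\<Oplus>\<^bsub>H b\<^esub>j\<in>{..<d}. t b i \<otimes>\<^bsub>H b\<^esub> t b j \<otimes>\<^bsub>H b\<^esub> \<gamma>' b i j k)"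
        using \<tau> \<gamma> \<gamma>'b t1[OF bW] i k ulf_closed[OF \<gamma>'u bW]
        by (intro Hb.finsum_cong') auto
      finally show ?thesis .
    qed
    have "emb ?S = (\<Oplus>\<^bsub>H b\<^esub>i\<in>{..<d}. (emb \<circ> (\<lambda>i. \<Oplus>\<^bsub>\<kappa>\<^esub>j\<in>{..<d}. \<tau> i \<otimes>\<^bsub>\<kappa>\<^esub> \<tau> j \<otimes>\<^bsub>\<kappa>\<^esub> \<gamma> i j k)) i)"
      by (rule ring_hom_cring.hom_finsum[OF emb_hom_cring in2])
    also have "\<dots> = (\<Oplus>\<^bsub>H b\<^esub>i\<in>{..<d}. \<Oplus>\<^bsub>H b\<^esub>j\<in>{..<d}. t b i \<otimes>\<^bsub>H b\<^esub> t b j \<otimes>\<^bsub>H b\<^esub> \<gamma>' b i j k)"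
      using t1[OF bW] k ulf_closed[OF \<gamma>'u bW] e1
      by (intro Hb.finsum_cong') (auto intro!: Hb.finsum_closed)
    finally have "emb (?S \<oplus>\<^bsub>\<kappa>\<^esub> s k) = quad_map (H b) d (\<gamma>' b) (s' b) (t b) k"
      using S s k s'b by (simp add: quad_map_def)
    also have "\<dots> = t b k" by (rule t4[OF bW k])
    also have "\<dots> = emb (\<tau> k)" using \<tau> k by simp
    finally show "emb (\<tau> k) = emb (?S \<oplus>\<^bsub>\<kappa>\<^esub> s k)" by simp
  qed
  moreover have "v\<kappa> (\<tau> k) \<le> 2 * e" if "k < d" for k
    using t2[OF bW that] \<tau> that by (simp add: v\<kappa>_eq)
  ultimately show "\<exists>t. \<forall>k<d. t k \<in> carrier \<kappa> \<and> v\<kappa> (t k) \<le> 2 * e \<and>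
      t k = (\<Oplus>\<^bsub>\<kappa>\<^esub>i\<in>{..<d}. \<Oplus>\<^bsub>\<kappa>\<^esub>j\<in>{..<d}. t i \<otimes>\<^bsub>\<kappa>\<^esub> t j \<otimes>\<^bsub>\<kappa>\<^esub> \<gamma> i j k) \<oplus>\<^bsub>\<kappa>\<^esub> s k"
    using \<tau> by (intro exI[of _ \<tau>]) auto
qed

end

theorem mainTheorem9:
  fixes A :: "('a, 'm) ring_scheme" and N :: "'a \<Rightarrow> real" and b :: "'a \<Rightarrow> real"
  assumes "banach_ring A N"
    and "b \<in> spectrum A N"
  shows "henselian_field TYPE('l) (residue_field A N b) (residue_abs b)"
proof -
  interpret banach_ring A N by (rule assms(1))
  interpret berkovich_point A N b by unfold_locales (rule assms(2))
  show ?thesis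
    by (rule quad_henselian_imp_henselian[OF \<kappa>_field \<kappa>_absolute_value \<kappa>_quad_henselian])
qed

end
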